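(* Let $P$ be a shift-invariant probability measure on the space $\mathcal{D}_\infty$ of down-skip-free sequences that is summarized by $\tau$. Then $P$ is a convex mixture of Markov measures governed by homogeneous $\Delta_{1,1}$ stochastic matrices. That is, there is a unique probability measure $\mu$ on $MM[\Delta_{1,1}^{(h)}]$ such that $$P(\cdot)=\int_{MM[\Delta_{1,1}^{(h)}]} Q(\cdot)\,\mu(dQ).$$
   Context: $\mathbb{N}_0=\{0,1,2,\dots\}$; $\delta_{ab}=1$ if $a=b$ and $0$ otherwise; $a_{[1:n]}=(a_1,\dots,a_n)$. For $n\ge 1$ let $\mathcal{D}_n=\{a_{[1:n]}\in\mathbb{N}_0^n: a_i-a_{i+1}\le 1\text{ for all }1\le i\le n-1\}$ (down-skip-free strings), and let $\mathcal{D}_\infty\subset\mathbb{N}_0^{\mathbb{N}}$ be the set of sequences with $a_i-a_{i+1}\le 1$ for all $i\geq 1$. Let $X_1,X_2,\dots$ denote the coordinate process on $\mathcal{D}_\infty$. The statistic $\tau=(\tau_n)_{n\in\mathbb{N}}$ is defined on $\mathcal{D}_n$ by $$\tau_n(a_{[1:n]})=\Big(a_1,\ \sum_{k=1}^n\delta_{a_k0},\ I(a_{[1:n]})\Big),\qquad I(a_{[1:n]})=(\iota_r(a_{[1:n]}))_{r\in\mathbb{N}_0},$$ $$\iota_r(a_{[1:n]})=\#\{j\in\{1,\dots,n-1\}: a_{j+1}-a_j+(1-\delta_{a_j0})=r\}.$$ A probability measure $P$ on $\mathcal{D}_\infty$ is summarized by $\tau$ if for every $n$ and every value $r$ with $P(\tau_n(X_{[1:n]})=r)>0$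 the conditional law of $X_{[1:n]}$ given $\tau_n(X_{[1:n]})=r$ is the uniform distribution on $\tau_n^{-1}(r)$. $\Delta_{1,1}^{(h)}$ denotes the set of homogeneous $\Delta_{1,1}$ stochastic matrices: infinite stochastic matrices $M=(m_{ij})_{i,j\in\mathbb{N}_0}$ for which there is a probability vector $(p_k)_{k\in\mathbb{N}_0}$ with $m_{0j}=p_j$ for all $j$, and, for $i\ge1$, $m_{ij}=p_{j-i+1}$ if $j\ge i-1$ and $m_{ij}=0$ if $j<i-1$. $MM[\Delta_{1,1}^{(h)}]$ denotes the set of (stationary, shift-ergodic) Markov measures governed by such matrices: shift-ergodic laws $Q$ on $\mathcal{D}_\infty$ for which there are $M\in\Delta_{1,1}^{(h)}$ and a probability vector $\nu$ with $\nu M=\nu$ such that $Q(X_1=x_1,\dots,X_n=x_n)=\nu_{x_1}\prod_{i=1}^{n-1}m_{x_i,x_{i+1}}$ for all $n$ and all $x_{[1:n]}$. It carries the sigma-field induced by weak convergence of measures. *)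

theory Defs
  imports "HOL-Probability.Probability"
begin

text \<open>Strings are lists and sequences are functions on \<^typ>\<open>nat\<close>, both indexed from \<open>0\<close>: the
  entry \<open>a\<^sub>i\<close> (\<open>i \<ge> 1\<close>) of a string is \<open>a ! (i - 1)\<close>, and the coordinate \<open>X\<^sub>i\<close> is
  \<open>\<lambda>x. x (i - 1)\<close>.\<close>

definition dsf_strings :: "nat \<Rightarrow> nat list set" where
  "dsf_strings n = {a. length a = n \<and> (\<forall>i. Suc i < n \<longrightarrow> int (a ! i) - int (a ! Suc i) \<le> 1)}"

definition dsf_seqs :: "(nat \<Rightarrow> nat) set" where
  "dsf_seqs = {x. \<forall>i. int (x i) - int (x (Suc i)) \<le> 1}"

text \<open>The topology on \<^typ>\<open>nat \<Rightarrow> nat\<close> is the product of the discrete topologies, and its Borel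
  sigma-field is the product sigma-field.\<close>

definition dsf_space :: "(nat \<Rightarrow> nat) measure" where
  "dsf_space = restrict_space borel dsf_seqs"

definition dsf_laws :: "(nat \<Rightarrow> nat) measure set" where
  "dsf_laws = {P. prob_space P \<and> sets P = sets dsf_space}"

definition initial_string :: "nat \<Rightarrow> (nat \<Rightarrow> nat) \<Rightarrow> nat list" where
  "initial_string n x = map x [0..<n]"

definition left_shift :: "(nat \<Rightarrow> nat) \<Rightarrow> (nat \<Rightarrow> nat)" where
  "left_shift x = (\<lambda>i. x (Suc i))"

definition shift_invariant :: "(nat \<Rightarrow> nat) measure \<Rightarrow> bool" where
  "shift_invariant P \<longleftrightarrow> (\<forall>A\<in>sets P. emeasure P (left_shift -` A \<inter> space P) = emeasure P A)"

definition shift_ergodic :: "(nat \<Rightarrow> nat) measure \<Rightarrow> bool" where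
  "shift_ergodic P \<longleftrightarrow> shift_invariant P \<and>
     (\<forall>A\<in>sets P. left_shift -` A \<inter> space P = A \<longrightarrow> emeasure P A = 0 \<or> emeasure P A = 1)"

definition iota :: "nat \<Rightarrow> nat list \<Rightarrow> nat" where
  "iota r a = card {j. Suc j < length a \<and>
     int (a ! Suc j) - int (a ! j) + (1 - of_bool (a ! j = 0)) = int r}"

definition tau :: "nat list \<Rightarrow> nat \<times> nat \<times> (nat \<Rightarrow> nat)" where
  "tau a = (a ! 0, (\<Sum>k<length a. of_bool (a ! k = 0)), (\<lambda>r. iota r a))"

text \<open>The fibres of \<^const>\<open>tau\<close> on \<^term>\<open>dsf_strings n\<close> are finite: the first entry and the
  multiset of increments leave finitely many strings. Hence \<^const>\<open>pmf_of_set\<close> below is the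
  uniform distribution.\<close>

definition summarized_by_tau :: "(nat \<Rightarrow> nat) measure \<Rightarrow> bool" where
  "summarized_by_tau P \<longleftrightarrow>
     (\<forall>n\<ge>1. \<forall>r. emeasure P {x \<in> space P. tau (initial_string n x) = r} > 0 \<longrightarrow>
        distr (uniform_measure P {x \<in> space P. tau (initial_string n x) = r}) (count_space UNIV) (initial_string n)
          = measure_pmf (pmf_of_set {a \<in> dsf_strings n. tau a = r}))"

definition probability_vector :: "(nat \<Rightarrow> real) \<Rightarrow> bool" where
  "probability_vector p \<longleftrightarrow> (\<forall>k. 0 \<le> p k) \<and> p sums 1"

definition homogeneous_Delta11 :: "(nat \<Rightarrow> nat \<Rightarrow> real) set" where
  "homogeneous_Delta11 = {M. (\<forall>i. probability_vector (M i)) \<and>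
     (\<exists>p. probability_vector p \<and> (\<forall>j. M 0 j = p j) \<and>
        (\<forall>i\<ge>1. \<forall>j. M i j = (if j \<ge> i - 1 then p (j + 1 - i) else 0)))}"

definition MM_Delta11 :: "(nat \<Rightarrow> nat) measure set" where
  "MM_Delta11 = {Q \<in> dsf_laws. shift_ergodic Q \<and>
     (\<exists>M\<in>homogeneous_Delta11. \<exists>\<nu>. probability_vector \<nu> \<and>
        (\<forall>j. (\<lambda>i. \<nu> i * M i j) sums \<nu> j) \<and>
        (\<forall>n\<ge>1. \<forall>a. length a = n \<longrightarrow>
           measure Q {x \<in> space Q. initial_string n x = a}
             = \<nu> (a ! 0) * (\<Prod>i<n - 1. M (a ! i) (a ! Suc i))))}"

text \<open>The coarsest topology on the laws that makes integration of every bounded continuous function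
  continuous.\<close>

definition weak_topology :: "(nat \<Rightarrow> nat) measure topology" where
  "weak_topology = topology_generated_by
     {{Q \<in> dsf_laws. (\<integral>x. f x \<partial>Q) \<in> U} | (f :: (nat \<Rightarrow> nat) \<Rightarrow> real) U.
        continuous_on dsf_seqs f \<and> bounded (f ` dsf_seqs) \<and> open U}"

definition MM_space :: "(nat \<Rightarrow> nat) measure measure" where
  "MM_space = restrict_space (sigma dsf_laws {V. openin weak_topology V}) MM_Delta11"

end

theory Submission imports Defs begin

text \<open>A down-skip-free path \<open>X\<close> is recorded here by its start and its increments
  \<open>R\<^sub>k = X\<^sub>k\<^sub>+\<^sub>1 - max (X\<^sub>k - 1) 0\<close>; every sequence of increments occurs. A homogeneous
  matrix with first row \<open>q\<close> governs precisely the laws under which the increments are independent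
  with distribution \<open>q\<close> and independent of the start. The theorem is therefore a de Finetti
  theorem, and its heart is that the increments of a stationary law summarized by \<open>tau\<close> are
  exchangeable given the start.

  The statistic sees the start, the multiset of increments and the number of zeros. As
  \<open>end point + length = start + sum of increments + zeros before the end\<close> (\<open>endpoint_balance\<close>), permuting
  increments preserves \<open>tau\<close> as soon as it preserves the end point. This last condition is removed
  by a coupling: two walks driven by the same increments merge once they have been at zero often
  enough (\<open>coalesce\<close>), so if zero is visited infinitely often, both arrangements can be continued by
  a common word after which the end points agree (\<open>exchangeable\<close>). A stationary path that visits
  zero only finitely often is almost surely constant (\<open>AE_zeros_or_constant\<close>). To see this, take a
  path that never goes below its start \<open>a\<close>, climbs to \<open>b\<close> and then descends from \<open>b\<close>; a loop above
  \<open>a\<close> that precedes the climb can be moved to just before the descent, where it becomes a loop above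
  \<open>b\<close>. After the move the length of the loop can be read off from the first passage below \<open>b\<close>, so the
  probabilities add up to at most one, whereas Poincare recurrence makes them add up to infinity
  (\<open>descent_above_start_null\<close>).

  By exchangeability the frequencies of the increments converge along a subsequence, and given the
  limit \<open>q\<close> the increments are independent with distribution \<open>q\<close> and independent of the start
  (\<open>de_Finetti_formula\<close>). Stationarity forces the conditional distribution of the start to be
  invariant for \<open>q\<close>. If \<open>q 0 > 0\<close>, the balance equations can be solved recursively, hence there is at
  most one such distribution (\<open>balanced_unique\<close>); if \<open>q 0 = 0\<close>, the path is constant. So the path
  itself determines a Markov law, its \<open>component\<close>, and \<open>P\<close> is the average of its components
  (\<open>component_decomposition\<close>). The components are ergodic by the same coupling: whether an invariant
  event occurs can be decided from the increments after any time, hence the event is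
  independent of itself (\<open>ergodic_if_q0_pos\<close>).

  For uniqueness, almost every path under an ergodic Markov law \<open>Q\<close> has component \<open>Q\<close>
  (\<open>AE_component_eq\<close>), so every measure that represents \<open>P\<close> is the distribution of the component
  under \<open>P\<close>. The sigma-field on the Markov laws enters through \<open>weak_open_preimage\<close>: weakly
  open sets are preimages of open sets under the countable family of cylinder probabilities.\<close>

section \<open>Paths and the words that drive them\<close>

text \<open>The state that follows \<open>s\<close> when the increment is \<open>r\<close>. Truncated subtraction absorbs the
  correction \<open>1 - \<delta>\<close> in the definition of \<open>iota\<close>.\<close>

definition advance :: "nat \<Rightarrow> nat \<Rightarrow> nat" where
  "advance s r = (s - 1) + r"

abbreviation endpoint :: "nat \<Rightarrow> nat list \<Rightarrow> nat" where
  "endpoint x w \<equiv> foldl advance x w"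

text \<open>The last state is left out so that the count is additive under concatenation of words.\<close>

fun zeros_before_end :: "nat \<Rightarrow> nat list \<Rightarrow> nat" where
  "zeros_before_end x [] = 0"
| "zeros_before_end x (r # w) = of_bool (x = 0) + zeros_before_end (advance x r) w"

fun states :: "nat \<Rightarrow> nat list \<Rightarrow> nat list" where
  "states x [] = [x]"
| "states x (r # w) = x # states (advance x r) w"

fun walk :: "nat \<Rightarrow> (nat \<Rightarrow> nat) \<Rightarrow> nat \<Rightarrow> nat" where
  "walk x s 0 = x"
| "walk x s (Suc k) = advance (walk x s k) (s k)"

definition incr :: "(nat \<Rightarrow> nat) \<Rightarrow> nat \<Rightarrow> nat" where
  "incr X i = X (Suc i) - (X i - 1)"

text \<open>Cylinders are indexed by a start and a word of increments because, unlike strings of states,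
  all such words are realized by paths.\<close>

definition cyl :: "nat \<Rightarrow> nat list \<Rightarrow> (nat \<Rightarrow> nat) set" where
  "cyl x w = {X \<in> dsf_seqs. X 0 = x \<and> initial_string (length w) (incr X) = w}"

definition shift_by :: "nat \<Rightarrow> (nat \<Rightarrow> nat) \<Rightarrow> (nat \<Rightarrow> nat)" where
  "shift_by n X = (\<lambda>i. X (n + i))"

text \<open>A step changes the state by \<open>r - 1\<close>, except that a step from zero changes it by \<open>r\<close>. Hence
  start, multiset of increments and end point together determine the number of zeros.\<close>

lemma endpoint_balance:
  "endpoint x w + length w = x + sum_list w + zeros_before_end x w"
proof (induction w arbitrary: x)
  case (Cons r w)
  show ?case using Cons[of "advance x r"] by (auto simp: advance_def)
qed simp

text \<open>Under common increments the distance of two walks stays the same, except that it drops by one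
  whenever the lower walk is at zero and the upper one is not.\<close>

lemma coalesce_below:
  "e \<le> e' \<Longrightarrow> e' \<le> e + zeros_before_end e v \<Longrightarrow> endpoint e v = endpoint e' v"
proof (induction v arbitrary: e e')
  case (Cons r v)
  show ?case
    using Cons.prems Cons.IH[of "advance e r" "advance e' r"]
    by (cases "e = 0"; cases "e' = 0") (auto simp: advance_def)
qed simp

text \<open>The walks do not cross, so when the upper one is at zero both are, and they agree from then on.\<close>

lemma coalesce_above:
  "e' \<le> e \<Longrightarrow> 0 < zeros_before_end e v \<Longrightarrow> endpoint e v = endpoint e' v"
proof (induction v arbitrary: e e')
  case (Cons r v)
  show ?case
    using Cons.prems Cons.IH[of "advance e' r" "advance e r"]
    by (cases "e = 0") (auto simp: advance_def)
qed simp

lemma coalesce: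
  assumes "e' < zeros_before_end e v"
  shows "endpoint e v = endpoint e' v"
proof (cases "e \<le> e'")
  case True then show ?thesis using coalesce_below[of e e' v] assms by simp
next
  case False then show ?thesis using coalesce_above[of e' e v] assms by simp
qed

lemma zeros_before_end_append:
  "zeros_before_end x (v @ w) = zeros_before_end x v + zeros_before_end (endpoint x v) w"
  by (induction v arbitrary: x) auto

text \<open>Away from zero the walk is an ordinary random walk, so a path that stays positive can be
  translated upwards.\<close>

lemma endpoint_add:
  assumes "1 \<le> a" and "\<forall>k\<le>length w. a \<le> endpoint a (take k w)"
  shows "endpoint (a + d) w = endpoint a w + d"
proof -
  have "k \<le> length w \<Longrightarrow> endpoint (a + d) (take k w) = endpoint a (take k w) + d" for k
  proof (induction k)
    case (Suc k)
    then have "a \<le> endpoint a (take k w)" using assms(2) by simp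
    then have "1 \<le> endpoint a (take k w)" using assms(1) by simp
    then show ?case using Suc by (simp add: take_Suc_conv_app_nth) (simp add: advance_def)
  qed simp
  from this[of "length w"] show ?thesis by simp
qed

lemma dsf_step: "X \<in> dsf_seqs \<Longrightarrow> X (Suc i) = advance (X i) (incr X i)"
proof -
  assume "X \<in> dsf_seqs"
  then have "int (X i) - int (X (Suc i)) \<le> 1" by (simp add: dsf_seqs_def)
  then show ?thesis by (simp add: advance_def incr_def)
qed

lemma initial_string_Suc: "initial_string (Suc n) s = initial_string n s @ [s n]"
  by (simp add: initial_string_def)

lemma length_initial_string [simp]: "length (initial_string n s) = n"
  by (simp add: initial_string_def)

lemma initial_string_0 [simp]: "initial_string 0 s = []"
  by (simp add: initial_string_def)

lemma nth_initial_string [simp]: "i < n \<Longrightarrow> initial_string n s ! i = s i"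
  by (simp add: initial_string_def)

lemma initial_string_add:
  "initial_string (n + m) s = initial_string n s @ initial_string m (shift_by n s)"
  by (induction m) (auto simp: initial_string_Suc shift_by_def)

lemma take_initial_string: "k \<le> n \<Longrightarrow> take k (initial_string n s) = initial_string k s"
  by (simp add: initial_string_def take_map)

lemma initial_string_eq_iff:
  "initial_string n s = v \<longleftrightarrow> length v = n \<and> (\<forall>i<n. s i = v ! i)"
  by (auto simp: list_eq_iff_nth_eq)

lemma incr_shift_by: "incr (shift_by n X) = shift_by n (incr X)"
  by (simp add: fun_eq_iff incr_def shift_by_def)

lemma shift_by_dsf: "X \<in> dsf_seqs \<Longrightarrow> shift_by n X \<in> dsf_seqs"
  by (auto simp: dsf_seqs_def shift_by_def)

lemma shift_by_shift_by: "shift_by m (shift_by n X) = shift_by (n + m) X"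
  by (simp add: shift_by_def add.assoc)

lemma shift_by_0 [simp]: "shift_by 0 X = X"
  by (simp add: shift_by_def)

lemma left_shift_eq: "left_shift = shift_by 1"
  by (auto simp: left_shift_def shift_by_def fun_eq_iff)

lemma shift_by_Suc: "shift_by (Suc n) X = left_shift (shift_by n X)"
  by (simp add: left_shift_def shift_by_def)

lemma dsf_endpoint:
  "X \<in> dsf_seqs \<Longrightarrow> X n = endpoint (X 0) (initial_string n (incr X))"
  by (induction n) (auto simp: initial_string_Suc dsf_step)

lemma walk_endpoint: "walk x s n = endpoint x (initial_string n s)"
  by (induction n) (auto simp: initial_string_Suc)

lemma incr_walk [simp]: "incr (walk x s) = s"
  by (auto simp: incr_def advance_def)

lemma walk_dsf [simp]: "walk x s \<in> dsf_seqs"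
  by (auto simp: dsf_seqs_def advance_def)

lemma zeros_before_end_card:
  "X \<in> dsf_seqs \<Longrightarrow>
    zeros_before_end (X 0) (initial_string n (incr X)) = card {k. k < n \<and> X k = 0}"
proof (induction n)
  case (Suc n)
  have "{k. k < Suc n \<and> X k = 0} = {k. k < n \<and> X k = 0} \<union> (if X n = 0 then {n} else {})"
    by (auto simp: less_Suc_eq)
  then show ?case
    using Suc by (auto simp: initial_string_Suc zeros_before_end_append dsf_endpoint[of X n, symmetric])
qed simp

lemma length_states [simp]: "length (states x w) = Suc (length w)"
  by (induction w arbitrary: x) auto

lemma nth_states: "i \<le> length w \<Longrightarrow> states x w ! i = endpoint x (take i w)"
proof (induction w arbitrary: x i)
  case (Cons r w)
  then show ?case by (cases i) auto
qed simp

lemma states_0 [simp]: "states x w ! 0 = x"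
  by (cases w) auto

lemma cyl_states: "cyl x w = {X \<in> dsf_seqs. initial_string (Suc (length w)) X = states x w}"
proof -
  have "(X 0 = x \<and> initial_string (length w) (incr X) = w) \<longleftrightarrow>
      initial_string (Suc (length w)) X = states x w" if D: "X \<in> dsf_seqs" for X
  proof
    assume l: "X 0 = x \<and> initial_string (length w) (incr X) = w"
    show "initial_string (Suc (length w)) X = states x w"
      unfolding initial_string_eq_iff
    proof (intro conjI allI impI)
      fix i assume i: "i < Suc (length w)"
      have "take i w = initial_string i (incr X)"
        using l i take_initial_string[of i "length w" "incr X"] by simp
      then show "X i = states x w ! i"
        using i l dsf_endpoint[OF D, of i] by (simp add: nth_states)
    qed simp
  next
    assume r: "initial_string (Suc (length w)) X = states x w"
    then have e: "X i = states x w ! i" if "i \<le> length w" for i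
      using that by (auto simp: initial_string_eq_iff)
    have "incr X i = w ! i" if "i < length w" for i
      using that e[of i] e[of "Suc i"]
      by (simp add: nth_states take_Suc_conv_app_nth incr_def advance_def)
    then show "X 0 = x \<and> initial_string (length w) (incr X) = w"
      using e[of 0] by (auto simp: initial_string_eq_iff)
  qed
  then show ?thesis unfolding cyl_def by blast
qed

lemma cyl_append:
  "X \<in> cyl x (w @ v) \<longleftrightarrow> X \<in> cyl x w \<and>
     initial_string (length v) (incr (shift_by (length w) X)) = v"
  by (auto simp: cyl_def initial_string_add incr_shift_by)

lemma cyl_state:
  assumes "X \<in> cyl x (w @ v)" shows "X (length w) = endpoint x w"
  using assms dsf_endpoint[of X "length w"] by (auto simp: cyl_def initial_string_add)

lemma cyl_disjoint: "length u = length v \<Longrightarrow> u \<noteq> v \<Longrightarrow> cyl x u \<inter> cyl x v = {}"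
  by (auto simp: cyl_def)

lemma dsf_string_states:
  assumes a: "a \<in> dsf_strings (Suc n)"
  obtains x w where "a = states x w" "length w = n"
proof -
  define w where "w = map (\<lambda>i. a ! Suc i - (a ! i - 1)) [0..<n]"
  have la: "length a = Suc n" using a by (simp add: dsf_strings_def)
  have st: "a ! Suc i = advance (a ! i) (w ! i)" if "i < n" for i
  proof -
    have "int (a ! i) - int (a ! Suc i) \<le> 1" using a that by (simp add: dsf_strings_def)
    then show ?thesis using that by (simp add: w_def advance_def)
  qed
  have lw: "length w = n" by (simp add: w_def)
  have ends: "i \<le> n \<Longrightarrow> a ! i = endpoint (a ! 0) (take i w)" for i
  proof (induction i)
    case (Suc i)
    then show ?case using st[of i] lw by (simp add: take_Suc_conv_app_nth)
  qed simp
  have "a = states (a ! 0) w"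
  proof (rule nth_equalityI)
    show "length a = length (states (a ! 0) w)" using la lw by simp
    fix i assume "i < length a"
    then have "i \<le> n" using la by simp
    then show "a ! i = states (a ! 0) w ! i" using ends[of i] lw by (metis nth_states)
  qed
  then show ?thesis using lw by (rule that)
qed

lemma states_dsf: "states x w \<in> dsf_strings (Suc (length w))"
proof -
  have "int (states x w ! i) - int (states x w ! Suc i) \<le> 1" if "i < length w" for i
    using that by (simp add: nth_states take_Suc_conv_app_nth) (simp add: advance_def)
  then show ?thesis by (simp add: dsf_strings_def)
qed

lemma iota_states: "iota r (states x w) = count (mset w) r"
proof -
  have inc: "int (states x w ! Suc j) - int (states x w ! j) + (1 - of_bool (states x w ! j = 0)) = int (w ! j)"
    if "j < length w" for j
    using that by (auto simp: nth_states take_Suc_conv_app_nth advance_def)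
  have "{j. Suc j < length (states x w) \<and>
       int (states x w ! Suc j) - int (states x w ! j) + (1 - of_bool (states x w ! j = 0)) = int r}
     = {j. j < length w \<and> w ! j = r}"
    by (intro Collect_cong conj_cong) (simp_all only: length_states Suc_less_eq inc of_nat_eq_iff)
  then have "iota r (states x w) = card {j. j < length w \<and> w ! j = r}" unfolding iota_def by (rule arg_cong)
  also have "\<dots> = count (mset w) r"
  proof (induction w)
    case (Cons a w)
    have "{j. j < length (a # w) \<and> (a # w) ! j = r} =
        (if a = r then {0} else {}) \<union> Suc ` {j. j < length w \<and> w ! j = r}"
    proof (rule set_eqI)
      show "j \<in> {j. j < length (a # w) \<and> (a # w) ! j = r} \<longleftrightarrow>
          j \<in> (if a = r then {0} else {}) \<union> Suc ` {j. j < length w \<and> w ! j = r}" for j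
        by (cases j) auto
    qed
    then have "card {j. j < length (a # w) \<and> (a # w) ! j = r} =
        (if a = r then 1 else 0) + card {j. j < length w \<and> w ! j = r}"
      by (auto simp: card_image card_insert_if)
    then show ?case using Cons by simp
  qed simp
  finally show ?thesis .
qed

lemma zeros_states:
  "(\<Sum>k<length (states x w). of_bool (states x w ! k = 0)) =
     zeros_before_end x w + of_bool (endpoint x w = 0)"
proof -
  have "(\<Sum>k<length (states x w). of_bool (states x w ! k = 0)) = length (filter (\<lambda>y. y = 0) (states x w))"
    by (simp add: length_filter_conv_card sum.If_cases of_bool_def Int_def del: length_states)
  also have "\<dots> = zeros_before_end x w + of_bool (endpoint x w = 0)"
    by (induction w arbitrary: x) auto
  finally show ?thesis .
qed

lemma tau_states:
  "tau (states x w) = (x, zeros_before_end x w + of_bool (endpoint x w = 0), count (mset w))"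
  unfolding tau_def zeros_states iota_states by simp

text \<open>The number of zeros agrees by \<open>endpoint_balance\<close>.\<close>

lemma tau_states_eq:
  assumes m: "mset w = mset w'" and e: "endpoint x w = endpoint x w'"
  shows "tau (states x w) = tau (states x w')"
proof -
  have "length w = length w'" "sum_list w = sum_list w'"
    using m by (auto dest: mset_eq_length) (metis sum_mset_sum_list)
  then have "zeros_before_end x w = zeros_before_end x w'"
    using endpoint_balance[of x w] endpoint_balance[of x w'] e by simp
  then show ?thesis using m e by (simp add: tau_states)
qed

text \<open>All words in a fibre are rearrangements of one word.\<close>

lemma finite_tau_fibre: "finite {a \<in> dsf_strings (Suc n). tau a = r}"
proof (cases "{a \<in> dsf_strings (Suc n). tau a = r} = {}")
  case True
  then show ?thesis by (simp only: finite.emptyI)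
next
  case False
  then obtain a where a: "a \<in> dsf_strings (Suc n)" "tau a = r" by auto
  obtain x w where xw: "a = states x w" "length w = n" using dsf_string_states[OF a(1)] .
  have "{a \<in> dsf_strings (Suc n). tau a = r} \<subseteq> states x ` {v. set v \<subseteq> set w \<and> length v = n}"
  proof
    fix b assume "b \<in> {a \<in> dsf_strings (Suc n). tau a = r}"
    then have b: "b \<in> dsf_strings (Suc n)" "tau b = r" by auto
    obtain y v where yv: "b = states y v" "length v = n" using dsf_string_states[OF b(1)] .
    have "y = x" "count (mset v) = count (mset w)" using a b xw yv by (auto simp: tau_states)
    then have "y = x" "mset v = mset w" by (auto intro: multiset_eqI)
    then show "b \<in> states x ` {v. set v \<subseteq> set w \<and> length v = n}"
      using yv by (auto dest: mset_eq_setD)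
  qed
  moreover have "finite (states x ` {v. set v \<subseteq> set w \<and> length v = n})"
    by (intro finite_imageI finite_lists_length_eq) simp
  ultimately show ?thesis by (rule finite_subset)
qed

section \<open>Cylinders determine laws\<close>

lemma sets_borel_seq:
  "sets (borel :: (nat \<Rightarrow> nat) measure) = sets (PiM UNIV (\<lambda>_. count_space UNIV))"
  by (metis (no_types, lifting) sets_PiM_cong sets_PiM_equal_borel sets_borel_eq_count_space)

lemma coordinate_borel [measurable (raw)]:
  "(\<lambda>X. X i) \<in> measurable (borel :: (nat \<Rightarrow> nat) measure) (count_space UNIV)"
  unfolding measurable_cong_sets[OF sets_borel_seq refl] by simp

text \<open>This is used both for paths, with \<open>D\<close> the down-skip-free sequences, and for sequences of
  increments, with \<open>D\<close> the whole space.\<close>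

lemma sets_restrict_borel_eq_prefix:
  fixes D :: "(nat \<Rightarrow> nat) set"
  shows "sets (restrict_space borel D) =
    sigma_sets D (range (\<lambda>a. {X \<in> D. initial_string (length a) X = a}))"
    (is "_ = sigma_sets D ?G")
proof
  have G: "?G \<subseteq> Pow D" by auto
  show "sets (restrict_space borel D) \<subseteq> sigma_sets D ?G"
  proof -
    have "(\<lambda>X. X i) \<in> measurable (sigma D ?G) (count_space UNIV)" for i
    proof (rule measurableI)
      fix A :: "nat set"
      have "(\<lambda>X. X i) -` A \<inter> space (sigma D ?G) =
          (\<Union>a\<in>{a. length a = Suc i \<and> a ! i \<in> A}. {X \<in> D. initial_string (length a) X = a})"
        (is "_ = ?U")
      proof -
        have "X \<in> ?U" if "X \<in> D" "X i \<in> A" for X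
          using that by (intro UN_I[of "initial_string (Suc i) X"]) auto
        then show ?thesis using G by (auto simp: initial_string_eq_iff space_measure_of_conv)
      qed
      moreover have "?U \<in> sets (sigma D ?G)"
      proof (rule sets.countable_UN')
        have "{X \<in> D. initial_string (length a) X = a} \<in> sigma_sets D ?G" for a
          by (intro sigma_sets.Basic rangeI)
        then show "(\<lambda>a. {X \<in> D. initial_string (length a) X = a}) ` {a. length a = Suc i \<and> a ! i \<in> A}
            \<subseteq> sets (sigma D ?G)"
          by (simp only: sets_measure_of[OF G] image_subset_iff) simp
      qed simp
      ultimately show "(\<lambda>X. X i) -` A \<inter> space (sigma D ?G) \<in> sets (sigma D ?G)" by simp
    qed simp
    then have "(\<lambda>X i. X i) \<in> measurable (sigma D ?G) (PiM UNIV (\<lambda>_. count_space UNIV))"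
      by (intro measurable_PiM_single') (auto simp: space_measure_of_conv)
    then have "(\<lambda>X. X) \<in> measurable (sigma D ?G) (borel :: (nat \<Rightarrow> nat) measure)"
      using measurable_cong_sets[OF refl sets_borel_seq] by blast
    then have "D \<inter> A \<in> sigma_sets D ?G" if "A \<in> sets borel" for A
      using measurable_sets[of "\<lambda>X. X" "sigma D ?G" borel A] that G
      by (simp add: sets_measure_of space_measure_of Int_commute)
    then show ?thesis by (auto simp: sets_restrict_space)
  qed
  show "sigma_sets D ?G \<subseteq> sets (restrict_space borel D)"
  proof -
    have "{X \<in> D. initial_string (length a) X = a} \<in> sets (restrict_space borel D)" for a
    proof -
      have "{X \<in> space borel. \<forall>i<length a. X i = a ! i} \<in> sets borel"
        by measurable
      then show ?thesis
        by (auto simp: sets_restrict_space initial_string_eq_iff image_iff)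
    qed
    moreover have "space (restrict_space borel D) = D" by (simp add: space_restrict_space)
    ultimately show ?thesis using sets.sigma_sets_subset[of ?G "restrict_space borel D"] by auto
  qed
qed

text \<open>Two prefix sets are nested or disjoint.\<close>

lemma prefix_sets_Int_stable:
  fixes D :: "(nat \<Rightarrow> nat) set"
  shows "Int_stable (range (\<lambda>a. {X \<in> D. initial_string (length a) X = a}) \<union> {{}})"
proof -
  have aux: "{X \<in> D. initial_string (length a) X = a} \<inter> {X \<in> D. initial_string (length b) X = b}
       \<in> {{X \<in> D. initial_string (length b) X = b}, {}}" if "length a \<le> length b" for a b
  proof (cases "take (length a) b = a")
    case True
    then have "initial_string (length a) X = a" if "initial_string (length b) X = b" for X
      using take_initial_string[OF \<open>length a \<le> length b\<close>, of X] that by metis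
    then have "{X \<in> D. initial_string (length a) X = a} \<inter> {X \<in> D. initial_string (length b) X = b}
       = {X \<in> D. initial_string (length b) X = b}" by blast
    then show ?thesis by blast
  next
    case False
    then have "initial_string (length a) X \<noteq> a" if "initial_string (length b) X = b" for X
      using take_initial_string[OF \<open>length a \<le> length b\<close>, of X] that by metis
    then have "{X \<in> D. initial_string (length a) X = a} \<inter> {X \<in> D. initial_string (length b) X = b} = {}"
      by blast
    then show ?thesis by blast
  qed
  show ?thesis
  proof (rule Int_stableI)
    fix A B assume A: "A \<in> range (\<lambda>a. {X \<in> D. initial_string (length a) X = a}) \<union> {{}}"
      and B: "B \<in> range (\<lambda>a. {X \<in> D. initial_string (length a) X = a}) \<union> {{}}"
    show "A \<inter> B \<in> range (\<lambda>a. {X \<in> D. initial_string (length a) X = a}) \<union> {{}}"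
    proof (cases "A = {} \<or> B = {}")
      case False
      then obtain a b where ab: "A = {X \<in> D. initial_string (length a) X = a}"
        "B = {X \<in> D. initial_string (length b) X = b}" using A B by auto
      show ?thesis
        using aux[of a b] aux[of b a] unfolding ab
        by (cases "length a \<le> length b") (auto simp: Int_commute)
    qed auto
  qed
qed

lemma finite_measure_eqI_prefix:
  fixes M N :: "(nat \<Rightarrow> nat) measure"
  assumes M: "sets M = sets (restrict_space borel D)" and N: "sets N = sets (restrict_space borel D)"
    and fin: "finite_measure M"
    and eq: "\<And>a. emeasure M {X \<in> D. initial_string (length a) X = a} =
                  emeasure N {X \<in> D. initial_string (length a) X = a}"
  shows "M = N"
proof (rule measure_eqI_generator_eq[where \<Omega> = D and A = "\<lambda>_. D" and
      E = "range (\<lambda>a. {X \<in> D. initial_string (length a) X = a}) \<union> {{}}"])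
  let ?E = "range (\<lambda>a. {X \<in> D. initial_string (length a) X = a})"
  have "sigma_sets D (?E \<union> {{}}) = sigma_sets D ?E"
    by (intro sigma_sets_eqI) (auto intro: sigma_sets.Empty)
  then show "sets M = sigma_sets D (?E \<union> {{}})" "sets N = sigma_sets D (?E \<union> {{}})"
    using M N by (simp_all add: sets_restrict_borel_eq_prefix)
  show "Int_stable (?E \<union> {{}})" by (rule prefix_sets_Int_stable)
  have "D = {X \<in> D. initial_string (length []) X = []}" by simp
  then show "range (\<lambda>_. D) \<subseteq> ?E \<union> {{}}" by blast
  show "emeasure M D \<noteq> \<infinity>" for i :: nat
    using fin by (simp add: finite_measure.emeasure_finite)
  show "emeasure M Y = emeasure N Y" if "Y \<in> ?E \<union> {{}}" for Y
    using that eq by (elim UnE rangeE) (simp_all only: emeasure_empty singleton_iff)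
  show "?E \<union> {{}} \<subseteq> Pow D" by blast
  show "(\<Union>i. D) = D" by simp
qed

lemma space_dsf_space [simp]: "space dsf_space = dsf_seqs"
  by (simp add: dsf_space_def space_restrict_space)

lemma dsf_prefix_cases:
  obtains "a = []" | x w where "{X \<in> dsf_seqs. initial_string (length a) X = a} = cyl x w"
     "a = states x w" | "{X \<in> dsf_seqs. initial_string (length a) X = a} = {}" "a \<noteq> []" "a \<notin> dsf_strings (length a)"
proof (cases "a = []")
  case False
  then obtain n where n: "length a = Suc n" by (cases a) auto
  show ?thesis
  proof (cases "a \<in> dsf_strings (Suc n)")
    case True
    then obtain x w where "a = states x w" "length w = n" by (rule dsf_string_states)
    then show ?thesis using that(2)[of x w] n by (simp add: cyl_states)
  next
    case nd: False
    have "a \<in> dsf_strings (Suc n)" if "X \<in> dsf_seqs" "initial_string (Suc n) X = a" for X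
      using that by (auto simp: dsf_strings_def dsf_seqs_def)
    then show ?thesis using that(3) nd n False by auto
  qed
qed

lemma prefix_sets_borel: "{s. initial_string (length v) s = v} \<in> sets (borel :: (nat \<Rightarrow> nat) measure)"
proof -
  have "{s \<in> space borel. \<forall>i<length v. s i = v ! i} \<in> sets (borel :: (nat \<Rightarrow> nat) measure)" by measurable
  then show ?thesis by (simp only: initial_string_eq_iff space_borel) simp
qed

lemma coordinate_dsf [measurable (raw)]: "(\<lambda>X. X i) \<in> measurable dsf_space (count_space UNIV)"
  unfolding dsf_space_def by (intro measurable_restrict_space1 coordinate_borel)

lemma measurable_seqI:
  assumes "\<And>i. (\<lambda>x. f x i) \<in> measurable M (count_space UNIV)"
  shows "f \<in> measurable M (borel :: (nat \<Rightarrow> nat) measure)"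
  using assms
  by (intro measurable_coordinatewise_then_product)
    (simp add: measurable_cong_sets[OF refl sets_borel_eq_count_space])

lemma measurable_dsfI:
  assumes "\<And>i. (\<lambda>x. f x i) \<in> measurable M (count_space UNIV)"
    and "\<And>x. x \<in> space M \<Longrightarrow> f x \<in> dsf_seqs"
  shows "f \<in> measurable M dsf_space"
  unfolding dsf_space_def using assms by (intro measurable_restrict_space2 measurable_seqI) auto

lemma walk_measurable [measurable]: "walk x \<in> measurable borel dsf_space"
proof (rule measurable_dsfI)
  show "(\<lambda>s. walk x s i) \<in> measurable borel (count_space UNIV)" for i
    by (induction i) (simp_all add: advance_def)
qed simp

lemma incr_coordinate_measurable [measurable]:
  "(\<lambda>X. incr X i) \<in> measurable dsf_space (count_space UNIV)"
  unfolding incr_def by measurable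

lemma shift_by_measurable [measurable]: "shift_by n \<in> measurable dsf_space dsf_space"
  by (rule measurable_dsfI) (auto simp: shift_by_dsf, simp add: shift_by_def)

lemma incr_measurable [measurable]: "incr \<in> measurable dsf_space borel"
  by (rule measurable_seqI) simp




lemma cyl_sets [measurable]: "cyl x w \<in> sets dsf_space"
proof -
  have "{X \<in> space dsf_space. X 0 = x \<and> (\<forall>i<length w. incr X i = w ! i)} \<in> sets dsf_space" by measurable
  also have "{X \<in> space dsf_space. X 0 = x \<and> (\<forall>i<length w. incr X i = w ! i)} = cyl x w"
    unfolding cyl_def initial_string_eq_iff space_dsf_space by blast
  finally show ?thesis .
qed

lemma dsf_law_eqI:
  assumes M: "sets M = sets dsf_space" and N: "sets N = sets dsf_space"
    and fin: "finite_measure M"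
    and eq: "\<And>x w. emeasure M (cyl x w) = emeasure N (cyl x w)"
  shows "M = N"
proof (rule finite_measure_eqI_prefix[where D = dsf_seqs])
  fix a
  show "emeasure M {X \<in> dsf_seqs. initial_string (length a) X = a} =
        emeasure N {X \<in> dsf_seqs. initial_string (length a) X = a}"
  proof (rule dsf_prefix_cases[of a])
    assume a: "a = []"
    have D: "{X \<in> dsf_seqs. initial_string (length a) X = a} = (\<Union>x. cyl x [])"
      unfolding a by (auto simp: cyl_def)
    have dis: "disjoint_family (\<lambda>x. cyl x [])" by (auto simp: disjoint_family_on_def cyl_def)
    have "range (\<lambda>x. cyl x []) \<subseteq> sets M" "range (\<lambda>x. cyl x []) \<subseteq> sets N"
      unfolding M N by (rule image_subsetI, rule cyl_sets)+
    from suminf_emeasure[OF this(1) dis] suminf_emeasure[OF this(2) dis]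
    show ?thesis unfolding D by (simp add: eq)
  next
    fix x w
    assume "{X \<in> dsf_seqs. initial_string (length a) X = a} = cyl x w"
    then show ?thesis by (simp only: eq)
  next
    assume "{X \<in> dsf_seqs. initial_string (length a) X = a} = {}"
    then show ?thesis by (simp only: emeasure_empty)
  qed
qed (use M N fin in \<open>simp_all add: dsf_space_def\<close>)

section \<open>Stationary path laws\<close>

lemma (in finite_measure) emeasure_UN_eq:
  assumes "countable I" "\<And>i. i \<in> I \<Longrightarrow> A i \<in> sets M" "\<And>i. i \<in> I \<Longrightarrow> B i \<in> sets M"
    and "disjoint_family_on A I" "disjoint_family_on B I"
    and "\<And>i. i \<in> I \<Longrightarrow> emeasure M (A i) = emeasure M (B i)"
  shows "emeasure M (\<Union>i\<in>I. A i) = emeasure M (\<Union>i\<in>I. B i)"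
  using assms by (simp add: emeasure_UN_countable cong: nn_integral_cong_simp)

locale path_law = prob_space P for P :: "(nat \<Rightarrow> nat) measure" +
  assumes sets_P [measurable_cong]: "sets P = sets dsf_space"
begin

lemma space_P [simp]: "space P = dsf_seqs"
  using sets_eq_imp_space_eq[OF sets_P] by simp

lemma cyl_sets_P: "cyl x w \<in> sets P"
  unfolding sets_P by (rule cyl_sets)

lemma Collect_cyl_sets:
  assumes "{X \<in> space P. Q X} \<in> sets P"
  shows "{X \<in> cyl x w. Q X} \<in> sets P"
proof -
  have "{X \<in> cyl x w. Q X} = cyl x w \<inter> {X \<in> space P. Q X}" by (auto simp: cyl_def)
  then show ?thesis using cyl_sets_P assms by simp
qed

end

locale stationary_law = path_law +
  assumes invariant: "shift_invariant P"
begin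

lemma shift_by_measurable_P [measurable]: "shift_by n \<in> measurable P P"
  using shift_by_measurable measurable_cong_sets[OF sets_P sets_P] by blast

lemma emeasure_shift_by:
  assumes A: "A \<in> sets P"
  shows "emeasure P (shift_by n -` A \<inter> dsf_seqs) = emeasure P A"
proof (induction n)
  case 0
  have "A \<subseteq> dsf_seqs" using sets.sets_into_space[OF A] by simp
  then show ?case by (simp add: Int_absorb2)
next
  case (Suc n)
  have "shift_by n -` A \<inter> dsf_seqs \<in> sets P"
    using measurable_sets[OF shift_by_measurable_P A] by simp
  then have "emeasure P (left_shift -` (shift_by n -` A \<inter> dsf_seqs) \<inter> space P) = emeasure P (shift_by n -` A \<inter> dsf_seqs)"
    using invariant by (simp only: shift_invariant_def)
  moreover have "left_shift -` (shift_by n -` A \<inter> dsf_seqs) \<inter> space P = shift_by (Suc n) -` A \<inter> dsf_seqs"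
    using shift_by_dsf[of _ 1] by (auto simp: left_shift_eq shift_by_shift_by)
  ultimately show ?case using Suc by simp
qed

lemma distr_shift_by: "distr P P (shift_by n) = P"
  by (rule measure_eqI) (simp_all add: emeasure_distr emeasure_shift_by)

lemma AE_shift_by:
  assumes "AE X in P. Q X"
  shows "AE X in P. Q (shift_by n X)"
proof (rule AE_distrD[OF shift_by_measurable_P])
  show "AE X in distr P P (shift_by n). Q X" unfolding distr_shift_by by (rule assms)
qed

lemma AE_subset_eq:
  assumes [measurable]: "A \<in> sets P" "B \<in> sets P" and "A \<subseteq> B" "emeasure P A = emeasure P B"
  shows "AE X in P. X \<in> B \<longrightarrow> X \<in> A"
proof -
  have "emeasure P (B - A) = 0"
    using assms by (simp add: emeasure_Diff)
  then have "AE X in P. X \<notin> B - A" by (intro AE_not_in) (simp add: null_sets_def)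
  then show ?thesis by simp
qed

text \<open>The set is contained in its preimage, and both have the same probability.\<close>

lemma AE_backward_invariant:
  assumes A: "A \<in> sets P" and "\<And>X. X \<in> A \<Longrightarrow> shift_by n X \<in> A"
  shows "AE X in P. shift_by n X \<in> A \<longrightarrow> X \<in> A"
proof -
  have "AE X in P. X \<in> shift_by n -` A \<inter> dsf_seqs \<longrightarrow> X \<in> A"
    using assms measurable_sets[OF shift_by_measurable_P A] sets.sets_into_space[OF A]
    by (intro AE_subset_eq) (auto simp: emeasure_shift_by)
  then show ?thesis by (rule AE_mp) (auto intro!: AE_I2)
qed

text \<open>Poincare recurrence: the sets of paths that visit \<open>B\<close> after time \<open>n\<close> decrease in \<open>n\<close> and all
  have the same probability.\<close>

lemma AE_recurrent:
  assumes B[measurable]: "B \<in> sets P"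
  shows "AE X in P. X \<in> B \<longrightarrow> (\<forall>n. \<exists>k\<ge>n. shift_by k X \<in> B)"
proof -
  define A where "A = {X \<in> space P. \<exists>k. shift_by k X \<in> B}"
  have [measurable]: "A \<in> sets P" unfolding A_def by measurable
  have "AE X in P. X \<in> A \<longrightarrow> shift_by n X \<in> A" for n
  proof -
    have "AE X in P. X \<in> A \<longrightarrow> X \<in> shift_by n -` A \<inter> dsf_seqs"
    proof (rule AE_subset_eq)
      show "shift_by n -` A \<inter> dsf_seqs \<in> sets P"
        using measurable_sets[OF shift_by_measurable_P \<open>A \<in> sets P\<close>] by simp
      show "shift_by n -` A \<inter> dsf_seqs \<subseteq> A" by (auto simp: A_def shift_by_shift_by)
    qed (simp_all add: emeasure_shift_by)
    then show ?thesis by (rule AE_mp) (auto intro!: AE_I2)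
  qed
  then have "AE X in P. \<forall>n. X \<in> A \<longrightarrow> shift_by n X \<in> A" unfolding AE_all_countable by blast
  then show ?thesis
  proof (rule AE_mp, intro AE_I2 impI allI)
    fix X n assume *: "X \<in> space P" "\<forall>n. X \<in> A \<longrightarrow> shift_by n X \<in> A" "X \<in> B"
    then have "X \<in> A" unfolding A_def by (auto intro: exI[of _ 0])
    then have "shift_by n X \<in> A" using * by blast
    then obtain k where "shift_by (n + k) X \<in> B" by (auto simp: A_def shift_by_shift_by)
    then show "\<exists>k\<ge>n. shift_by k X \<in> B" by (intro exI[of _ "n + k"]) simp
  qed
qed

end

section \<open>Partial exchangeability and the dichotomy\<close>

text \<open>The consequence of being summarized by \<open>tau\<close> on which everything below rests. It is shared by
  the Markov laws, so that what follows applies to them as well.\<close>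

locale partially_exchangeable = stationary_law +
  assumes swap: "mset w = mset w' \<Longrightarrow> endpoint x w = endpoint x w' \<Longrightarrow>
    emeasure P (cyl x w) = emeasure P (cyl x w')"
begin

text \<open>Let \<open>b\<close> be the end point of \<open>s\<close>. A loop at \<open>a\<close> that stays above \<open>a\<close> may be moved from before \<open>s\<close>
  to after \<open>s\<close>, where it becomes a loop at \<open>b\<close> that stays above \<open>b\<close>; since neither position meets
  zero, the statistic does not change. In the new position, the descent that follows is the first passage below
  \<open>b\<close> after \<open>s\<close>, so different lengths of the loop give disjoint events. Therefore the probabilities of
  returning to the event at time \<open>L\<close> are summable over \<open>L\<close>, which recurrence allows only for a null
  event.\<close>

lemma descent_above_start_null:
  assumes a: "1 \<le> a"
  shows "emeasure P {X \<in> cyl a (s @ [0]). \<forall>k. a \<le> X k} = 0"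
proof -
  define B where "B = {X \<in> cyl a (s @ [0]). \<forall>k. a \<le> X k}"
  define j where "j = length s"
  define b where "b = endpoint a s"
  have B[measurable]: "B \<in> sets P"
    unfolding B_def by (rule Collect_cyl_sets) measurable
  have Bdsf: "X \<in> dsf_seqs" if "X \<in> B" for X using that by (auto simp: B_def cyl_def)
  have "B = {}" if nb: "\<not> a \<le> b"
  proof -
    have "X j = b" if "X \<in> B" for X
      using that cyl_state[of X a s "[0]"] by (simp add: B_def j_def b_def)
    then show ?thesis using nb by (auto simp: B_def)
  qed
  moreover have "emeasure P B = 0" if ab: "a \<le> b"
  proof -
    \<comment> \<open>\<open>W L\<close>: loops of length \<open>L\<close> at \<open>a\<close> above \<open>a\<close>; \<open>D L\<close>: first passage below \<open>b\<close> exactly after \<open>L + 1\<close>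
      steps from the end of \<open>s\<close>; \<open>R L\<close>: return to the event at time \<open>L\<close>\<close>
    define W where "W L = {w. length w = L \<and> endpoint a w = a \<and> (\<forall>k\<le>L. a \<le> endpoint a (take k w))}" for L
    define D where "D L = {X \<in> space P. (\<forall>k\<le>L. b \<le> X (j + k)) \<and> X (j + Suc L) < b}" for L
    define R where "R L = {X \<in> B. shift_by L X \<in> B}" for L
    have D[measurable]: "D L \<in> sets P" for L unfolding D_def by measurable
    have R[measurable]: "R L \<in> sets P" for L
    proof -
      have "R L = B \<inter> (shift_by L -` B \<inter> space P)" using Bdsf by (auto simp: R_def)
      then show ?thesis using measurable_sets[OF shift_by_measurable_P B] B by auto
    qed
    have endb: "endpoint b (take k w) = endpoint a (take k w) + (b - a)" if "w \<in> W L" "k \<le> L" for w L k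
      using endpoint_add[OF a, of "take k w" "b - a"] that ab by (auto simp: W_def min_def)
    have "emeasure P (R L) \<le> emeasure P (D L)" for L
    proof -
      have "R L \<subseteq> (\<Union>w\<in>W L. cyl a (w @ s @ [0]))"
      proof
        fix X assume "X \<in> R L"
        then have 1: "X \<in> B" "shift_by L X \<in> B" by (auto simp: R_def)
        define w where "w = initial_string L (incr X)"
        have X0: "X 0 = a" and dsf: "X \<in> dsf_seqs" using 1 by (auto simp: B_def cyl_def)
        have st: "endpoint a (take k w) = X k" if "k \<le> L" for k
          using that dsf_endpoint[OF dsf, of k] X0 by (simp add: w_def take_initial_string)
        have "X L = a" using 1 by (simp add: B_def cyl_def shift_by_def)
        then have "w \<in> W L" using st[of L] st 1 by (auto simp: W_def w_def B_def)
        moreover have "X \<in> cyl a (w @ s @ [0])"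
        proof -
          have "X \<in> cyl a w" using X0 dsf by (simp add: cyl_def w_def)
          moreover have "initial_string (length (s @ [0])) (incr (shift_by (length w) X)) = s @ [0]"
            using 1(2) unfolding B_def cyl_def by (simp add: w_def)
          ultimately show ?thesis unfolding cyl_append[of X a w] by blast
        qed
        ultimately show "X \<in> (\<Union>w\<in>W L. cyl a (w @ s @ [0]))" by blast
      qed
      then have "emeasure P (R L) \<le> emeasure P (\<Union>w\<in>W L. cyl a (w @ s @ [0]))"
        by (rule emeasure_mono) (intro sets.countable_UN' cyl_sets_P image_subsetI countableI_type)
      also have "\<dots> = emeasure P (\<Union>w\<in>W L. cyl a (s @ w @ [0]))"
      proof (rule emeasure_UN_eq)
        show "emeasure P (cyl a (w @ s @ [0])) = emeasure P (cyl a (s @ w @ [0]))" if "w \<in> W L" for w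
        proof (rule swap)
          have l: "length w = L" "endpoint a w = a" using that by (auto simp: W_def)
          have "endpoint b w = b" using endb[OF that, of L] l ab by simp
          then show "endpoint a (w @ s @ [0]) = endpoint a (s @ w @ [0])" using l by (simp add: b_def)
        qed simp
        show "disjoint_family_on (\<lambda>w. cyl a (w @ s @ [0])) (W L)"
          unfolding disjoint_family_on_def by (intro ballI impI cyl_disjoint) (auto simp: W_def)
        show "disjoint_family_on (\<lambda>w. cyl a (s @ w @ [0])) (W L)"
          unfolding disjoint_family_on_def by (intro ballI impI cyl_disjoint) (auto simp: W_def)
      qed (intro countableI_type cyl_sets_P)+
      also have "\<dots> \<le> emeasure P (D L)"
      proof (rule emeasure_mono[OF _ D], intro UN_least subsetI)
        fix w X assume w: "w \<in> W L" and X: "X \<in> cyl a (s @ w @ [0])"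
        have l: "length w = L" "endpoint a w = a" using w by (auto simp: W_def)
        have st: "X (j + k) = endpoint b (take k w)" if "k \<le> L" for k
        proof -
          have "(s @ take k w) @ (drop k w @ [0]) = s @ w @ [0]"
            by (metis append_assoc append_take_drop_id)
          then have "X \<in> cyl a ((s @ take k w) @ (drop k w @ [0]))" using X by metis
          from cyl_state[OF this] show ?thesis using that l by (simp add: j_def b_def)
        qed
        have "X (length (s @ w @ [0])) = endpoint a (s @ w @ [0])"
          using X cyl_state[of X a "s @ w @ [0]" "[]"] by simp
        moreover have "endpoint b w = b" using endb[OF w, of L] l ab by simp
        ultimately have "X (j + Suc L) = b - 1"
          using l by (simp add: j_def b_def advance_def)
        then have "X (j + Suc L) < b" using a ab by simp
        moreover have "b \<le> X (j + k)" if "k \<le> L" for k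
        proof -
          have "a \<le> endpoint a (take k w)" using w that by (auto simp: W_def)
          then show ?thesis using st[OF that] endb[OF w that] ab by simp
        qed
        ultimately show "X \<in> D L" using X by (simp add: D_def cyl_def)
      qed
      finally show ?thesis .
    qed
    then have le: "measure P (R L) \<le> measure P (D L)" for L
      by (simp add: emeasure_eq_measure)
    have "disjoint_family D"
      unfolding disjoint_family_on_def
    proof (intro ballI impI)
      have *: "D m \<inter> D n = {}" if "m < n" for m n
      proof -
        have "b \<le> X (j + Suc m)" if "X \<in> D n" for X
          using that \<open>m < n\<close> unfolding D_def by (blast intro: Suc_leI)
        then show ?thesis unfolding D_def by (fastforce simp: not_less)
      qed
      fix m n :: nat assume "m \<noteq> n"
      then show "D m \<inter> D n = {}" using *[of m n] *[of n m] by (auto simp: neq_iff)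
    qed
    then have "(\<lambda>L. measure P (D L)) sums measure P (\<Union>L. D L)"
      by (intro finite_measure_UNION image_subsetI D)
    then have "summable (\<lambda>L. measure P (D L))" by (rule sums_summable)
    then have "summable (\<lambda>L. measure P (R L))"
      by (rule summable_comparison_test'[where N = 0]) (use le in simp)
    then have "AE X in P. eventually (\<lambda>L. X \<in> space P - R L) sequentially"
      by (intro borel_cantelli_AE1 R) (simp add: emeasure_eq_measure)
    moreover have "AE X in P. X \<in> B \<longrightarrow> (\<forall>n. \<exists>k\<ge>n. shift_by k X \<in> B)" by (rule AE_recurrent[OF B])
    ultimately have "AE X in P. X \<notin> B"
    proof eventually_elim
      case (elim X)
      show ?case
      proof
        assume "X \<in> B"
        from elim(1) obtain n where n: "\<And>L. n \<le> L \<Longrightarrow> X \<notin> R L"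
          by (auto simp: eventually_sequentially)
        obtain k where "n \<le> k" "shift_by k X \<in> B" using elim(2) \<open>X \<in> B\<close> by blast
        then show False using n[of k] \<open>X \<in> B\<close> by (simp add: R_def)
      qed
    qed
    then show ?thesis using AE_iff_null_sets[OF B] by (simp add: null_sets_def)
  qed
  ultimately have "emeasure P B = 0" by (cases "a \<le> b") auto
  then show ?thesis by (simp only: B_def)
qed

text \<open>The set of nondecreasing paths that start at height at least \<open>a\<close> is invariant under the shift,
  so backward invariance shows that the start is as high as any later state.\<close>

lemma AE_nondecreasing_constant:
  "AE X in P. (\<forall>j. X j \<le> X (Suc j)) \<longrightarrow> (\<forall>n. X n = X 0)"
proof -
  define U where "U a = {X \<in> space P. a \<le> X 0 \<and> (\<forall>j. X j \<le> X (Suc j))}" for a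
  have U: "U a \<in> sets P" for a unfolding U_def by measurable
  have mono: "X 0 \<le> X n" if "\<forall>j. X j \<le> X (Suc j)" for X :: "nat \<Rightarrow> nat" and n
    using lift_Suc_mono_le[of X 0 n] that by auto
  have "AE X in P. shift_by n X \<in> U a \<longrightarrow> X \<in> U a" for n a
  proof (rule AE_backward_invariant[OF U])
    fix X assume u: "X \<in> U a"
    then have "a \<le> X n" using mono[of X n] by (auto simp: U_def)
    then show "shift_by n X \<in> U a" using u shift_by_dsf by (simp add: U_def) (simp add: shift_by_def)
  qed
  then have "AE X in P. \<forall>n a. shift_by n X \<in> U a \<longrightarrow> X \<in> U a" unfolding AE_all_countable by blast
  then show ?thesis
  proof (rule AE_mp, intro AE_I2 impI allI)
    fix X n assume *: "X \<in> space P" "\<forall>n a. shift_by n X \<in> U a \<longrightarrow> X \<in> U a" "\<forall>j. X j \<le> X (Suc j)"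
    have "shift_by n X \<in> U (X n)"
      using * shift_by_dsf by (simp add: U_def) (simp add: shift_by_def)
    then have "X \<in> U (X n)" using * by blast
    then show "X n = X 0" using mono[OF *(3), of n] by (auto simp: U_def)
  qed
qed

lemma AE_constant_if_start_minimal:
  "AE X in P. 1 \<le> X 0 \<and> (\<forall>k. X 0 \<le> X k) \<longrightarrow> (\<forall>n. X n = X 0)"
proof -
  have "AE X in P. 1 \<le> a \<longrightarrow> X \<notin> {X \<in> cyl a (s @ [0]). \<forall>k. a \<le> X k}" for a s
  proof (cases "1 \<le> a")
    case True
    have "{X \<in> cyl a (s @ [0]). \<forall>k. a \<le> X k} \<in> sets P"
      by (rule Collect_cyl_sets) measurable
    then have "{X \<in> cyl a (s @ [0]). \<forall>k. a \<le> X k} \<in> null_sets P"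
      using descent_above_start_null[OF True, of s] by (simp only: null_sets_def mem_Collect_eq simp_thms)
    from AE_not_in[OF this] show ?thesis by (rule AE_mp) (intro AE_I2 impI, assumption)
  qed simp
  then have "AE X in P. \<forall>a s. 1 \<le> a \<longrightarrow> X \<notin> {X \<in> cyl a (s @ [0]). \<forall>k. a \<le> X k}"
    unfolding AE_all_countable by blast
  with AE_nondecreasing_constant AE_space[of P] show ?thesis
  proof eventually_elim
    case (elim X)
    show ?case
    proof (intro impI)
      assume "1 \<le> X 0 \<and> (\<forall>k. X 0 \<le> X k)"
      then have min: "1 \<le> X 0" "\<forall>k. X 0 \<le> X k" by auto
      have dsf: "X \<in> dsf_seqs" using elim(2) by simp
      have "X j \<le> X (Suc j)" for j
      proof -
        have "initial_string (Suc j) (incr X) \<noteq> initial_string j (incr X) @ [0]"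
          using elim(3)[rule_format, OF min(1), of "initial_string j (incr X)"] min dsf by (auto simp: cyl_def)
        then have "incr X j \<noteq> 0" by (simp add: initial_string_Suc)
        then show ?thesis by (simp add: incr_def)
      qed
      then show "\<forall>n. X n = X 0" using elim(1) by blast
    qed
  qed
qed

text \<open>If zeros stop, shift the path to a time at which it attains its minimum over the zero-free
  remainder; the shifted path is constant, and backward invariance carries this to the whole path.\<close>

lemma AE_zeros_or_constant:
  "AE X in P. (\<forall>n. \<exists>k\<ge>n. X k = 0) \<or> (1 \<le> X 0 \<and> (\<forall>k. X k = X 0))"
proof -
  define K where "K = {X \<in> space P. 1 \<le> X 0 \<and> (\<forall>k. X k = X 0)}"
  have K: "K \<in> sets P" unfolding K_def by measurable
  have "AE X in P. shift_by n X \<in> K \<longrightarrow> X \<in> K" for n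
  proof (rule AE_backward_invariant[OF K])
    fix X assume k: "X \<in> K"
    then obtain c where "\<And>i. X i = c" unfolding K_def by blast
    then have "shift_by n X = X" by (simp add: shift_by_def fun_eq_iff)
    then show "shift_by n X \<in> K" using k by simp
  qed
  then have 1: "AE X in P. \<forall>n. shift_by n X \<in> K \<longrightarrow> X \<in> K" unfolding AE_all_countable by blast
  have 2: "AE X in P. \<forall>n. 1 \<le> shift_by n X 0 \<and> (\<forall>k. shift_by n X 0 \<le> shift_by n X k) \<longrightarrow>
      (\<forall>i. shift_by n X i = shift_by n X 0)"
    using AE_shift_by[OF AE_constant_if_start_minimal] unfolding AE_all_countable by blast
  from 1 2 AE_space[of P] show ?thesis
  proof eventually_elim
    case (elim X)
    show ?case
    proof (rule disjCI)
      assume "\<not> (1 \<le> X 0 \<and> (\<forall>k. X k = X 0))"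
      then have nK: "X \<notin> K" by (auto simp: K_def)
      show "\<forall>n. \<exists>k\<ge>n. X k = 0"
      proof (rule ccontr)
        assume "\<not> (\<forall>n. \<exists>k\<ge>n. X k = 0)"
        then obtain n where n: "\<forall>k\<ge>n. X k \<noteq> 0" by auto
        define m where "m = (ARG_MIN X k. n \<le> k)"
        have m: "n \<le> m" "\<And>k. n \<le> k \<Longrightarrow> X m \<le> X k"
          using arg_min_nat_lemma[of "\<lambda>k. n \<le> k" n X] by (auto simp: m_def)
        have "1 \<le> shift_by m X 0 \<and> (\<forall>k. shift_by m X 0 \<le> shift_by m X k)"
          using m n by (simp add: shift_by_def Suc_le_eq)
        moreover from this have "\<forall>i. shift_by m X i = shift_by m X 0" using elim(2) by blast
        ultimately have "shift_by m X \<in> K" using elim(3) shift_by_dsf by (simp add: K_def)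
        then show False using elim(1) nK by blast
      qed
    qed
  qed
qed

text \<open>Continue both words by a common word \<open>v\<close> that makes the end points agree; then partial
  exchangeability applies. Such a \<open>v\<close> exists almost surely by \<open>coalesce\<close> when zero is visited infinitely
  often. A constant path has only ones as increments, and a word of ones has no other rearrangement.\<close>

lemma exchangeable_le:
  assumes m: "mset w = mset w'"
  shows "measure P (cyl x w) \<le> measure P (cyl x w')"
proof (cases "w = w'")
  case False
  have l: "length w' = length w" using m by (metis size_mset)
  define n where "n = length w"
  define e where "e = endpoint x w"
  define e' where "e' = endpoint x w'"
  define G where "G L = {v. length v = L \<and> endpoint e v = endpoint e' v}" for L
  define E where "E L = {X \<in> space P. endpoint e (initial_string L (incr (shift_by n X))) =
     endpoint e' (initial_string L (incr (shift_by n X)))}" for L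
  have UN: "cyl x u \<inter> E L = (\<Union>v\<in>G L. cyl x (u @ v))" if "length u = n" for u L
  proof (intro set_eqI iffI)
    fix X assume "X \<in> cyl x u \<inter> E L"
    then show "X \<in> (\<Union>v\<in>G L. cyl x (u @ v))" using that
      by (intro UN_I[of "initial_string L (incr (shift_by n X))"]) (auto simp: G_def E_def cyl_append)
  next
    fix X assume "X \<in> (\<Union>v\<in>G L. cyl x (u @ v))"
    then show "X \<in> cyl x u \<inter> E L" using that by (auto simp: G_def E_def cyl_append) (auto simp: cyl_def)
  qed
  have meas: "cyl x u \<inter> E L \<in> sets P" if "length u = n" for u L
    unfolding UN[OF that] by (intro sets.countable_UN' cyl_sets_P image_subsetI countableI_type)
  have eq: "measure P (cyl x w \<inter> E L) = measure P (cyl x w' \<inter> E L)" for L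
  proof -
    have "emeasure P (\<Union>v\<in>G L. cyl x (w @ v)) = emeasure P (\<Union>v\<in>G L. cyl x (w' @ v))"
    proof (rule emeasure_UN_eq)
      show "emeasure P (cyl x (w @ v)) = emeasure P (cyl x (w' @ v))" if "v \<in> G L" for v
        using that m by (intro swap) (auto simp: G_def e_def e'_def)
      show "disjoint_family_on (\<lambda>v. cyl x (w @ v)) (G L)" "disjoint_family_on (\<lambda>v. cyl x (w' @ v)) (G L)"
        unfolding disjoint_family_on_def by (intro ballI impI cyl_disjoint; auto simp: G_def)+
    qed (intro countableI_type cyl_sets_P)+
    then show ?thesis using UN[of w L] UN[of w' L] l by (simp add: n_def measure_def)
  qed
  have Emono: "X \<in> E (Suc L)" if "X \<in> E L" for X L
    using that by (simp add: E_def initial_string_Suc)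
  have AEin: "AE X in P. X \<in> cyl x w \<longrightarrow> X \<in> (\<Union>L. cyl x w \<inter> E L)"
    using AE_zeros_or_constant AE_space
  proof (eventually_elim, intro impI)
    fix X assume d: "(\<forall>n. \<exists>k\<ge>n. X k = 0) \<or> (1 \<le> X 0 \<and> (\<forall>k. X k = X 0))"
      and sp: "X \<in> space P" and c: "X \<in> cyl x w"
    have "\<not> (1 \<le> X 0 \<and> (\<forall>k. X k = X 0))"
    proof
      assume cc: "1 \<le> X 0 \<and> (\<forall>k. X k = X 0)"
      then obtain k where "\<And>i. X i = k" "1 \<le> k" by blast
      then have "incr X i = 1" for i by (simp add: incr_def)
      then have "initial_string n (incr X) = replicate n 1"
        by (intro nth_equalityI) simp_all
      then have "w = replicate n 1" using c by (simp add: cyl_def n_def)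
      then have "\<forall>r\<in>set w'. r = 1" using mset_eq_setD[OF m] by auto
      then have "w' = replicate n 1"
        using l replicate_length_same[of w' 1] by (simp add: n_def)
      then show False using False \<open>w = replicate n 1\<close> by simp
    qed
    then have z: "\<forall>n. \<exists>k\<ge>n. X k = 0" using d by blast
    define \<eta> where "\<eta> = shift_by n X"
    have \<eta>: "\<eta> \<in> dsf_seqs" using sp shift_by_dsf by (simp add: \<eta>_def)
    have z\<eta>: "\<exists>k\<ge>m. \<eta> k = 0" for m
    proof -
      obtain k where "n + m \<le> k" "X k = 0" using z by blast
      then show ?thesis by (intro exI[of _ "k - n"]) (auto simp: \<eta>_def shift_by_def)
    qed
    have "\<eta> 0 = e" using c cyl_state[of X x w "[]"] by (simp add: \<eta>_def shift_by_def n_def e_def)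
    have "infinite {k. \<eta> k = 0}"
      using z\<eta> unfolding infinite_nat_iff_unbounded_le by auto
    then obtain Z where Z: "Z \<subseteq> {k. \<eta> k = 0}" "card Z = Suc e'" "finite Z"
      using infinite_arbitrarily_large by blast
    define L where "L = Suc (Max Z)"
    have "Z \<subseteq> {k. k < L \<and> \<eta> k = 0}" using Z by (auto simp: L_def less_Suc_eq_le)
    then have "Suc e' \<le> card {k. k < L \<and> \<eta> k = 0}"
      using card_mono[of "{k. k < L \<and> \<eta> k = 0}" Z] Z(2) by simp
    then have "e' < zeros_before_end e (initial_string L (incr \<eta>))"
      using zeros_before_end_card[OF \<eta>, of L] \<open>\<eta> 0 = e\<close> by simp
    then have "X \<in> E L" using coalesce sp by (simp add: E_def \<eta>_def)
    then show "X \<in> (\<Union>L. cyl x w \<inter> E L)" using c by blast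
  qed
  have "(\<lambda>L. measure P (cyl x w \<inter> E L)) \<longlonglongrightarrow> measure P (\<Union>L. cyl x w \<inter> E L)"
  proof (rule finite_Lim_measure_incseq)
    show "range (\<lambda>L. cyl x w \<inter> E L) \<subseteq> sets P" using meas[of w] by (auto simp: n_def)
    show "incseq (\<lambda>L. cyl x w \<inter> E L)" using Emono by (intro incseq_SucI) auto
  qed
  moreover have "measure P (\<Union>L. cyl x w \<inter> E L) = measure P (cyl x w)"
  proof (rule measure_eq_AE)
    show "AE X in P. X \<in> (\<Union>L. cyl x w \<inter> E L) \<longleftrightarrow> X \<in> cyl x w"
      using AEin by (rule AE_mp) (auto intro!: AE_I2)
    show "(\<Union>L. cyl x w \<inter> E L) \<in> sets P"
      by (intro sets.countable_UN image_subsetI meas) (simp add: n_def)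
  qed (rule cyl_sets_P)
  ultimately have "(\<lambda>L. measure P (cyl x w \<inter> E L)) \<longlonglongrightarrow> measure P (cyl x w)" by simp
  then show ?thesis
  proof (rule LIMSEQ_le_const2, intro exI allI impI)
    fix L
    show "measure P (cyl x w \<inter> E L) \<le> measure P (cyl x w')"
      unfolding eq by (intro finite_measure_mono cyl_sets_P) auto
  qed
qed simp

lemma exchangeable:
  assumes "mset w = mset w'"
  shows "emeasure P (cyl x w) = emeasure P (cyl x w')"
  using exchangeable_le[OF assms, of x] exchangeable_le[OF assms[symmetric], of x]
  by (simp add: emeasure_eq_measure)

end

lemma shift_by_apply: "shift_by n X i = X (n + i)"
  by (simp add: shift_by_def)

lemma incr_shift_by_apply: "incr (shift_by n X) i = incr X (n + i)"
  by (simp add: incr_def shift_by_def)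

section \<open>Limiting frequencies and de Finetti's formula\<close>

definition freq :: "(nat \<Rightarrow> nat) \<Rightarrow> nat \<Rightarrow> nat \<Rightarrow> real" where
  "freq s r n = (\<Sum>k<n. of_bool (s k = r)) / real n"

text \<open>Along the powers of 4 the quadratic estimates of \<open>AE_freq_convergent\<close> are summable. Cutting off
  at 0 and 1 bounds the value also for sequences without a limit.\<close>

definition freq_limit :: "(nat \<Rightarrow> nat) \<Rightarrow> nat \<Rightarrow> real" where
  "freq_limit s r = max 0 (min 1 (lim (\<lambda>j. freq s r (4 ^ j))))"

lemma freq_bounds: "0 \<le> freq s r n" "freq s r n \<le> 1"
proof -
  show "0 \<le> freq s r n" by (simp add: freq_def sum_nonneg)
  have "(\<Sum>k<n. of_bool (s k = r)) \<le> (\<Sum>k<n. 1 :: real)" by (intro sum_mono) simp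
  then show "freq s r n \<le> 1" by (cases "n = 0") (simp_all add: freq_def)
qed

lemma freq_limit_bounds: "0 \<le> freq_limit s r" "freq_limit s r \<le> 1"
  by (simp_all add: freq_limit_def)

lemma freq_limit_LIMSEQ:
  assumes "convergent (\<lambda>j. freq s r (4 ^ j))"
  shows "(\<lambda>j. freq s r (4 ^ j)) \<longlonglongrightarrow> freq_limit s r"
proof -
  have l: "(\<lambda>j. freq s r (4 ^ j)) \<longlonglongrightarrow> lim (\<lambda>j. freq s r (4 ^ j))"
    using assms by (simp add: convergent_LIMSEQ_iff)
  have "0 \<le> lim (\<lambda>j. freq s r (4 ^ j))" by (rule LIMSEQ_le_const[OF l]) (simp add: freq_bounds)
  moreover have "lim (\<lambda>j. freq s r (4 ^ j)) \<le> 1" by (rule LIMSEQ_le_const2[OF l]) (simp add: freq_bounds)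
  ultimately show ?thesis using l by (simp add: freq_limit_def)
qed

text \<open>Shifting by one changes a frequency over \<open>N\<close> steps by at most \<open>1 / N\<close>, so both sequences have the
  same limit or neither has one; in the latter case \<open>lim\<close> returns the same value for both.\<close>

lemma freq_limit_shift_by: "freq_limit (shift_by n s) = freq_limit s"
proof (induction n)
  case (Suc n)
  define t where "t = shift_by n s"
  have "freq_limit (shift_by 1 t) r = freq_limit t r" for r
  proof -
    have d: "\<bar>freq (shift_by 1 t) r N - freq t r N\<bar> \<le> inverse (real N)" for N
    proof -
      have "(\<Sum>k<N. of_bool (shift_by 1 t k = r)) - (\<Sum>k<N. of_bool (t k = r)) =
          of_bool (t N = r) - (of_bool (t 0 = r) :: real)"
        by (induction N) (auto simp: shift_by_def)
      then have "freq (shift_by 1 t) r N - freq t r N = (of_bool (t N = r) - of_bool (t 0 = r)) / real N"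
        unfolding freq_def diff_divide_distrib[symmetric] by simp
      then show ?thesis by (simp add: divide_inverse abs_mult)
    qed
    have "(\<lambda>j. inverse (real (4 ^ j))) \<longlonglongrightarrow> 0"
      using LIMSEQ_inverse_realpow_zero[of 4] by simp
    then have z: "(\<lambda>j. freq (shift_by 1 t) r (4 ^ j) - freq t r (4 ^ j)) \<longlonglongrightarrow> 0"
      by (rule Lim_null_comparison[rotated])
        (intro always_eventually allI, simp only: real_norm_def d)
    have "(\<lambda>j. freq (shift_by 1 t) r (4 ^ j)) \<longlonglongrightarrow> L \<longleftrightarrow> (\<lambda>j. freq t r (4 ^ j)) \<longlonglongrightarrow> L" for L
      using tendsto_add[OF z, of "\<lambda>j. freq t r (4 ^ j)" L]
        tendsto_diff[OF _ z, of "\<lambda>j. freq (shift_by 1 t) r (4 ^ j)" L] by auto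
    then have "lim (\<lambda>j. freq (shift_by 1 t) r (4 ^ j)) = lim (\<lambda>j. freq t r (4 ^ j))"
      unfolding lim_def by simp
    then show ?thesis by (simp add: freq_limit_def)
  qed
  then have "freq_limit (shift_by 1 t) = freq_limit t" by blast
  then show ?case using Suc by (simp add: t_def shift_by_shift_by)
qed simp

lemma freq_limit_measurable [measurable]:
  "freq_limit \<in> measurable borel (borel :: (nat \<Rightarrow> real) measure)"
proof (rule measurable_coordinatewise_then_product)
  show "(\<lambda>s. freq_limit s r) \<in> borel_measurable borel" for r
    unfolding freq_limit_def freq_def by measurable
qed

text \<open>Coefficients with sum zero cancel the common covariance \<open>\<beta>\<close>; only the diagonal remains.\<close>

lemma expectation_square_zero_sum:
  fixes U :: "nat \<Rightarrow> 'a \<Rightarrow> real"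
  assumes int: "\<And>k l. integrable M (\<lambda>X. U k X * U l X)"
    and cov: "\<And>k l. (\<integral>X. U k X * U l X \<partial>M) = (if k = l then \<alpha> else \<beta>)"
    and c: "(\<Sum>k<n. c k) = 0"
  shows "(\<integral>X. (\<Sum>k<n. c k * U k X)\<^sup>2 \<partial>M) = (\<alpha> - \<beta>) * (\<Sum>k<n. (c k)\<^sup>2)"
    and "integrable M (\<lambda>X. (\<Sum>k<n. c k * U k X)\<^sup>2)"
proof -
  have e: "(\<Sum>k<n. c k * U k X)\<^sup>2 = (\<Sum>k<n. \<Sum>l<n. (c k * c l) * (U k X * U l X))" for X
    unfolding power2_eq_square sum_product by (intro sum.cong refl) (simp add: mult_ac)
  have "(\<integral>X. (\<Sum>k<n. c k * U k X)\<^sup>2 \<partial>M) = (\<Sum>k<n. \<Sum>l<n. (c k * c l) * (if k = l then \<alpha> else \<beta>))"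
    unfolding e by (simp add: Bochner_Integration.integral_sum int cov)
  also have "\<dots> = (\<Sum>k<n. \<Sum>l<n. \<beta> * (c k * c l) + (if l = k then (\<alpha> - \<beta>) * (c k)\<^sup>2 else 0))"
    by (intro sum.cong refl) (auto simp: power2_eq_square algebra_simps)
  also have "\<dots> = \<beta> * ((\<Sum>k<n. c k) * (\<Sum>k<n. c k)) + (\<alpha> - \<beta>) * (\<Sum>k<n. (c k)\<^sup>2)"
    unfolding sum.distrib by (simp add: sum_product) (simp only: sum_distrib_left)
  finally show "(\<integral>X. (\<Sum>k<n. c k * U k X)\<^sup>2 \<partial>M) = (\<alpha> - \<beta>) * (\<Sum>k<n. (c k)\<^sup>2)"
    using c by simp
  show "integrable M (\<lambda>X. (\<Sum>k<n. c k * U k X)\<^sup>2)"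
    unfolding e by (intro Bochner_Integration.integrable_sum integrable_mult_right int)
qed

lemma emeasure_distr_density_indicator:
  assumes [measurable]: "A \<in> sets M" "f \<in> measurable M N" "C \<in> sets N"
  shows "emeasure (distr (density M (indicator A)) N f) C = emeasure M {X \<in> A. f X \<in> C}"
proof -
  have "emeasure (distr (density M (indicator A)) N f) C = emeasure M (A \<inter> (f -` C \<inter> space M))"
    by (simp add: emeasure_distr emeasure_restricted)
  also have "A \<inter> (f -` C \<inter> space M) = {X \<in> A. f X \<in> C}"
    using sets.sets_into_space[OF assms(1)] by auto
  finally show ?thesis .
qed

context partially_exchangeable
begin

lemma incr_shift_measurable [measurable]: "(\<lambda>X. incr (shift_by m X)) \<in> measurable P borel"
  by measurable

text \<open>As functions of \<open>C\<close> both sides are finite measures, and they agree on prefix sets.\<close>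

lemma exchangeable_with_future:
  assumes m: "mset w = mset w'" and [measurable]: "C \<in> sets borel"
  shows "emeasure P {X \<in> cyl x w. incr (shift_by (length w) X) \<in> C} =
    emeasure P {X \<in> cyl x w'. incr (shift_by (length w) X) \<in> C}"
proof -
  let ?N = "\<lambda>u. distr (density P (indicator (cyl x u))) borel (\<lambda>X. incr (shift_by (length w) X))"
  have l: "length w' = length w" using m by (metis size_mset)
  have N: "emeasure (?N u) C = emeasure P {X \<in> cyl x u. incr (shift_by (length w) X) \<in> C}"
    if "C \<in> sets borel" for u C
    by (rule emeasure_distr_density_indicator) (use that cyl_sets_P in measurable)
  have "?N w = ?N w'"
  proof (rule finite_measure_eqI_prefix[where D = UNIV])
    show "finite_measure (?N w)"
      by (rule finite_measureI) (simp add: N cyl_sets_P)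
    fix v
    note s = prefix_sets_borel[of v]
    have "{X \<in> cyl x u. initial_string (length v) (incr (shift_by (length w) X)) = v} = cyl x (u @ v)"
      if "length u = length w" for u using that by (auto simp: cyl_append)
    then show "emeasure (?N w) {s \<in> UNIV. initial_string (length v) s = v} =
        emeasure (?N w') {s \<in> UNIV. initial_string (length v) s = v}"
      using N[OF s, of w] N[OF s, of w'] exchangeable[of "w @ v" "w' @ v" x] m l by simp
  qed (simp_all add: sets_restrict_UNIV)
  then show ?thesis using N[OF assms(2), of w] N[OF assms(2), of w'] by simp
qed

text \<open>Split according to the word \<open>u\<close> of the increments in between: \<open>w @ r # u\<close> is a rearrangement of
  \<open>w @ u @ [r]\<close>.\<close>

lemma rotate_increment:
  assumes C[measurable]: "C \<in> sets borel" and n: "n = length w"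
  shows "emeasure P {X \<in> cyl x w. incr X n = r \<and> incr (shift_by (Suc (n + k)) X) \<in> C} =
    emeasure P {X \<in> cyl x w. incr X (n + k) = r \<and> incr (shift_by (Suc (n + k)) X) \<in> C}"
proof -
  define G where "G = {u :: nat list. length u = k}"
  define A where "A v = {X \<in> cyl x v. incr (shift_by (Suc (n + k)) X) \<in> C}" for v
  have A: "A v \<in> sets P" for v
    unfolding A_def by (rule Collect_cyl_sets) measurable
  have s: "incr X (n + i) = incr (shift_by n X) i" for X i by (simp add: incr_shift_by_apply)
  have 1: "{X \<in> cyl x w. incr X n = r \<and> incr (shift_by (Suc (n + k)) X) \<in> C} = (\<Union>u\<in>G. A (w @ r # u))"
  proof -
    have h: "initial_string (Suc k) t = t 0 # initial_string k (shift_by 1 t)" for t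
      using initial_string_add[of 1 k t] initial_string_Suc[of 0 t] by simp
    show ?thesis
      using s[of _ 0] by (auto simp: A_def G_def cyl_append n h)
  qed
  have 2: "{X \<in> cyl x w. incr X (n + k) = r \<and> incr (shift_by (Suc (n + k)) X) \<in> C} = (\<Union>u\<in>G. A (w @ u @ [r]))"
  proof -
    have "initial_string (Suc k) (incr (shift_by n X)) = u @ [r] \<longleftrightarrow>
       u = initial_string k (incr (shift_by n X)) \<and> incr X (n + k) = r" if "u \<in> G" for u X
      using s[of X k] by (auto simp: initial_string_Suc)
    then show ?thesis by (auto simp: A_def G_def cyl_append n)
  qed
  show ?thesis unfolding 1 2
  proof (rule emeasure_UN_eq)
    show "emeasure P (A (w @ r # u)) = emeasure P (A (w @ u @ [r]))" if "u \<in> G" for u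
      using exchangeable_with_future[of "w @ r # u" "w @ u @ [r]" C x] that n by (simp add: A_def G_def)
    have "A u \<inter> A v = {}" if "length u = length v" "u \<noteq> v" for u v
      using cyl_disjoint[OF that] by (auto simp: A_def)
    then show "disjoint_family_on (\<lambda>u. A (w @ r # u)) G" "disjoint_family_on (\<lambda>u. A (w @ u @ [r])) G"
      unfolding disjoint_family_on_def G_def by simp_all
  qed (intro countableI_type A)+
qed

abbreviation p :: "(nat \<Rightarrow> nat) \<Rightarrow> nat \<Rightarrow> real" where
  "p X \<equiv> freq_limit (incr X)"

lemma p_measurable [measurable]: "(\<lambda>X. p X) \<in> measurable P borel"
  by measurable

lemma p_coordinate_measurable [measurable]: "(\<lambda>X. p X r) \<in> borel_measurable P"
  using measurable_compose[OF p_measurable measurable_product_coordinates] .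

lemma p_shift_by: "p (shift_by n X) = p X"
  by (simp add: incr_shift_by freq_limit_shift_by)

text \<open>The limiting frequencies are a function of the increments after any given time, so
  \<open>rotate_increment\<close> applies.\<close>

lemma rotate_increment_p:
  assumes \<psi>[measurable]: "\<psi> \<in> borel_measurable (borel :: (nat \<Rightarrow> real) measure)" and n: "n = length w"
  shows "(\<integral>\<^sup>+X. indicator {X \<in> cyl x w. incr X n = r} X * \<psi> (p X) \<partial>P) =
    (\<integral>\<^sup>+X. indicator {X \<in> cyl x w. incr X (n + k) = r} X * \<psi> (p X) \<partial>P)"
proof -
  let ?A = "\<lambda>k. {X \<in> cyl x w. incr X (n + k) = r}"
  have A[measurable]: "?A k \<in> sets P" for k
    by (rule Collect_cyl_sets) measurable
  have N: "emeasure (distr (density P (indicator (?A k))) borel p) D =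
      emeasure P {X \<in> ?A k. p X \<in> D}" if "D \<in> sets borel" for D k
    by (rule emeasure_distr_density_indicator[OF A p_measurable that])
  have "distr (density P (indicator (?A 0))) borel p = distr (density P (indicator (?A k))) borel p"
  proof (rule measure_eqI)
    fix D assume "D \<in> sets (distr (density P (indicator (?A 0))) borel p)"
    then have D: "D \<in> sets borel" by simp
    have "freq_limit -` D \<inter> space borel \<in> sets borel" by (rule measurable_sets[OF freq_limit_measurable D])
    then have "freq_limit -` D \<in> sets borel" by simp
    from rotate_increment[OF this n, of x r k] show "emeasure (distr (density P (indicator (?A 0))) borel p) D =
        emeasure (distr (density P (indicator (?A k))) borel p) D"
      unfolding N[OF D] by (simp add: p_shift_by conj_ac del: incr_shift_by)
  qed simp
  note eq = this
  have F: "(\<integral>\<^sup>+q. \<psi> q \<partial>distr (density P (indicator (?A k))) borel p) =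
      (\<integral>\<^sup>+X. indicator (?A k) X * \<psi> (p X) \<partial>P)" for k
    by (simp add: nn_integral_distr nn_integral_density)
  show ?thesis using F[of 0] F[of k] unfolding eq by (simp only: add_0_right)
qed

text \<open>The difference of the frequencies over \<open>4 ^ Suc j\<close> and \<open>4 ^ j\<close> steps has second moment at most
  \<open>4 ^ (- j)\<close>, hence first absolute moment at most \<open>2 ^ (- j)\<close>; so almost surely the differences are
  absolutely summable.\<close>

lemma AE_freq_convergent:
  "AE X in P. \<forall>r. (\<lambda>j. freq (incr X) r (4 ^ j)) \<longlonglongrightarrow> p X r"
proof -
  have "AE X in P. convergent (\<lambda>j. freq (incr X) r (4 ^ j))" for r
  proof -
    define U where "U k X = (of_bool (incr X k = r) :: real)" for k X
    have U[measurable]: "U k \<in> borel_measurable P" for k unfolding U_def by measurable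
    define \<alpha> where "\<alpha> = measure P {X \<in> space P. incr X 0 = r}"
    define \<beta> where "\<beta> = measure P {X \<in> space P. incr X 0 = r \<and> incr X 1 = r}"
    have int: "integrable P (\<lambda>X. U k X * U l X)" for k l
      by (rule integrable_const_bound[where B = 1]) (simp_all add: U_def)
    have pair: "measure P {X \<in> space P. incr X k = r \<and> incr X l = r} = \<beta>" if "k < l" for k l
    proof -
      define d where "d = l - k - 1"
      have l: "l = k + Suc d" using that by (simp add: d_def)
      have m[measurable]: "{X \<in> space P. incr X 0 = r \<and> incr X (Suc d) = r} \<in> sets P" for d by measurable
      have "measure P {X \<in> space P. incr X k = r \<and> incr X l = r} =
          measure P (shift_by k -` {X \<in> space P. incr X 0 = r \<and> incr X (Suc d) = r} \<inter> dsf_seqs)"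
        using shift_by_dsf by (intro arg_cong[where f = "measure P"]) (auto simp: incr_shift_by_apply l)
      also have "\<dots> = measure P {X \<in> space P. incr X 0 = r \<and> incr X (Suc d) = r}"
        using emeasure_shift_by[OF m] by (simp add: measure_def)
      also have "\<dots> = \<beta>"
      proof -
        have U: "{X \<in> space P. incr X 0 = r \<and> incr X (Suc d) = r} = (\<Union>x. {X \<in> cyl x [r]. incr X (1 + d) = r})" for d
          by (auto simp: cyl_def initial_string_Suc initial_string_eq_iff)
        have s: "{X \<in> cyl x [r]. incr X (1 + d) = r} \<in> sets P" for x d
          by (rule Collect_cyl_sets) measurable
        have "emeasure P (\<Union>x. {X \<in> cyl x [r]. incr X (1 + d) = r}) = emeasure P (\<Union>x. {X \<in> cyl x [r]. incr X (1 + 0) = r})"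
        proof (rule emeasure_UN_eq)
          show "emeasure P {X \<in> cyl x [r]. incr X (1 + d) = r} = emeasure P {X \<in> cyl x [r]. incr X (1 + 0) = r}" for x
            using rotate_increment[of UNIV 1 "[r]" x r d] by simp
        qed (use s in \<open>auto simp: disjoint_family_on_def cyl_def\<close>)
        then show ?thesis unfolding \<beta>_def using U[of d] U[of 0] by (simp add: measure_def)
      qed
      finally show ?thesis .
    qed
    have cov: "(\<integral>X. U k X * U l X \<partial>P) = (if k = l then \<alpha> else \<beta>)" for k l
    proof -
      have "(\<integral>X. U k X * U l X \<partial>P) = (\<integral>X. indicator {X \<in> space P. incr X k = r \<and> incr X l = r} X \<partial>P)"
        by (intro Bochner_Integration.integral_cong) (auto simp: U_def indicator_def)
      also have "\<dots> = measure P ({X \<in> space P. incr X k = r \<and> incr X l = r} \<inter> space P)"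
        by simp
      also have "{X \<in> space P. incr X k = r \<and> incr X l = r} \<inter> space P =
          {X \<in> space P. incr X k = r \<and> incr X l = r}" by auto
      also have "measure P {X \<in> space P. incr X k = r \<and> incr X l = r} = (if k = l then \<alpha> else \<beta>)"
      proof (cases "k = l")
        case True
        have m: "{X \<in> space P. incr X 0 = r} \<in> sets P" by measurable
        have "measure P {X \<in> space P. incr X k = r} = measure P (shift_by k -` {X \<in> space P. incr X 0 = r} \<inter> dsf_seqs)"
          using shift_by_dsf by (intro arg_cong[where f = "measure P"]) (auto simp: incr_shift_by_apply)
        then show ?thesis using True emeasure_shift_by[OF m] by (simp add: measure_def \<alpha>_def)
      next
        case False
        then show ?thesis using pair[of k l] pair[of l k] by (auto simp: neq_iff conj_commute)
      qed
      finally show ?thesis .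
    qed
    have \<alpha>\<beta>: "\<alpha> - \<beta> \<le> 1"
    proof -
      have "\<alpha> \<le> 1" "0 \<le> \<beta>" by (simp_all add: \<alpha>_def \<beta>_def)
      then show ?thesis by simp
    qed
    define d where "d j X = freq (incr X) r (4 ^ Suc j) - freq (incr X) r (4 ^ j)" for j X
    have d[measurable]: "d j \<in> borel_measurable P" for j
      unfolding d_def freq_def by measurable
    have dle: "(\<integral>\<^sup>+X. ennreal \<bar>d j X\<bar> \<partial>P) \<le> ennreal ((1/2) ^ j)" for j
    proof -
      define N where "N = (4::nat) ^ j"
      have N: "0 < N" by (simp add: N_def)
      \<comment> \<open>the coefficients that express the difference of the two frequencies\<close>
      define c where "c k = 1 / (4 * real N) - of_bool (k < N) / real N" for k
      have split: "(\<Sum>k<4 * N. f k * of_bool (k < N)) = (\<Sum>k<N. f k)" for f :: "nat \<Rightarrow> real"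
      proof -
        have "(\<Sum>k<4 * N. f k * of_bool (k < N)) = (\<Sum>k\<in>{..<4 * N} \<inter> {k. k < N}. f k)"
          by (simp add: sum.inter_restrict of_bool_def if_distrib cong: if_cong)
        also have "{..<4 * N} \<inter> {k. k < N} = {..<N}" by auto
        finally show ?thesis .
      qed
      have dc: "d j X = (\<Sum>k<4 * N. c k * U k X)" for X
      proof -
        have "(\<Sum>k<4 * N. c k * U k X) = (\<Sum>k<4 * N. U k X / (4 * real N) - (U k X / real N) * of_bool (k < N))"
          by (intro sum.cong refl) (simp add: c_def algebra_simps)
        also have "\<dots> = (\<Sum>k<4 * N. U k X) / (4 * real N) - (\<Sum>k<N. U k X) / real N"
          by (simp only: sum_subtractf split sum_divide_distrib)
        finally show ?thesis by (simp add: d_def freq_def U_def N_def)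
      qed
      have c0: "(\<Sum>k<4 * N. c k) = 0"
      proof -
        have "(\<Sum>k<4 * N. c k) = (\<Sum>k<4 * N. 1 / (4 * real N) - (1 / real N) * of_bool (k < N))"
          by (simp add: c_def)
        also have "\<dots> = 0" using N by (simp only: sum_subtractf split) simp
        finally show ?thesis .
      qed
      have c2: "(\<Sum>k<4 * N. (c k)\<^sup>2) \<le> 1 / real N"
      proof -
        have "(\<Sum>k<4 * N. (c k)\<^sup>2) = (\<Sum>k<4 * N. 1 / (16 * (real N)\<^sup>2) + (1 / (2 * (real N)\<^sup>2)) * of_bool (k < N))"
          using N by (intro sum.cong refl) (auto simp: c_def power2_eq_square field_simps)
        also have "\<dots> = (4 * real N) * (1 / (16 * (real N)\<^sup>2)) + real N * (1 / (2 * (real N)\<^sup>2))"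
          by (simp only: sum.distrib split) simp
        also have "\<dots> \<le> 1 / real N" using N by (simp add: power2_eq_square field_simps)
        finally show ?thesis .
      qed
      have intd: "integrable P (\<lambda>X. (d j X)\<^sup>2)"
        unfolding dc by (rule expectation_square_zero_sum(2)[OF int cov c0])
      have "(\<integral>X. (d j X)\<^sup>2 \<partial>P) = (\<alpha> - \<beta>) * (\<Sum>k<4 * N. (c k)\<^sup>2)"
        unfolding dc by (rule expectation_square_zero_sum(1)[OF int cov c0])
      also have "\<dots> \<le> 1 * (\<Sum>k<4 * N. (c k)\<^sup>2)" by (intro mult_right_mono \<alpha>\<beta> sum_nonneg) simp
      also have "\<dots> \<le> 1 / real N" using c2 by simp
      finally have ed: "(\<integral>X. (d j X)\<^sup>2 \<partial>P) \<le> 1 / 4 ^ j" by (simp add: N_def)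
      \<comment> \<open>the weight in \<open>2 \<bar>y\<bar> \<le> h y\<^sup>2 + 1 / h\<close> that balances both terms\<close>
      define h where "h = (2::real) ^ j"
      have h: "0 < h" "4 ^ j = h * h" by (simp_all add: h_def power_mult_distrib[symmetric])
      have pw: "\<bar>y\<bar> \<le> (h * y\<^sup>2 + 1 / h) / 2" for y
      proof -
        have "0 \<le> (h * \<bar>y\<bar> - 1)\<^sup>2" by simp
        then have "2 * h * \<bar>y\<bar> \<le> h * h * y\<^sup>2 + 1" by (simp add: power2_eq_square algebra_simps)
        then show ?thesis using h by (simp add: field_simps power2_eq_square)
      qed
      have i2: "integrable P (\<lambda>X. (h * (d j X)\<^sup>2 + 1 / h) / 2)" using intd by simp
      have "(\<integral>\<^sup>+X. ennreal \<bar>d j X\<bar> \<partial>P) \<le> (\<integral>\<^sup>+X. ennreal ((h * (d j X)\<^sup>2 + 1 / h) / 2) \<partial>P)"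
        by (intro nn_integral_mono ennreal_leI pw)
      also have "\<dots> = ennreal (\<integral>X. (h * (d j X)\<^sup>2 + 1 / h) / 2 \<partial>P)"
        using i2 h by (intro nn_integral_eq_integral) auto
      also have "(\<integral>X. (h * (d j X)\<^sup>2 + 1 / h) / 2 \<partial>P) = (h * (\<integral>X. (d j X)\<^sup>2 \<partial>P) + 1 / h) / 2"
        using intd prob_space by simp
      also have "\<dots> \<le> (h * (1 / 4 ^ j) + 1 / h) / 2" using ed h by (intro divide_right_mono add_right_mono mult_left_mono) auto
      also have "\<dots> = (1/2) ^ j" using h by (simp add: power_divide h_def[symmetric])
      finally show ?thesis by (simp add: ennreal_leI)
    qed
    have "(\<integral>\<^sup>+X. (\<Sum>j. ennreal \<bar>d j X\<bar>) \<partial>P) = (\<Sum>j. \<integral>\<^sup>+X. ennreal \<bar>d j X\<bar> \<partial>P)"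
      by (intro nn_integral_suminf) measurable
    also have "\<dots> \<le> (\<Sum>j. ennreal ((1/2) ^ j))" by (rule suminf_le[OF dle summableI summableI])
    also have "\<dots> = ennreal (\<Sum>j. (1/2) ^ j)"
      by (rule suminf_ennreal2) (simp_all add: summable_geometric)
    finally have "AE X in P. (\<Sum>j. ennreal \<bar>d j X\<bar>) \<noteq> \<infinity>"
      by (intro nn_integral_noteq_infinite) (auto simp: top_unique)
    then show ?thesis
    proof eventually_elim
      case (elim X)
      then have "summable (\<lambda>j. \<bar>d j X\<bar>)" by (intro summable_suminf_not_top) auto
      then have "summable (\<lambda>j. d j X)" by (rule summable_rabs_cancel)
      then have "convergent (\<lambda>n. \<Sum>j<n. d j X)" by (simp add: summable_iff_convergent)
      moreover have "(\<Sum>j<n. d j X) = freq (incr X) r (4 ^ n) - freq (incr X) r (4 ^ 0)" for n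
        unfolding d_def by (rule sum_lessThan_telescope)
      ultimately have "convergent (\<lambda>n. freq (incr X) r (4 ^ n) - freq (incr X) r (4 ^ 0))" by simp
      then show ?case by (rule convergent_diff_const_right_iff[THEN iffD1])
    qed
  qed
  then have "AE X in P. \<forall>r. convergent (\<lambda>j. freq (incr X) r (4 ^ j))" unfolding AE_all_countable by blast
  then show ?thesis by eventually_elim (blast intro: freq_limit_LIMSEQ)
qed

text \<open>By \<open>rotate_increment_p\<close> the event that the next increment is \<open>r\<close> may be replaced by the frequency
  of \<open>r\<close> over the next \<open>4 ^ j\<close> increments, which converges to \<open>p X r\<close>.\<close>

lemma replace_last_increment:
  assumes \<psi>[measurable]: "\<psi> \<in> borel_measurable (borel :: (nat \<Rightarrow> real) measure)" and \<psi>1: "\<And>q. \<psi> q \<le> 1"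
  shows "(\<integral>\<^sup>+X. indicator (cyl x (w @ [r])) X * \<psi> (p X) \<partial>P) =
    (\<integral>\<^sup>+X. indicator (cyl x w) X * (ennreal (p X r) * \<psi> (p X)) \<partial>P)"
proof -
  define n where "n = length w"
  let ?A = "\<lambda>k. {X \<in> cyl x w. incr X (n + k) = r}"
  have cylm[measurable]: "cyl x w \<in> sets P" by (rule cyl_sets_P)
  have A[measurable]: "?A k \<in> sets P" for k
    by (rule Collect_cyl_sets) measurable
  have A0: "cyl x (w @ [r]) = ?A 0"
    by (auto simp: cyl_append n_def incr_shift_by_apply initial_string_Suc)
  define I where "I = (\<integral>\<^sup>+X. indicator (cyl x (w @ [r])) X * \<psi> (p X) \<partial>P)"
  define g where "g N X = (indicator (cyl x w) X * \<psi> (p X)) * ennreal (freq (incr (shift_by n X)) r N)" for N X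
  have fm: "(\<lambda>X. freq (incr (shift_by n X)) r N) \<in> borel_measurable P" for N
    unfolding freq_def incr_shift_by by (simp add: shift_by_def)
  have gm[measurable]: "g N \<in> borel_measurable P" for N
    unfolding g_def using fm by measurable
  have gI: "(\<integral>\<^sup>+X. g N X \<partial>P) = I" if N: "0 < N" for N
  proof -
    have "g N X = ennreal (1 / real N) * (\<Sum>k<N. indicator (?A k) X * \<psi> (p X))" for X
    proof -
      have "(\<Sum>k<N. indicator (?A k) X * \<psi> (p X)) =
          (\<Sum>k<N. (indicator (cyl x w) X * \<psi> (p X)) * ennreal (of_bool (incr (shift_by n X) k = r)))"
        by (intro sum.cong refl) (auto simp: indicator_def incr_shift_by_apply)
      also have "\<dots> = (indicator (cyl x w) X * \<psi> (p X)) * ennreal (\<Sum>k<N. of_bool (incr (shift_by n X) k = r))"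
        by (simp only: sum_distrib_left[symmetric]) (simp add: sum_ennreal)
      finally have e: "(\<Sum>k<N. indicator (?A k) X * \<psi> (p X)) =
        (indicator (cyl x w) X * \<psi> (p X)) * ennreal (\<Sum>k<N. of_bool (incr (shift_by n X) k = r))" .
      have "ennreal (freq (incr (shift_by n X)) r N) =
          ennreal (1 / real N) * ennreal (\<Sum>k<N. of_bool (incr (shift_by n X) k = r))"
        by (simp add: freq_def ennreal_mult[symmetric] sum_nonneg)
      then show ?thesis unfolding g_def e by (simp only: mult_ac)
    qed
    then have "(\<integral>\<^sup>+X. g N X \<partial>P) =
        (\<integral>\<^sup>+X. ennreal (1 / real N) * (\<Sum>k<N. indicator (?A k) X * \<psi> (p X)) \<partial>P)"
      by (simp only:)
    also have "\<dots> = ennreal (1 / real N) * (\<integral>\<^sup>+X. (\<Sum>k<N. indicator (?A k) X * \<psi> (p X)) \<partial>P)"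
      by (rule nn_integral_cmult) measurable
    also have "(\<integral>\<^sup>+X. (\<Sum>k<N. indicator (?A k) X * \<psi> (p X)) \<partial>P) =
        (\<Sum>k<N. \<integral>\<^sup>+X. indicator (?A k) X * \<psi> (p X) \<partial>P)"
      by (rule nn_integral_sum) measurable
    also have "ennreal (1 / real N) * (\<Sum>k<N. \<integral>\<^sup>+X. indicator (?A k) X * \<psi> (p X) \<partial>P) =
      ennreal (1 / real N) * (\<Sum>k<N. I)"
      using rotate_increment_p[OF \<psi> n_def, of x r] by (simp add: I_def A0)
    also have "\<dots> = (ennreal (1 / real N) * ennreal (real N)) * I"
      by (simp add: ennreal_of_nat_eq_real_of_nat mult.assoc)
    also have "ennreal (1 / real N) * ennreal (real N) = 1"
      using N by (simp add: ennreal_mult[symmetric])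
    finally show ?thesis by simp
  qed
  have lim: "AE X in P. (\<lambda>j. g (4 ^ j) X) \<longlonglongrightarrow> (indicator (cyl x w) X * \<psi> (p X)) * ennreal (p X r)"
    using AE_shift_by[OF AE_freq_convergent, of n]
  proof eventually_elim
    case (elim X)
    have "(\<lambda>j. ennreal (freq (incr (shift_by n X)) r (4 ^ j))) \<longlonglongrightarrow> ennreal (p X r)"
      using elim[rule_format, of r] unfolding p_shift_by by (rule tendsto_ennrealI)
    moreover have "indicator (cyl x w) X * \<psi> (p X) < top"
      using \<psi>1[of "p X"] by (auto simp: indicator_def less_top[symmetric] top_unique)
    ultimately show ?case unfolding g_def by (intro ennreal_tendsto_cmult)
  qed
  have "(\<lambda>j. \<integral>\<^sup>+X. g (4 ^ j) X \<partial>P) \<longlonglongrightarrow> (\<integral>\<^sup>+X. (indicator (cyl x w) X * \<psi> (p X)) * ennreal (p X r) \<partial>P)"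
  proof (rule nn_integral_dominated_convergence[where w = "\<lambda>_. 1"])
    show "AE X in P. g (4 ^ j) X \<le> 1" for j
    proof (rule AE_I2)
      fix X
      have "indicator (cyl x w) X * \<psi> (p X) * ennreal (freq (incr (shift_by n X)) r (4 ^ j)) \<le> 1 * 1 * 1"
        by (intro mult_mono) (auto simp: \<psi>1 freq_bounds ennreal_le_1 indicator_def)
      then show "g (4 ^ j) X \<le> 1" by (simp add: g_def)
    qed
    show "(\<integral>\<^sup>+X. 1 \<partial>P) < \<infinity>"
      using emeasure_space_1 by (simp del: space_P)
    show "AE X in P. (\<lambda>j. g (4 ^ j) X) \<longlonglongrightarrow> (indicator (cyl x w) X * \<psi> (p X)) * ennreal (p X r)"
      by (rule lim)
  qed measurable
  then have "(\<lambda>j. I) \<longlonglongrightarrow> (\<integral>\<^sup>+X. (indicator (cyl x w) X * \<psi> (p X)) * ennreal (p X r) \<partial>P)"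
    by (simp add: gI)
  then have "I = (\<integral>\<^sup>+X. (indicator (cyl x w) X * \<psi> (p X)) * ennreal (p X r) \<partial>P)"
    by (rule LIMSEQ_unique[OF tendsto_const])
  then show ?thesis by (simp only: I_def mult_ac)
qed

text \<open>Given \<open>p\<close>, the increments are independent with distribution \<open>p\<close> and independent of the start. The
  increments are removed one at a time; each contributes its factor to the test function.\<close>

theorem de_Finetti_formula:
  assumes "\<psi> \<in> borel_measurable (borel :: (nat \<Rightarrow> real) measure)" and "\<And>q. \<psi> q \<le> 1"
  shows "(\<integral>\<^sup>+X. indicator (cyl x w) X * \<psi> (p X) \<partial>P) =
    (\<integral>\<^sup>+X. indicator (cyl x []) X * ((\<Prod>r\<leftarrow>w. ennreal (p X r)) * \<psi> (p X)) \<partial>P)"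
  using assms
proof (induction w arbitrary: \<psi> rule: rev_induct)
  case (snoc r w)
  note [measurable] = snoc.prems(1)
  \<comment> \<open>the minimum keeps the test function below 1 away from the values of \<open>p\<close>\<close>
  define \<psi>' where "\<psi>' q = min 1 (ennreal (q r)) * \<psi> q" for q :: "nat \<Rightarrow> real"
  have [measurable]: "\<psi>' \<in> borel_measurable borel" unfolding \<psi>'_def by measurable
  have le: "\<psi>' q \<le> 1" for q
    unfolding \<psi>'_def using mult_mono[of "min 1 (ennreal (q r))" 1 "\<psi> q" 1] snoc.prems(2) by simp
  have e: "ennreal (p X r) * \<psi> (p X) = \<psi>' (p X)" for X
    by (simp add: \<psi>'_def min_absorb2 ennreal_le_1 freq_limit_bounds)
  have "(\<integral>\<^sup>+X. indicator (cyl x (w @ [r])) X * \<psi> (p X) \<partial>P) =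
    (\<integral>\<^sup>+X. indicator (cyl x w) X * \<psi>' (p X) \<partial>P)"
    unfolding replace_last_increment[OF snoc.prems] e ..
  also have "\<dots> = (\<integral>\<^sup>+X. indicator (cyl x []) X * ((\<Prod>r\<leftarrow>w. ennreal (p X r)) * \<psi>' (p X)) \<partial>P)"
    by (rule snoc.IH) (simp_all add: le)
  finally show ?case unfolding e[symmetric] by (simp add: mult.assoc)
qed simp

end

section \<open>Invariant vectors of homogeneous matrices\<close>

text \<open>The homogeneous matrix with first row \<open>q\<close>; truncated subtraction covers row 0 as well.\<close>

definition kern :: "(nat \<Rightarrow> real) \<Rightarrow> nat \<Rightarrow> nat \<Rightarrow> real" where
  "kern q x y = (if x \<le> Suc y then q (y - (x - 1)) else 0)"

text \<open>Invariance of \<open>\<nu>\<close>: column \<open>y\<close> of the matrix vanishes below row \<open>Suc y\<close>, so the sum is finite.\<close>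

definition balanced :: "(nat \<Rightarrow> real) \<Rightarrow> (nat \<Rightarrow> real) \<Rightarrow> bool" where
  "balanced q \<nu> \<longleftrightarrow> (\<forall>y. \<nu> y = (\<Sum>x\<le>Suc y. \<nu> x * kern q x y))"

text \<open>The solution with value 1 at 0 of the balance equations: the equation for state \<open>y\<close> is solved for
  the value at \<open>Suc y\<close>, which occurs there with the coefficient \<open>q 0\<close>.\<close>

fun invariant_weight :: "(nat \<Rightarrow> real) \<Rightarrow> nat \<Rightarrow> real" where
  "invariant_weight q 0 = 1"
| "invariant_weight q (Suc y) = (invariant_weight q y - (\<Sum>x\<le>y. invariant_weight q x * kern q x y)) / q 0"

definition positive_recurrent :: "(nat \<Rightarrow> real) \<Rightarrow> bool" where
  "positive_recurrent q \<longleftrightarrow> probability_vector q \<and> 0 < q 0 \<and>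
     (\<forall>x. 0 \<le> invariant_weight q x) \<and> summable (invariant_weight q)"

definition invariant_vector :: "(nat \<Rightarrow> real) \<Rightarrow> nat \<Rightarrow> real" where
  "invariant_vector q x = invariant_weight q x / suminf (invariant_weight q)"

lemma kern_diag [simp]: "kern q (Suc y) y = q 0"
  by (simp add: kern_def)

lemma balancedD:
  assumes "balanced q \<nu>"
  shows "\<nu> y = (\<Sum>x\<le>y. \<nu> x * kern q x y) + \<nu> (Suc y) * q 0"
proof -
  have "\<nu> y = (\<Sum>x\<le>Suc y. \<nu> x * kern q x y)" using assms unfolding balanced_def by blast
  also have "\<dots> = (\<Sum>x\<le>y. \<nu> x * kern q x y) + \<nu> (Suc y) * q 0"
    by (simp only: sum.atMost_Suc kern_diag)
  finally show ?thesis .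
qed

lemma balanced_invariant_weight:
  assumes "q 0 \<noteq> 0" shows "balanced q (invariant_weight q)"
  unfolding balanced_def
proof
  fix y
  have "invariant_weight q (Suc y) * q 0 = invariant_weight q y - (\<Sum>x\<le>y. invariant_weight q x * kern q x y)"
    using assms by (simp only: invariant_weight.simps nonzero_eq_divide_eq) simp
  then show "invariant_weight q y = (\<Sum>x\<le>Suc y. invariant_weight q x * kern q x y)"
    by (simp only: sum.atMost_Suc kern_diag)
qed

lemma balanced_scale:
  assumes "balanced q \<nu>" shows "balanced q (\<lambda>x. \<nu> x / c)"
  unfolding balanced_def
proof
  fix y
  have "\<nu> y = (\<Sum>x\<le>Suc y. \<nu> x * kern q x y)" using assms unfolding balanced_def by blast
  then have "\<nu> y / c = (\<Sum>x\<le>Suc y. \<nu> x * kern q x y) / c" by (rule arg_cong)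
  then show "\<nu> y / c = (\<Sum>x\<le>Suc y. \<nu> x / c * kern q x y)"
    by (simp only: sum_divide_distrib times_divide_eq_left)
qed

lemma balanced_eq_invariant_weight:
  assumes "balanced q \<nu>" "q 0 \<noteq> 0"
  shows "\<nu> x = \<nu> 0 * invariant_weight q x"
proof (induction x rule: less_induct)
  case (less x)
  show ?case
  proof (cases x)
    case (Suc y)
    have "\<nu> y = (\<Sum>x\<le>y. \<nu> x * kern q x y) + \<nu> (Suc y) * q 0"
      by (rule balancedD[OF assms(1)])
    also have "(\<Sum>x\<le>y. \<nu> x * kern q x y) = \<nu> 0 * (\<Sum>x\<le>y. invariant_weight q x * kern q x y)"
      unfolding sum_distrib_left
    proof (rule sum.cong[OF refl])
      fix z assume "z \<in> {..y}"
      then have "\<nu> z = \<nu> 0 * invariant_weight q z" using less[of z] Suc by simp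
      then show "\<nu> z * kern q z y = \<nu> 0 * (invariant_weight q z * kern q z y)" by simp
    qed
    finally have "\<nu> (Suc y) * q 0 = \<nu> y - \<nu> 0 * (\<Sum>x\<le>y. invariant_weight q x * kern q x y)" by simp
    also have "\<nu> y = \<nu> 0 * invariant_weight q y" using less[of y] Suc by simp
    finally have "\<nu> (Suc y) * q 0 = \<nu> 0 * (invariant_weight q y - (\<Sum>x\<le>y. invariant_weight q x * kern q x y))"
      by (simp add: right_diff_distrib)
    then show ?thesis using assms(2) Suc by (simp add: field_simps)
  qed simp
qed

text \<open>The balance equations determine \<open>\<nu>\<close> up to the factor \<open>\<nu> 0\<close>, and the total mass determines this
  factor.\<close>

lemma balanced_unique:
  assumes b: "balanced q \<nu>" and \<nu>: "probability_vector \<nu>" and q: "probability_vector q" "0 < q 0"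
  shows "positive_recurrent q" "\<nu> = invariant_vector q"
proof -
  have e: "\<nu> x = \<nu> 0 * invariant_weight q x" for x using balanced_eq_invariant_weight[OF b, of x] q by simp
  have s: "\<nu> sums 1" and nn: "\<And>x. 0 \<le> \<nu> x" using \<nu> by (auto simp: probability_vector_def)
  have n0: "\<nu> 0 \<noteq> 0"
  proof
    assume "\<nu> 0 = 0"
    then have "\<nu> x = 0" for x using e[of x] by (simp only: mult_zero_left)
    then have "\<nu> = (\<lambda>_. 0)" by (rule ext)
    then show False using s sums_unique2[of "\<lambda>_. 0 :: real" 1 0] by simp
  qed
  then have pos: "0 < \<nu> 0" using nn[of 0] by simp
  have w: "invariant_weight q = (\<lambda>x. \<nu> x / \<nu> 0)"
  proof
    show "invariant_weight q x = \<nu> x / \<nu> 0" for x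
      using e[of x] n0 nonzero_mult_div_cancel_left[of "\<nu> 0" "invariant_weight q x"] by metis
  qed
  have ws: "invariant_weight q sums (1 / \<nu> 0)" unfolding w by (rule sums_divide[OF s])
  show "positive_recurrent q"
    using q ws nn pos by (auto simp: positive_recurrent_def sums_iff w)
  show "\<nu> = invariant_vector q"
    using ws n0 by (auto simp: invariant_vector_def fun_eq_iff sums_iff w)
qed

lemma invariant_vector:
  assumes "positive_recurrent q"
  shows "probability_vector (invariant_vector q)" "balanced q (invariant_vector q)"
proof -
  have s: "summable (invariant_weight q)" and nn: "\<And>x. 0 \<le> invariant_weight q x" and q: "0 < q 0"
    using assms by (auto simp: positive_recurrent_def)
  have "(\<Sum>x<1. invariant_weight q x) \<le> suminf (invariant_weight q)"
    using s nn by (intro sum_le_suminf) auto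
  then have pos: "0 < suminf (invariant_weight q)" by simp
  have "(\<lambda>x. invariant_weight q x / suminf (invariant_weight q)) sums (suminf (invariant_weight q) / suminf (invariant_weight q))"
    by (rule sums_divide[OF summable_sums[OF s]])
  then have "invariant_vector q sums 1"
    using pos unfolding invariant_vector_def[abs_def] by simp
  then show "probability_vector (invariant_vector q)"
    using nn pos by (simp add: probability_vector_def invariant_vector_def)
  show "balanced q (invariant_vector q)"
    unfolding invariant_vector_def[abs_def] using q by (intro balanced_scale balanced_invariant_weight) simp
qed

lemma invariant_weight_measurable [measurable]:
  "(\<lambda>q. invariant_weight q x) \<in> borel_measurable (borel :: (nat \<Rightarrow> real) measure)"
proof (induction x rule: less_induct)
  case (less x)
  show ?case
  proof (cases x)
    case (Suc y)
    have "(\<lambda>q. invariant_weight q z * kern q z y) \<in> borel_measurable borel" if "z \<le> y" for z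
      using less[of z] that Suc unfolding kern_def by simp
    then have "(\<lambda>q. \<Sum>z\<le>y. invariant_weight q z * kern q z y) \<in> borel_measurable borel"
      by (intro borel_measurable_sum) simp
    then show ?thesis using less[of y] Suc by simp
  qed simp
qed

lemma AE_eq_if_integrals_eq:
  fixes f g :: "'a \<Rightarrow> ennreal"
  assumes [measurable]: "f \<in> borel_measurable M" "g \<in> borel_measurable M"
    and "(\<integral>\<^sup>+x. f x \<partial>M) \<noteq> \<infinity>"
    and "\<And>D. D \<in> sets M \<Longrightarrow> (\<integral>\<^sup>+x. f x * indicator D x \<partial>M) = (\<integral>\<^sup>+x. g x * indicator D x \<partial>M)"
  shows "AE x in M. f x = g x"
proof -
  have "density M f = density M g"
    by (rule measure_eqI) (simp_all add: emeasure_density assms(4))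
  then show ?thesis using assms(3) finite_density_unique[of f M g] by simp
qed

lemma suminf_cyl_start:
  fixes c :: ennreal
  assumes "X \<in> dsf_seqs" shows "(\<Sum>x. c * indicator (cyl x []) X) = c"
  by (rule suminf_cmult_indicator[where i = "X 0"])
    (use assms in \<open>auto simp: disjoint_family_on_def cyl_def\<close>)

lemma suminf_cyl_single:
  fixes c :: ennreal
  shows "(\<Sum>r. c * indicator (cyl x [r]) X) = c * indicator (cyl x []) X"
proof (cases "X \<in> cyl x []")
  case True
  have "(\<Sum>r. c * indicator (cyl x [r]) X) = c"
    by (rule suminf_cmult_indicator[where i = "incr X 0"])
      (use True in \<open>auto simp: disjoint_family_on_def cyl_def initial_string_Suc\<close>)
  then show ?thesis using True by simp
next
  case False
  then have "X \<notin> cyl x [r]" for r by (auto simp: cyl_def)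
  then show ?thesis using False by simp
qed

context partially_exchangeable
begin

definition p_law :: "(nat \<Rightarrow> real) measure" where
  "p_law = distr P borel p"

text \<open>The conditional probability of the start \<open>x\<close> given the limiting frequencies.\<close>

definition start_density :: "nat \<Rightarrow> (nat \<Rightarrow> real) \<Rightarrow> ennreal" where
  "start_density x = RN_deriv p_law (distr (density P (indicator (cyl x []))) borel p)"

lemma sets_p_law [measurable_cong, simp]: "sets p_law = sets borel"
  by (simp add: p_law_def)

lemma prob_space_p_law: "prob_space p_law"
  unfolding p_law_def by (rule prob_space_distr[OF p_measurable])

lemma start_density_measurable [measurable]: "start_density x \<in> borel_measurable borel"
proof -
  have "start_density x \<in> borel_measurable p_law" unfolding start_density_def by simp
  then show ?thesis by (simp cong: measurable_cong_sets)
qed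

lemma nn_integral_p_law: "f \<in> borel_measurable borel \<Longrightarrow> (\<integral>\<^sup>+q. f q \<partial>p_law) = (\<integral>\<^sup>+X. f (p X) \<partial>P)"
  unfolding p_law_def by (subst nn_integral_distr[OF p_measurable]) simp_all

lemma nn_integral_start:
  assumes [measurable]: "\<psi> \<in> borel_measurable borel"
  shows "(\<integral>\<^sup>+X. indicator (cyl x []) X * \<psi> (p X) \<partial>P) = (\<integral>\<^sup>+q. start_density x q * \<psi> q \<partial>p_law)"
proof -
  interpret p_law: prob_space p_law by (rule prob_space_p_law)
  have [measurable]: "cyl x [] \<in> sets P" by (rule cyl_sets_P)
  let ?L = "distr (density P (indicator (cyl x []))) borel p"
  have L: "emeasure ?L D = emeasure P {X \<in> cyl x []. p X \<in> D}" if "D \<in> sets borel" for D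
    by (rule emeasure_distr_density_indicator[OF cyl_sets_P p_measurable that])
  have ac: "absolutely_continuous p_law ?L"
    unfolding absolutely_continuous_def
  proof
    fix D assume D: "D \<in> null_sets p_law"
    then have Db: "D \<in> sets borel" by auto
    have "emeasure ?L D \<le> emeasure p_law D"
      unfolding L[OF Db] p_law_def using Db
      using measurable_sets[OF p_measurable Db]
      by (simp add: emeasure_distr) (intro emeasure_mono, auto simp: cyl_def)
    then show "D \<in> null_sets ?L" using D Db by (auto simp: null_sets_def)
  qed
  have "(\<integral>\<^sup>+X. indicator (cyl x []) X * \<psi> (p X) \<partial>P) = (\<integral>\<^sup>+q. \<psi> q \<partial>?L)"
    by (simp add: nn_integral_distr nn_integral_density)
  also have "?L = density p_law (start_density x)"
    unfolding start_density_def using p_law.density_RN_deriv[OF ac] by simp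
  also have "(\<integral>\<^sup>+q. \<psi> q \<partial>density p_law (start_density x)) = (\<integral>\<^sup>+q. start_density x q * \<psi> q \<partial>p_law)"
    by (rule nn_integral_density) simp_all
  finally show ?thesis .
qed

lemma nn_integral_split_start:
  assumes [measurable]: "f \<in> borel_measurable P"
  shows "(\<integral>\<^sup>+X. f X \<partial>P) = (\<Sum>x. \<integral>\<^sup>+X. indicator (cyl x []) X * f X \<partial>P)"
proof -
  have [measurable]: "cyl x [] \<in> sets P" for x by (rule cyl_sets_P)
  have "(\<integral>\<^sup>+X. f X \<partial>P) = (\<integral>\<^sup>+X. (\<Sum>x. f X * indicator (cyl x []) X) \<partial>P)"
    by (rule nn_integral_cong) (simp only: space_P suminf_cyl_start)
  also have "\<dots> = (\<Sum>x. \<integral>\<^sup>+X. f X * indicator (cyl x []) X \<partial>P)"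
    by (rule nn_integral_suminf) measurable
  finally show ?thesis by (simp only: mult.commute)
qed

text \<open>Summing \<open>replace_last_increment\<close> over all values of the first increment gives the whole
  space.\<close>

lemma AE_p_sums_1: "AE q in p_law. (\<Sum>r. ennreal (q r)) = 1"
proof (rule AE_eq_if_integrals_eq)
  interpret p_law: prob_space p_law by (rule prob_space_p_law)
  have eq: "(\<integral>\<^sup>+q. (\<Sum>r. ennreal (q r)) * indicator D q \<partial>p_law) = (\<integral>\<^sup>+q. 1 * indicator D q \<partial>p_law)"
    if D[measurable]: "D \<in> sets borel" for D
  proof -
    have [measurable]: "cyl x w \<in> sets P" for x w by (rule cyl_sets_P)
    have "(\<integral>\<^sup>+q. (\<Sum>r. ennreal (q r)) * indicator D q \<partial>p_law) =
        (\<integral>\<^sup>+X. (\<Sum>r. ennreal (p X r)) * indicator D (p X) \<partial>P)"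
      by (rule nn_integral_p_law) measurable
    also have "\<dots> = (\<Sum>x. \<integral>\<^sup>+X. indicator (cyl x []) X * ((\<Sum>r. ennreal (p X r)) * indicator D (p X)) \<partial>P)"
      by (rule nn_integral_split_start) measurable
    also have "\<dots> = (\<Sum>x. \<integral>\<^sup>+X. indicator (cyl x []) X * indicator D (p X) \<partial>P)"
    proof (rule suminf_cong)
      fix x
      have "(\<integral>\<^sup>+X. indicator (cyl x []) X * ((\<Sum>r. ennreal (p X r)) * indicator D (p X)) \<partial>P) =
          (\<integral>\<^sup>+X. (\<Sum>r. indicator (cyl x []) X * (ennreal (p X r) * indicator D (p X))) \<partial>P)"
        by (intro nn_integral_cong) simp
      also have "\<dots> = (\<Sum>r. \<integral>\<^sup>+X. indicator (cyl x []) X * (ennreal (p X r) * indicator D (p X)) \<partial>P)"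
        by (rule nn_integral_suminf) measurable
      also have "\<dots> = (\<Sum>r. \<integral>\<^sup>+X. indicator (cyl x ([] @ [r])) X * indicator D (p X) \<partial>P)"
        by (intro suminf_cong replace_last_increment[symmetric]) (auto simp: indicator_def)
      also have "\<dots> = (\<Sum>r. \<integral>\<^sup>+X. indicator D (p X) * indicator (cyl x [r]) X \<partial>P)"
        by (simp only: append_Nil mult.commute)
      also have "\<dots> = (\<integral>\<^sup>+X. (\<Sum>r. indicator D (p X) * indicator (cyl x [r]) X) \<partial>P)"
        by (rule nn_integral_suminf[symmetric]) measurable
      also have "\<dots> = (\<integral>\<^sup>+X. indicator (cyl x []) X * indicator D (p X) \<partial>P)"
        by (simp only: suminf_cyl_single mult.commute)
      finally show "(\<integral>\<^sup>+X. indicator (cyl x []) X * ((\<Sum>r. ennreal (p X r)) * indicator D (p X)) \<partial>P) =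
          (\<integral>\<^sup>+X. indicator (cyl x []) X * indicator D (p X) \<partial>P)" .
    qed
    also have "\<dots> = (\<integral>\<^sup>+X. indicator D (p X) \<partial>P)"
      by (rule nn_integral_split_start[symmetric]) measurable
    also have "\<dots> = (\<integral>\<^sup>+q. indicator D q \<partial>p_law)" by (rule nn_integral_p_law[symmetric]) measurable
    finally show ?thesis by simp
  qed
  show "(\<integral>\<^sup>+q. (\<Sum>r. ennreal (q r)) * indicator D q \<partial>p_law) = (\<integral>\<^sup>+q. 1 * indicator D q \<partial>p_law)"
    if "D \<in> sets p_law" for D using eq that by simp
  show "(\<integral>\<^sup>+q. (\<Sum>r. ennreal (q r)) \<partial>p_law) \<noteq> \<infinity>"
    using eq[of UNIV] p_law.emeasure_space_1 by (simp add: p_law_def)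
qed measurable

lemma AE_start_density_sums_1: "AE q in p_law. (\<Sum>x. start_density x q) = 1"
proof (rule AE_eq_if_integrals_eq)
  interpret p_law: prob_space p_law by (rule prob_space_p_law)
  have eq: "(\<integral>\<^sup>+q. (\<Sum>x. start_density x q) * indicator D q \<partial>p_law) = (\<integral>\<^sup>+q. 1 * indicator D q \<partial>p_law)"
    if D[measurable]: "D \<in> sets borel" for D
  proof -
    have "(\<integral>\<^sup>+q. (\<Sum>x. start_density x q) * indicator D q \<partial>p_law) =
        (\<integral>\<^sup>+q. (\<Sum>x. start_density x q * indicator D q) \<partial>p_law)" by simp
    also have "\<dots> = (\<Sum>x. \<integral>\<^sup>+q. start_density x q * indicator D q \<partial>p_law)"
      by (rule nn_integral_suminf) measurable
    also have "\<dots> = (\<Sum>x. \<integral>\<^sup>+X. indicator (cyl x []) X * indicator D (p X) \<partial>P)"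
      by (intro suminf_cong nn_integral_start[symmetric]) measurable
    also have "\<dots> = (\<integral>\<^sup>+X. indicator D (p X) \<partial>P)"
      by (rule nn_integral_split_start[symmetric]) measurable
    also have "\<dots> = (\<integral>\<^sup>+q. indicator D q \<partial>p_law)" by (rule nn_integral_p_law[symmetric]) measurable
    finally show ?thesis by simp
  qed
  show "(\<integral>\<^sup>+q. (\<Sum>x. start_density x q) * indicator D q \<partial>p_law) = (\<integral>\<^sup>+q. 1 * indicator D q \<partial>p_law)"
    if "D \<in> sets p_law" for D using eq that by simp
  show "(\<integral>\<^sup>+q. (\<Sum>x. start_density x q) \<partial>p_law) \<noteq> \<infinity>"
    using eq[of UNIV] p_law.emeasure_space_1 by (simp add: p_law_def)
qed measurable

text \<open>The state \<open>y\<close> is reached from \<open>x \<le> Suc y\<close> by exactly one increment, and from no other state.\<close>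

lemma indicator_step:
  assumes "X \<in> dsf_seqs"
  shows "indicator (cyl y []) (shift_by 1 X) = (\<Sum>x\<le>Suc y. indicator (cyl x [y - (x - 1)]) X :: ennreal)"
proof (cases "X 1 = y")
  case True
  have le: "X 0 \<le> Suc y" and i: "incr X 0 = y - (X 0 - 1)"
    using True dsf_step[OF assms, of 0] by (auto simp: advance_def)
  have "(\<Sum>x\<le>Suc y. indicator (cyl x [y - (x - 1)]) X :: ennreal) = (\<Sum>x\<le>Suc y. if x = X 0 then 1 else 0)"
    using i assms by (intro sum.cong refl) (auto simp: indicator_def cyl_def initial_string_Suc)
  also have "\<dots> = 1" using le by (simp del: sum.atMost_Suc)
  finally show ?thesis using True assms shift_by_dsf by (simp add: cyl_def shift_by_apply del: sum.atMost_Suc)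
next
  case False
  have "indicator (cyl x [y - (x - 1)]) X = (0 :: ennreal)" if "x \<le> Suc y" for x
  proof -
    have "X \<notin> cyl x [y - (x - 1)]"
    proof
      assume c: "X \<in> cyl x [y - (x - 1)]"
      then have "X 1 = y" using cyl_state[of X x "[y - (x - 1)]" "[]"] that by (simp add: advance_def)
      then show False using False by simp
    qed
    then show ?thesis by simp
  qed
  then have "(\<Sum>x\<le>Suc y. indicator (cyl x [y - (x - 1)]) X :: ennreal) = 0" by (intro sum.neutral) simp
  then show ?thesis using False by (simp add: cyl_def shift_by_apply del: sum.atMost_Suc)
qed

text \<open>By stationarity the event that the start is \<open>y\<close> may be replaced by the event that the next state
  is \<open>y\<close>, while \<open>p\<close> is unchanged by the shift. Splitting according to the start gives the balance
  equation.\<close>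

lemma AE_start_density_balanced:
  "AE q in p_law. \<forall>y. start_density y q = (\<Sum>x\<le>Suc y. start_density x q * ennreal (kern q x y))"
proof -
  interpret p_law: prob_space p_law by (rule prob_space_p_law)
  have kern_meas[measurable]: "(\<lambda>q. kern q x y) \<in> borel_measurable borel" for x y unfolding kern_def by measurable
  have "AE q in p_law. start_density y q = (\<Sum>x\<le>Suc y. start_density x q * ennreal (kern q x y))" for y
  proof (rule AE_eq_if_integrals_eq)
    have [measurable]: "cyl x w \<in> sets P" for x w by (rule cyl_sets_P)
    show "(\<integral>\<^sup>+q. start_density y q * indicator D q \<partial>p_law) =
        (\<integral>\<^sup>+q. (\<Sum>x\<le>Suc y. start_density x q * ennreal (kern q x y)) * indicator D q \<partial>p_law)"
      if "D \<in> sets p_law" for D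
    proof -
      have D[measurable]: "D \<in> sets borel" using that by simp
      have "(\<integral>\<^sup>+q. start_density y q * indicator D q \<partial>p_law) =
          (\<integral>\<^sup>+X. indicator (cyl y []) X * indicator D (p X) \<partial>P)"
        by (rule nn_integral_start[symmetric]) measurable
      also have "\<dots> = (\<integral>\<^sup>+X. indicator (cyl y []) X * indicator D (p X) \<partial>distr P P (shift_by 1))"
        by (simp only: distr_shift_by)
      also have "\<dots> = (\<integral>\<^sup>+X. indicator (cyl y []) (shift_by 1 X) * indicator D (p (shift_by 1 X)) \<partial>P)"
        by (rule nn_integral_distr[OF shift_by_measurable_P]) measurable
      also have "\<dots> = (\<integral>\<^sup>+X. (\<Sum>x\<le>Suc y. indicator (cyl x ([] @ [y - (x - 1)])) X * indicator D (p X)) \<partial>P)"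
        by (intro nn_integral_cong)
          (simp only: space_P indicator_step p_shift_by sum_distrib_right append_Nil)
      also have "\<dots> = (\<Sum>x\<le>Suc y. \<integral>\<^sup>+X. indicator (cyl x ([] @ [y - (x - 1)])) X * indicator D (p X) \<partial>P)"
        by (rule nn_integral_sum) measurable
      also have "\<dots> = (\<Sum>x\<le>Suc y. \<integral>\<^sup>+q. start_density x q * ennreal (kern q x y) * indicator D q \<partial>p_law)"
      proof (rule sum.cong[OF refl])
        fix x assume "x \<in> {..Suc y}"
        then have k: "kern q x y = q (y - (x - 1))" for q by (simp add: kern_def)
        have "(\<integral>\<^sup>+X. indicator (cyl x ([] @ [y - (x - 1)])) X * indicator D (p X) \<partial>P) =
            (\<integral>\<^sup>+X. indicator (cyl x []) X * (ennreal (p X (y - (x - 1))) * indicator D (p X)) \<partial>P)"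
          by (rule replace_last_increment) (auto simp: indicator_def)
        also have "\<dots> = (\<integral>\<^sup>+q. start_density x q * (ennreal (q (y - (x - 1))) * indicator D q) \<partial>p_law)"
          by (rule nn_integral_start) measurable
        finally show "(\<integral>\<^sup>+X. indicator (cyl x ([] @ [y - (x - 1)])) X * indicator D (p X) \<partial>P) =
            (\<integral>\<^sup>+q. start_density x q * ennreal (kern q x y) * indicator D q \<partial>p_law)"
          by (simp only: k mult.assoc)
      qed
      also have "\<dots> = (\<integral>\<^sup>+q. (\<Sum>x\<le>Suc y. start_density x q * ennreal (kern q x y) * indicator D q) \<partial>p_law)"
        by (rule nn_integral_sum[symmetric]) measurable
      finally show ?thesis by (simp only: sum_distrib_right)
    qed
    have "(\<integral>\<^sup>+q. start_density y q * 1 \<partial>p_law) = (\<integral>\<^sup>+X. indicator (cyl y []) X * 1 \<partial>P)"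
      by (rule nn_integral_start[symmetric]) measurable
    also have "\<dots> = emeasure P (cyl y [])" by simp
    finally show "(\<integral>\<^sup>+q. start_density y q \<partial>p_law) \<noteq> \<infinity>" by (simp add: emeasure_eq_measure)
  qed measurable
  then show ?thesis unfolding AE_all_countable by blast
qed

lemma AE_p_bounds: "AE q in p_law. \<forall>r. 0 \<le> q r \<and> q r \<le> 1"
proof -
  have "AE q in p_law. 0 \<le> q r \<and> q r \<le> 1" for r
    unfolding p_law_def by (subst AE_distr_iff[OF p_measurable]) (auto simp: freq_limit_bounds)
  then show ?thesis unfolding AE_all_countable by blast
qed

lemma AE_p_law_probability_vector: "AE q in p_law. probability_vector q"
  using AE_p_bounds AE_p_sums_1
proof eventually_elim
  case (elim q)
  have s: "summable q" using elim by (intro summable_suminf_not_top) auto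
  have nn: "0 \<le> q r" for r using elim(1) by blast
  have "(\<Sum>r. ennreal (q r)) = ennreal (suminf q)" by (rule suminf_ennreal2[OF nn s])
  then have "ennreal (suminf q) = 1" using elim(2) by (simp only:)
  then have "suminf q = 1" by simp
  then show ?case using s nn by (simp add: probability_vector_def sums_iff)
qed

lemma AE_start_density_eq:
  "AE q in p_law. 0 < q 0 \<longrightarrow> positive_recurrent q \<and> (\<forall>x. start_density x q = ennreal (invariant_vector q x))"
  using AE_p_law_probability_vector AE_start_density_sums_1 AE_start_density_balanced
proof (eventually_elim, intro impI)
  fix q assume q: "probability_vector q" and s: "(\<Sum>x. start_density x q) = 1"
    and b: "\<forall>y. start_density y q = (\<Sum>x\<le>Suc y. start_density x q * ennreal (kern q x y))" and q0: "0 < q 0"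
  define \<nu> where "\<nu> x = enn2real (start_density x q)" for x
  have fin: "start_density x q \<noteq> top" for x
  proof -
    have "(\<Sum>x\<in>{x}. start_density x q) \<le> (\<Sum>x. start_density x q)" by (rule sum_le_suminf) auto
    then show ?thesis using s by (auto simp: top_unique)
  qed
  then have e: "start_density x q = ennreal (\<nu> x)" for x by (simp add: \<nu>_def less_top)
  have nn: "0 \<le> \<nu> x" for x by (simp add: \<nu>_def)
  have "summable \<nu>" using s nn unfolding e by (intro summable_suminf_not_top) auto
  moreover have "suminf \<nu> = 1"
  proof -
    have "(\<Sum>x. ennreal (\<nu> x)) = ennreal (suminf \<nu>)" by (rule suminf_ennreal2[OF nn \<open>summable \<nu>\<close>])
    then have "ennreal (suminf \<nu>) = 1" using s unfolding e by (simp only:)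
    then show ?thesis by simp
  qed
  ultimately have pv: "probability_vector \<nu>" using nn by (auto simp: probability_vector_def sums_iff)
  have kn: "0 \<le> kern q x y" for x y using q by (simp add: kern_def probability_vector_def)
  have "balanced q \<nu>"
    unfolding balanced_def
  proof
    fix y
    have "ennreal (\<nu> y) = (\<Sum>x\<le>Suc y. ennreal (\<nu> x) * ennreal (kern q x y))" using b unfolding e by blast
    also have "\<dots> = (\<Sum>x\<le>Suc y. ennreal (\<nu> x * kern q x y))"
      by (intro sum.cong refl ennreal_mult[symmetric] nn kn)
    also have "\<dots> = ennreal (\<Sum>x\<le>Suc y. \<nu> x * kern q x y)"
      by (intro sum_ennreal mult_nonneg_nonneg nn kn)
    finally have "ennreal (\<nu> y) = ennreal (\<Sum>x\<le>Suc y. \<nu> x * kern q x y)" .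
    moreover have "0 \<le> (\<Sum>x\<le>Suc y. \<nu> x * kern q x y)"
      by (intro sum_nonneg mult_nonneg_nonneg nn kn)
    ultimately show "\<nu> y = (\<Sum>x\<le>Suc y. \<nu> x * kern q x y)"
      using ennreal_inj[OF nn] by blast
  qed
  from balanced_unique[OF this pv q q0] show "positive_recurrent q \<and> (\<forall>x. start_density x q = ennreal (invariant_vector q x))"
    using e by simp
qed

text \<open>If \<open>p X 0 = 0\<close>, almost surely no increment is 0, and then zero is never entered; a constant path
  with value at least 1 has only ones as increments, so that \<open>p X 0 = 0\<close>.\<close>

lemma AE_zeros_iff_p_pos:
  "AE X in P. (0 < p X 0 \<and> (\<forall>n. \<exists>k\<ge>n. X k = 0)) \<or> (p X 0 = 0 \<and> 1 \<le> X 0 \<and> (\<forall>k. X k = X 0))"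
proof -
  have [measurable]: "cyl x w \<in> sets P" for x w by (rule cyl_sets_P)
  have [measurable]: "{q :: nat \<Rightarrow> real. q 0 = 0} \<in> sets borel"
  proof -
    have "{q \<in> space (borel :: (nat \<Rightarrow> real) measure). q 0 = 0} \<in> sets borel" by measurable
    then show ?thesis by simp
  qed
  have "AE X in P. p X 0 = 0 \<longrightarrow> X \<notin> cyl x [0]" for x
  proof -
    have "(\<integral>\<^sup>+X. indicator (cyl x ([] @ [0])) X * indicator {q. q 0 = 0} (p X) \<partial>P) =
        (\<integral>\<^sup>+X. indicator (cyl x []) X * (ennreal (p X 0) * indicator {q. q 0 = 0} (p X)) \<partial>P)"
      by (rule replace_last_increment) (auto simp: indicator_def)
    also have "\<dots> = (\<integral>\<^sup>+X. 0 \<partial>P)" by (intro nn_integral_cong) (auto simp: indicator_def)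
    finally have "(\<integral>\<^sup>+X. indicator (cyl x [0]) X * indicator {q. q 0 = 0} (p X) \<partial>P) = 0" by simp
    then have "AE X in P. indicator (cyl x [0]) X * indicator {q. q 0 = 0} (p X) = (0 :: ennreal)"
      by (subst (asm) nn_integral_0_iff_AE) auto
    then show ?thesis by eventually_elim (auto simp: indicator_def split: if_splits)
  qed
  then have "AE X in P. \<forall>x. p X 0 = 0 \<longrightarrow> X \<notin> cyl x [0]" unfolding AE_all_countable by blast
  then have "AE X in P. \<forall>n. \<forall>x. p (shift_by n X) 0 = 0 \<longrightarrow> shift_by n X \<notin> cyl x [0]"
    unfolding AE_all_countable[of _ P] by (intro allI AE_shift_by) (simp only: AE_all_countable)
  then show ?thesis using AE_zeros_or_constant AE_space
  proof eventually_elim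
    case (elim X)
    have nz: "incr X n \<noteq> 0" if "p X 0 = 0" for n
    proof
      assume "incr X n = 0"
      then have "shift_by n X \<in> cyl (X n) [0]"
        using elim(3) shift_by_dsf[of X n] by (simp add: cyl_def initial_string_Suc incr_shift_by_apply shift_by_apply)
      then show False using elim(1) that by (simp add: p_shift_by)
    qed
    show ?case
    proof (cases "p X 0 = 0")
      case True
      have "X (Suc n) \<noteq> 0" for n
        using nz[OF True, of n] dsf_step[of X n] elim(3) by (simp add: advance_def)
      then have "\<not> (\<forall>n. \<exists>k\<ge>n. X k = 0)" by (metis Suc_le_D)
      then show ?thesis using elim(2) True by blast
    next
      case False
      have "\<not> (1 \<le> X 0 \<and> (\<forall>k. X k = X 0))"
      proof
        assume "1 \<le> X 0 \<and> (\<forall>k. X k = X 0)"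
        then obtain k where "\<And>i. X i = k" "1 \<le> k" by blast
        then have "incr X = (\<lambda>_. 1)" by (simp add: incr_def fun_eq_iff)
        then have "p X 0 = 0" by (simp add: freq_limit_def freq_def)
        then show False using False by simp
      qed
      moreover have "0 < p X 0" using False freq_limit_bounds(1)[of "incr X" 0] by simp
      ultimately show ?thesis using elim(2) by blast
    qed
  qed
qed

end

section \<open>Markov laws\<close>

text \<open>Coordinate 0 of the product space is the start of the path, the other coordinates are its
  increments.\<close>

definition markov_law :: "(nat \<Rightarrow> real) \<Rightarrow> (nat \<Rightarrow> real) \<Rightarrow> (nat \<Rightarrow> nat) measure" where
  "markov_law q \<nu> = distr (PiM UNIV (\<lambda>i. measure_pmf (embed_pmf (if i = 0 then \<nu> else q)))) dsf_space
     (\<lambda>s. walk (s 0) (\<lambda>i. s (Suc i)))"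

definition point_vector :: "nat \<Rightarrow> nat \<Rightarrow> real" where
  "point_vector k j = of_bool (j = k)"

lemma probability_vector_point_vector: "probability_vector (point_vector k)"
  unfolding probability_vector_def point_vector_def of_bool_def using sums_single[of k "\<lambda>_. 1 :: real"] by auto

lemma suminf_probability_vector:
  assumes "probability_vector \<nu>" shows "(\<Sum>x. ennreal (\<nu> x)) = 1"
proof -
  have "(\<Sum>x. ennreal (\<nu> x)) = ennreal (suminf \<nu>)"
    using assms by (intro suminf_ennreal2) (auto simp: probability_vector_def sums_iff)
  then show ?thesis using assms by (simp add: probability_vector_def sums_iff)
qed

lemma pmf_probability_vector:
  assumes "probability_vector \<nu>" shows "pmf (embed_pmf \<nu>) x = \<nu> x"
  using assms suminf_probability_vector[OF assms]
  by (intro pmf_embed_pmf) (auto simp: probability_vector_def nn_integral_count_space_nat)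

text \<open>A cylinder is a rectangle in the product space.\<close>

lemma markov_law_cyl:
  assumes q: "probability_vector q" and \<nu>: "probability_vector \<nu>"
  shows "path_law (markov_law q \<nu>)"
    and "emeasure (markov_law q \<nu>) (cyl x w) = ennreal (\<nu> x * (\<Prod>r\<leftarrow>w. q r))"
proof -
  define M where "M i = measure_pmf (embed_pmf (if i = (0::nat) then \<nu> else q))" for i
  interpret product_prob_space M UNIV
    by (rule product_prob_spaceI) (simp add: M_def measure_pmf.prob_space_axioms)
  interpret P: prob_space "PiM UNIV M" by (rule prob_space_PiM) (simp add: M_def measure_pmf.prob_space_axioms)
  define F where "F s = walk (s 0) (\<lambda>i. s (Suc i))" for s :: "nat \<Rightarrow> nat"
  have Ps: "sets (PiM UNIV M) = sets (borel :: (nat \<Rightarrow> nat) measure)"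
    unfolding sets_borel_seq by (intro sets_PiM_cong) (simp_all add: M_def)
  have F: "F \<in> measurable (PiM UNIV M) dsf_space"
  proof -
    have "F \<in> measurable borel dsf_space"
    proof (rule measurable_dsfI)
      show "(\<lambda>s. F s i) \<in> measurable borel (count_space UNIV)" for i
        unfolding F_def by (induction i) (simp_all add: advance_def)
    qed (simp add: F_def)
    then show ?thesis using measurable_cong_sets[OF Ps refl] by blast
  qed
  have law: "markov_law q \<nu> = distr (PiM UNIV M) dsf_space F"
    unfolding markov_law_def M_def F_def ..
  show "path_law (markov_law q \<nu>)"
    unfolding law path_law_def path_law_axioms_def using P.prob_space_distr[OF F] by simp
  define Y where "Y i = (if i = 0 then {x} else {w ! (i - 1)})" for i
  have "emeasure (markov_law q \<nu>) (cyl x w) = emeasure (PiM UNIV M) (F -` cyl x w \<inter> space (PiM UNIV M))"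
    unfolding law by (rule emeasure_distr[OF F cyl_sets])
  also have "F -` cyl x w \<inter> space (PiM UNIV M) = {s \<in> space (PiM UNIV M). \<forall>i\<in>{..length w}. s i \<in> Y i}"
  proof -
    have "F s \<in> cyl x w \<longleftrightarrow> (\<forall>i\<in>{..length w}. s i \<in> Y i)" for s
    proof -
      have "F s \<in> cyl x w \<longleftrightarrow> s 0 = x \<and> (\<forall>i<length w. s (Suc i) = w ! i)"
        by (auto simp: cyl_def F_def initial_string_eq_iff)
      also have "\<dots> \<longleftrightarrow> (\<forall>i\<in>{..length w}. s i \<in> Y i)"
      proof
        assume l: "s 0 = x \<and> (\<forall>i<length w. s (Suc i) = w ! i)"
        show "\<forall>i\<in>{..length w}. s i \<in> Y i"
        proof
          fix i assume "i \<in> {..length w}"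
          then show "s i \<in> Y i" using l by (cases i) (auto simp: Y_def)
        qed
      next
        assume r: "\<forall>i\<in>{..length w}. s i \<in> Y i"
        have "s (Suc i) = w ! i" if "i < length w" for i
          using bspec[OF r, of "Suc i"] that by (simp add: Y_def)
        moreover have "s 0 = x" using bspec[OF r, of 0] by (simp add: Y_def)
        ultimately show "s 0 = x \<and> (\<forall>i<length w. s (Suc i) = w ! i)" by blast
      qed
      finally show ?thesis .
    qed
    then show ?thesis by blast
  qed
  also have "emeasure (PiM UNIV M) \<dots> = (\<Prod>i\<in>{..length w}. emeasure (M i) (Y i))"
    by (rule emeasure_PiM_Collect) (simp_all add: M_def)
  also have "\<dots> = (\<Prod>i\<in>{..length w}. ennreal (if i = 0 then \<nu> x else q (w ! (i - 1))))"
    by (intro prod.cong refl)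
      (simp add: M_def Y_def emeasure_pmf_single pmf_probability_vector q \<nu>)
  also have "\<dots> = ennreal (\<Prod>i\<in>{..length w}. if i = 0 then \<nu> x else q (w ! (i - 1)))"
    using q \<nu> by (intro prod_ennreal) (simp add: probability_vector_def)
  also have "(\<Prod>i\<in>{..length w}. if i = 0 then \<nu> x else q (w ! (i - 1))) = \<nu> x * (\<Prod>i<length w. q (w ! i))"
    by (subst prod.atMost_shift) simp
  also have "(\<Prod>i<length w. q (w ! i)) = (\<Prod>r\<leftarrow>w. q r)"
    by (simp add: prod.list_conv_set_nth atLeast0LessThan)
  finally show "emeasure (markov_law q \<nu>) (cyl x w) = ennreal (\<nu> x * (\<Prod>r\<leftarrow>w. q r))" .
qed

locale invariant_markov = stationary_law +
  fixes q \<nu> :: "nat \<Rightarrow> real"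
  assumes q: "probability_vector q" and \<nu>: "probability_vector \<nu>" and balanced: "balanced q \<nu>"
    and cyl_prob: "emeasure P (cyl x w) = ennreal (\<nu> x * (\<Prod>r\<leftarrow>w. q r))"
begin

lemma q_nonneg: "0 \<le> q r" using q by (simp add: probability_vector_def)

lemma \<nu>_nonneg: "0 \<le> \<nu> x" using \<nu> by (simp add: probability_vector_def)

lemma prod_q_nonneg: "0 \<le> (\<Prod>r\<leftarrow>w. q r)"
  by (induction w) (simp_all add: q_nonneg)

end

lemma invariant_markov_law:
  assumes q: "probability_vector q" and \<nu>: "probability_vector \<nu>" and b: "balanced q \<nu>"
  shows "invariant_markov (markov_law q \<nu>) q \<nu>"
proof -
  let ?P = "markov_law q \<nu>"
  interpret path_law ?P by (rule markov_law_cyl(1)[OF q \<nu>])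
  note cyl = markov_law_cyl(2)[OF q \<nu>]
  have qn: "0 \<le> q r" and \<nu>n: "0 \<le> \<nu> x" for r x using q \<nu> by (auto simp: probability_vector_def)
  have pn: "0 \<le> (\<Prod>r\<leftarrow>w. q r)" for w by (induction w) (simp_all add: qn)
  have ls: "left_shift \<in> measurable ?P dsf_space"
    unfolding left_shift_eq using shift_by_measurable measurable_cong_sets[OF sets_P refl] by blast
  have "distr ?P dsf_space left_shift = ?P"
  proof (rule dsf_law_eqI)
    show "finite_measure (distr ?P dsf_space left_shift)"
      using prob_space_distr[OF ls] by (simp add: prob_space_def)
    fix x w
    define A where "A z = cyl z ((x - (z - 1)) # w)" for z
    have "left_shift -` cyl x w \<inter> space ?P = (\<Union>z\<in>{..Suc x}. A z)"
    proof (intro set_eqI iffI)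
      fix X assume "X \<in> left_shift -` cyl x w \<inter> space ?P"
      then have c: "shift_by 1 X \<in> cyl x w" and d: "X \<in> dsf_seqs" by (auto simp: left_shift_eq)
      have "X 1 = x" using c by (simp add: cyl_def shift_by_apply)
      then have le: "X 0 \<le> Suc x" and i: "incr X 0 = x - (X 0 - 1)"
        using dsf_step[OF d, of 0] by (auto simp: advance_def)
      have "X \<in> cyl (X 0) ([x - (X 0 - 1)] @ w)"
        unfolding cyl_append using c d i by (auto simp: cyl_def initial_string_Suc)
      then show "X \<in> (\<Union>z\<in>{..Suc x}. A z)" using le by (intro UN_I[of "X 0"]) (simp_all add: A_def)
    next
      fix X assume "X \<in> (\<Union>z\<in>{..Suc x}. A z)"
      then obtain z where z: "z \<le> Suc x" "X \<in> cyl z ([x - (z - 1)] @ w)" by (auto simp: A_def)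
      then have d: "X \<in> dsf_seqs" by (simp add: cyl_def)
      have "X 1 = x" using cyl_state[OF z(2)] z(1) by (simp add: advance_def)
      moreover have "initial_string (length w) (incr (shift_by 1 X)) = w"
        using z(2) unfolding cyl_append by simp
      ultimately show "X \<in> left_shift -` cyl x w \<inter> space ?P"
        using d shift_by_dsf[OF d, of 1] by (simp add: left_shift_eq cyl_def shift_by_apply)
    qed
    then have "emeasure (distr ?P dsf_space left_shift) (cyl x w) = emeasure ?P (\<Union>z\<in>{..Suc x}. A z)"
      by (simp only: emeasure_distr[OF ls cyl_sets])
    also have "\<dots> = (\<Sum>z\<le>Suc x. emeasure ?P (A z))"
      unfolding A_def by (rule sum_emeasure[OF image_subsetI[OF cyl_sets_P], symmetric])
        (auto simp: disjoint_family_on_def cyl_def)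
    also have "\<dots> = (\<Sum>z\<le>Suc x. ennreal ((\<nu> z * kern q z x) * (\<Prod>r\<leftarrow>w. q r)))"
      by (intro sum.cong refl) (simp add: A_def cyl kern_def mult.assoc)
    also have "\<dots> = ennreal (\<Sum>z\<le>Suc x. (\<nu> z * kern q z x) * (\<Prod>r\<leftarrow>w. q r))"
      by (intro sum_ennreal mult_nonneg_nonneg \<nu>n pn) (simp add: kern_def qn)
    also have "(\<Sum>z\<le>Suc x. (\<nu> z * kern q z x) * (\<Prod>r\<leftarrow>w. q r)) = \<nu> x * (\<Prod>r\<leftarrow>w. q r)"
    proof -
      have "(\<Sum>z\<le>Suc x. \<nu> z * kern q z x) = \<nu> x" using b unfolding balanced_def by metis
      then show ?thesis by (simp only: sum_distrib_right[symmetric])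
    qed
    finally show "emeasure (distr ?P dsf_space left_shift) (cyl x w) = emeasure ?P (cyl x w)"
      by (simp only: cyl)
  qed (simp_all add: sets_P)
  then have "emeasure ?P (left_shift -` A \<inter> space ?P) = emeasure ?P A" if "A \<in> sets ?P" for A
    using emeasure_distr[OF ls, of A] that sets_P by metis
  then have "shift_invariant ?P" unfolding shift_invariant_def by blast
  then show ?thesis using q \<nu> b cyl by unfold_locales auto
qed

sublocale invariant_markov \<subseteq> partially_exchangeable
proof
  fix w w' :: "nat list" and x
  assume "mset w = mset w'"
  then have "mset (map q w) = mset (map q w')" by simp
  then have "(\<Prod>r\<leftarrow>w. q r) = (\<Prod>r\<leftarrow>w'. q r)" by (metis prod_mset_prod_list)
  then show "emeasure P (cyl x w) = emeasure P (cyl x w')" by (simp add: cyl_prob)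
qed

lemma ennreal_prod_list: "(\<And>r. 0 \<le> q r) \<Longrightarrow> (\<Prod>r\<leftarrow>w. ennreal (q r)) = ennreal (\<Prod>r\<leftarrow>w. q r)"
proof (induction w)
  case (Cons r w)
  have "0 \<le> (\<Prod>r\<leftarrow>w. q r)" using Cons.prems by (induction w) simp_all
  then show ?case using Cons by (simp add: ennreal_mult)
qed simp

lemma ergodic_if_AE_constant:
  assumes "path_law P" "shift_invariant P" and AE: "AE X in P. X = (\<lambda>_. c)"
  shows "A \<in> sets P \<Longrightarrow> emeasure P A = indicator A (\<lambda>_. c)" and "shift_ergodic P"
proof -
  interpret path_law P by fact
  show *: "emeasure P A = indicator A (\<lambda>_. c)" if "A \<in> sets P" for A
  proof -
    have "emeasure P A = (\<integral>\<^sup>+X. indicator A X \<partial>P)" using that by simp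
    also have "\<dots> = (\<integral>\<^sup>+X. indicator A (\<lambda>_. c) \<partial>P)"
      by (rule nn_integral_cong_AE) (use AE in eventually_elim, simp)
    also have "\<dots> = indicator A (\<lambda>_. c)" using emeasure_space_1 by simp
    finally show ?thesis .
  qed
  show "shift_ergodic P"
    unfolding shift_ergodic_def using assms(2) * by (auto simp: indicator_def)
qed

context invariant_markov
begin

lemma increments_prob: "emeasure P {X \<in> space P. initial_string (length w) (incr X) = w} = ennreal (\<Prod>r\<leftarrow>w. q r)"
proof -
  have U: "{X \<in> space P. initial_string (length w) (incr X) = w} = (\<Union>x. cyl x w)" by (auto simp: cyl_def)
  have "(\<Sum>x. emeasure P (cyl x w)) = emeasure P (\<Union>x. cyl x w)"
    by (rule suminf_emeasure[OF image_subsetI[OF cyl_sets_P]]) (auto simp: disjoint_family_on_def cyl_def)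
  moreover have "(\<Sum>x. emeasure P (cyl x w)) = (\<Sum>x. ennreal (\<nu> x) * ennreal (\<Prod>r\<leftarrow>w. q r))"
    by (intro suminf_cong) (simp only: cyl_prob ennreal_mult \<nu>_nonneg prod_q_nonneg)
  ultimately show ?thesis unfolding U by (simp add: suminf_probability_vector[OF \<nu>])
qed

lemma nn_integral_prod_p: "(\<integral>\<^sup>+X. (\<Prod>r\<leftarrow>w. ennreal (p X r)) \<partial>P) = ennreal (\<Prod>r\<leftarrow>w. q r)"
proof -
  have m: "(\<lambda>X. \<Prod>r\<leftarrow>w. ennreal (p X r)) \<in> borel_measurable P" by (induction w) simp_all
  have "(\<integral>\<^sup>+X. (\<Prod>r\<leftarrow>w. ennreal (p X r)) \<partial>P) =
      (\<Sum>x. \<integral>\<^sup>+X. indicator (cyl x []) X * (\<Prod>r\<leftarrow>w. ennreal (p X r)) \<partial>P)"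
    by (rule nn_integral_split_start[OF m])
  also have "\<dots> = (\<Sum>x. emeasure P (cyl x w))"
  proof (rule suminf_cong)
    fix x
    have "(\<integral>\<^sup>+X. indicator (cyl x []) X * (\<Prod>r\<leftarrow>w. ennreal (p X r)) \<partial>P) = (\<integral>\<^sup>+X. indicator (cyl x w) X * 1 \<partial>P)"
      using de_Finetti_formula[of "\<lambda>_. 1" x w] by simp
    also have "\<dots> = emeasure P (cyl x w)" using cyl_sets_P[of x w] by simp
    finally show "(\<integral>\<^sup>+X. indicator (cyl x []) X * (\<Prod>r\<leftarrow>w. ennreal (p X r)) \<partial>P) = emeasure P (cyl x w)" .
  qed
  also have "\<dots> = (\<Sum>x. ennreal (\<nu> x) * ennreal (\<Prod>r\<leftarrow>w. q r))"
    by (intro suminf_cong) (simp only: cyl_prob ennreal_mult \<nu>_nonneg prod_q_nonneg)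
  finally show ?thesis by (simp add: suminf_probability_vector[OF \<nu>])
qed

text \<open>The first two moments of \<open>p X r\<close> are \<open>q r\<close> and its square, so \<open>p X r\<close> has variance zero.\<close>

lemma AE_p_eq: "AE X in P. p X = q"
proof -
  have "AE X in P. p X r = q r" for r
  proof -
    have i1: "integrable P (\<lambda>X. p X r)" and i2: "integrable P (\<lambda>X. p X r * p X r)"
      by (rule integrable_const_bound[where B = 1]; simp add: freq_limit_bounds mult_le_one)+
    have "ennreal (\<integral>X. p X r \<partial>P) = ennreal (q r)"
      using nn_integral_prod_p[of "[r]"] nn_integral_eq_integral[OF i1] by (simp add: freq_limit_bounds)
    then have e1: "(\<integral>X. p X r \<partial>P) = q r"
      by (simp add: q_nonneg freq_limit_bounds)
    have "ennreal (\<integral>X. p X r * p X r \<partial>P) = ennreal (q r * q r)"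
      using nn_integral_prod_p[of "[r, r]"] nn_integral_eq_integral[OF i2]
      by (simp add: freq_limit_bounds ennreal_mult[symmetric])
    then have e2: "(\<integral>X. p X r * p X r \<partial>P) = q r * q r"
      by (simp add: q_nonneg freq_limit_bounds)
    have sq: "(p X r - q r)\<^sup>2 = p X r * p X r - 2 * q r * p X r + q r * q r" for X
      by (simp add: power2_eq_square algebra_simps)
    have "(\<integral>X. (p X r - q r)\<^sup>2 \<partial>P) = 0"
      unfolding sq using i1 i2 e1 e2 prob_space by simp
    moreover have "integrable P (\<lambda>X. (p X r - q r)\<^sup>2)" unfolding sq using i1 i2 by simp
    ultimately have "AE X in P. (p X r - q r)\<^sup>2 = 0"
      using integral_nonneg_eq_0_iff_AE[of P "\<lambda>X. (p X r - q r)\<^sup>2"] by simp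
    then show ?thesis by eventually_elim simp
  qed
  then have "AE X in P. \<forall>r. p X r = q r" unfolding AE_all_countable by blast
  then show ?thesis by eventually_elim (rule ext, blast)
qed

lemma future_independent:
  assumes C: "C \<in> sets borel"
  shows "emeasure P {X \<in> cyl x w. incr (shift_by (length w) X) \<in> C} =
    emeasure P (cyl x w) * emeasure P {X \<in> space P. incr X \<in> C}"
proof -
  let ?N1 = "distr (density P (indicator (cyl x w))) borel (\<lambda>X. incr (shift_by (length w) X))"
  let ?N2 = "scale_measure (emeasure P (cyl x w)) (distr P borel incr)"
  have im: "incr \<in> measurable P borel" by measurable
  have N1: "emeasure ?N1 C = emeasure P {X \<in> cyl x w. incr (shift_by (length w) X) \<in> C}"
    if "C \<in> sets borel" for C
    by (rule emeasure_distr_density_indicator[OF cyl_sets_P incr_shift_measurable that])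
  have N2: "emeasure ?N2 C = emeasure P (cyl x w) * emeasure P {X \<in> space P. incr X \<in> C}"
    if "C \<in> sets borel" for C
  proof -
    have "incr -` C \<inter> space P = {X \<in> space P. incr X \<in> C}" by auto
    then show ?thesis using emeasure_distr[OF im that] by (simp only: emeasure_scale_measure)
  qed
  have "?N1 = ?N2"
  proof (rule finite_measure_eqI_prefix[where D = UNIV])
    show "finite_measure ?N1" by (rule finite_measureI) (simp add: N1)
    fix v
    note s = prefix_sets_borel[of v]
    have "emeasure ?N1 {s. initial_string (length v) s = v} = emeasure P (cyl x (w @ v))"
      unfolding N1[OF s] by (intro arg_cong[where f = "emeasure P"]) (auto simp: cyl_append)
    also have "\<dots> = ennreal (\<nu> x * (\<Prod>r\<leftarrow>w. q r)) * ennreal (\<Prod>r\<leftarrow>v. q r)"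
      unfolding cyl_prob by (simp add: ennreal_mult[symmetric] \<nu>_nonneg prod_q_nonneg mult.assoc)
    also have "\<dots> = emeasure ?N2 {s. initial_string (length v) s = v}"
      using N2[OF s] by (simp only: mem_Collect_eq increments_prob cyl_prob)
    finally show "emeasure ?N1 {s \<in> UNIV. initial_string (length v) s = v} =
        emeasure ?N2 {s \<in> UNIV. initial_string (length v) s = v}" by simp
  qed (simp_all add: sets_restrict_UNIV)
  then show ?thesis using N1[OF C] N2[OF C] by simp
qed

text \<open>After its first zero the path agrees with the walk that starts at 0 and has the same increments.\<close>

lemma coalesce_with_zero_start:
  assumes "\<eta> \<in> dsf_seqs" "\<eta> k = 0"
  shows "shift_by (Suc k) \<eta> = shift_by (Suc k) (walk 0 (incr \<eta>))"
proof
  fix i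
  have "k \<in> {j. j < Suc k \<and> \<eta> j = 0}" using assms by simp
  then have "0 < card {j. j < Suc k \<and> \<eta> j = 0}" by (auto simp: card_gt_0_iff)
  then have "0 < zeros_before_end (\<eta> 0) (initial_string (Suc k) (incr \<eta>))"
    using zeros_before_end_card[OF assms(1)] by simp
  from coalesce[OF this]
  have "endpoint (\<eta> 0) (initial_string (Suc k + i) (incr \<eta>)) = endpoint 0 (initial_string (Suc k + i) (incr \<eta>))"
    by (simp only: initial_string_add foldl_append)
  then show "shift_by (Suc k) \<eta> i = shift_by (Suc k) (walk 0 (incr \<eta>)) i"
    using dsf_endpoint[OF assms(1), of "Suc k + i"] by (simp only: shift_by_apply walk_endpoint)
qed

text \<open>Zero is visited infinitely often. By coalescence, an invariant event occurs for \<open>X\<close> if and only if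
  it occurs for the walk that starts at 0 and is driven by the increments after time \<open>n\<close>. These are
  independent of the cylinders of length \<open>n\<close>, so the event is independent of all cylinders and hence of
  itself.\<close>

lemma ergodic_if_q0_pos:
  assumes q0: "0 < q 0"
  shows "shift_ergodic P"
  unfolding shift_ergodic_def
proof (intro conjI ballI impI invariant)
  fix A assume A: "A \<in> sets P" and inv: "left_shift -` A \<inter> space P = A"
  have A1: "left_shift X \<in> A \<longleftrightarrow> X \<in> A" if "X \<in> dsf_seqs" for X using inv that by auto
  have Ainv: "shift_by n X \<in> A \<longleftrightarrow> X \<in> A" if "X \<in> dsf_seqs" for n X
  proof (induction n)
    case (Suc n)
    then show ?case using A1[OF shift_by_dsf[OF that, of n]] by (simp add: shift_by_Suc)
  qed simp
  have AD: "A \<in> sets dsf_space" using A sets_P by simp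
  define C where "C = walk 0 -` A"
  have C: "C \<in> sets borel" unfolding C_def using measurable_sets[OF walk_measurable AD, of 0] by simp
  have AEz: "AE X in P. \<forall>n. \<exists>k\<ge>n. X k = 0"
    using AE_zeros_iff_p_pos AE_p_eq by eventually_elim (use q0 in auto)
  have iff: "AE X in P. \<forall>n. X \<in> A \<longleftrightarrow> incr (shift_by n X) \<in> C"
    using AEz AE_space
  proof (eventually_elim, intro allI)
    fix X n assume z: "\<forall>n. \<exists>k\<ge>n. X k = 0" and sp: "X \<in> space P"
    define \<eta> where "\<eta> = shift_by n X"
    have d: "X \<in> dsf_seqs" "\<eta> \<in> dsf_seqs" using sp shift_by_dsf by (simp_all add: \<eta>_def)
    obtain k where "n \<le> k" "X k = 0" using z by blast
    then have "\<eta> (k - n) = 0" by (simp add: \<eta>_def shift_by_apply)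
    note sh = coalesce_with_zero_start[OF d(2) this]
    have "X \<in> A \<longleftrightarrow> \<eta> \<in> A" unfolding \<eta>_def using Ainv[OF d(1)] by simp
    also have "\<dots> \<longleftrightarrow> shift_by (Suc (k - n)) \<eta> \<in> A" using Ainv[OF d(2)] by simp
    also have "\<dots> \<longleftrightarrow> walk 0 (incr \<eta>) \<in> A" unfolding sh using Ainv[OF walk_dsf] by simp
    finally show "X \<in> A \<longleftrightarrow> incr (shift_by n X) \<in> C" by (simp add: C_def \<eta>_def)
  qed
  have PA: "emeasure P {X \<in> space P. incr X \<in> C} = emeasure P A"
  proof (rule emeasure_eq_AE)
    show "AE X in P. X \<in> {X \<in> space P. incr X \<in> C} \<longleftrightarrow> X \<in> A"
      using iff AE_space
    proof eventually_elim
      case (elim X)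
      then show ?case using elim(1)[rule_format, of 0] by simp
    qed
    show "{X \<in> space P. incr X \<in> C} \<in> sets P"
      using C by measurable
  qed (rule A)
  have "density P (indicator A) = scale_measure (emeasure P A) P"
  proof (rule dsf_law_eqI)
    show "finite_measure (density P (indicator A))"
      using A by (intro finite_measureI) (simp add: emeasure_restricted del: space_P)
    fix x w
    have "emeasure (density P (indicator A)) (cyl x w) = emeasure P (A \<inter> cyl x w)"
      using A cyl_sets_P by (rule emeasure_restricted)
    also have "\<dots> = emeasure P {X \<in> cyl x w. incr (shift_by (length w) X) \<in> C}"
    proof (rule emeasure_eq_AE)
      show "AE X in P. X \<in> A \<inter> cyl x w \<longleftrightarrow> X \<in> {X \<in> cyl x w. incr (shift_by (length w) X) \<in> C}"
        using iff by eventually_elim blast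
      show "A \<inter> cyl x w \<in> sets P" using A cyl_sets_P by blast
      show "{X \<in> cyl x w. incr (shift_by (length w) X) \<in> C} \<in> sets P"
        by (rule Collect_cyl_sets) (use C in measurable)
    qed
    also have "\<dots> = emeasure (scale_measure (emeasure P A) P) (cyl x w)"
      unfolding future_independent[OF C] PA by (simp add: mult.commute)
    finally show "emeasure (density P (indicator A)) (cyl x w) = emeasure (scale_measure (emeasure P A) P) (cyl x w)" .
  qed (simp_all add: sets_P)
  then have "emeasure (density P (indicator A)) A = emeasure (scale_measure (emeasure P A) P) A" by simp
  then have "emeasure P A = emeasure P A * emeasure P A"
    using emeasure_restricted[OF A A] by simp
  then have "measure P A = measure P A * measure P A"
    by (simp add: emeasure_eq_measure ennreal_mult[symmetric])
  then have "measure P A = 0 \<or> measure P A = 1" by simp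
  then show "emeasure P A = 0 \<or> emeasure P A = 1" by (auto simp: emeasure_eq_measure)
qed

lemma \<nu>_eq_invariant_vector:
  assumes "0 < q 0"
  shows "positive_recurrent q" "\<nu> = invariant_vector q"
  using balanced_unique[OF balanced \<nu> q assms] by simp_all

text \<open>Almost every path is constant. The events of being eventually equal to \<open>c\<close> are strictly
  invariant, as ergodicity requires, and one of them has probability 1.\<close>

lemma ergodic_constant_if_q0_zero:
  assumes "q 0 = 0" and erg: "shift_ergodic P"
  shows "\<exists>c\<ge>1. AE X in P. X = (\<lambda>_. c)"
proof -
  have const: "AE X in P. 1 \<le> X 0 \<and> (\<forall>k. X k = X 0)"
    using AE_zeros_iff_p_pos AE_p_eq by eventually_elim (use assms in auto)
  define A where "A c = {X \<in> space P. \<exists>N. \<forall>k\<ge>N. X k = c}" for c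
  have A: "A c \<in> sets P" for c unfolding A_def by measurable
  have A_inv: "left_shift -` A c \<inter> space P = A c" for c
  proof (intro set_eqI iffI)
    fix X assume "X \<in> left_shift -` A c \<inter> space P"
    then obtain N where d: "X \<in> space P" and N: "\<forall>k\<ge>N. X (Suc k) = c" by (auto simp: A_def left_shift_def)
    have "\<forall>k\<ge>Suc N. X k = c" using N by (metis Suc_le_D Suc_le_mono)
    then show "X \<in> A c" using d by (auto simp: A_def)
  next
    fix X assume "X \<in> A c"
    then obtain N where d: "X \<in> space P" and N: "\<forall>k\<ge>N. X k = c" by (auto simp: A_def)
    then have "\<forall>k\<ge>N. left_shift X k = c" by (simp add: left_shift_def)
    moreover have "left_shift X \<in> space P" using d shift_by_dsf[of X 1] by (simp add: left_shift_eq)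
    ultimately show "X \<in> left_shift -` A c \<inter> space P" using d by (auto simp: A_def)
  qed
  have "\<forall>B\<in>sets P. left_shift -` B \<inter> space P = B \<longrightarrow> emeasure P B = 0 \<or> emeasure P B = 1"
    using erg unfolding shift_ergodic_def by (rule conjunct2)
  from bspec[OF this A] A_inv have z1: "emeasure P (A c) = 0 \<or> emeasure P (A c) = 1" for c by (rule mp)
  have "\<exists>c. emeasure P (A c) = 1"
  proof (rule ccontr)
    assume "\<nexists>c. emeasure P (A c) = 1"
    then have "A c \<in> null_sets P" for c using z1 A by (auto simp: null_sets_def)
    then have "AE X in P. X \<notin> A c" for c by (rule AE_not_in)
    then have "AE X in P. \<forall>c. X \<notin> A c" unfolding AE_all_countable by blast
    with const AE_space have "AE X in P. False"
    proof eventually_elim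
      case (elim X)
      then have "X \<in> A (X 0)" unfolding A_def by blast
      then show ?case using elim by blast
    qed
    then show False by simp
  qed
  then obtain c where "emeasure P (A c) = 1" by blast
  then have "AE X in P. X \<in> A c"
    using AE_in_set_eq_1[OF A] by (simp add: emeasure_eq_measure)
  with const have c: "AE X in P. X = (\<lambda>_. c) \<and> 1 \<le> c"
  proof eventually_elim
    case (elim X)
    then obtain N where "\<forall>k\<ge>N. X k = c" by (auto simp: A_def)
    then have "X N = c" by blast
    moreover have "X k = X 0" "X N = X 0" for k using elim(1) by blast+
    ultimately have "X k = c" for k by metis
    then show ?case using elim(1) by (auto simp: fun_eq_iff)
  qed
  then have "AE X in P. 1 \<le> c" by eventually_elim blast
  then have "1 \<le> c" by simp
  moreover have "AE X in P. X = (\<lambda>_. c)" using c by eventually_elim blast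
  ultimately show ?thesis by blast
qed

end

abbreviation constant_law :: "nat \<Rightarrow> (nat \<Rightarrow> nat) measure" where
  "constant_law c \<equiv> markov_law (point_vector 1) (point_vector c)"

lemma constant_law:
  assumes c: "1 \<le> c"
  shows "invariant_markov (constant_law c) (point_vector 1) (point_vector c)"
    and "AE X in constant_law c. X = (\<lambda>_. c)"
    and "shift_ergodic (constant_law c)"
proof -
  have "balanced (point_vector 1) (point_vector c)"
    unfolding balanced_def
  proof
    fix y
    have "(\<Sum>x\<le>Suc y. point_vector c x * kern (point_vector 1) x y) =
        (\<Sum>x\<le>Suc y. if x = c then kern (point_vector 1) c y else 0)"
      by (intro sum.cong refl) (simp add: point_vector_def)
    also have "\<dots> = point_vector c y"
      using c by (auto simp: kern_def point_vector_def simp del: sum.atMost_Suc)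
    finally show "point_vector c y = (\<Sum>x\<le>Suc y. point_vector c x * kern (point_vector 1) x y)" by simp
  qed
  then show inv: "invariant_markov (constant_law c) (point_vector 1) (point_vector c)"
    by (intro invariant_markov_law probability_vector_point_vector)
  interpret invariant_markov "constant_law c" "point_vector 1" "point_vector c" by (rule inv)
  have "AE X in constant_law c. X \<in> cyl c []"
  proof -
    have "measure (constant_law c) (cyl c []) = 1"
      unfolding measure_def cyl_prob by (simp add: point_vector_def)
    then show ?thesis using AE_in_set_eq_1[OF cyl_sets_P, of c "[]"] by blast
  qed
  then show AE: "AE X in constant_law c. X = (\<lambda>_. c)"
    using AE_zeros_iff_p_pos AE_p_eq
  proof eventually_elim
    case (elim X)
    then have "\<not> 0 < p X 0" by (simp add: point_vector_def)
    then have "X k = X 0" for k using elim(2) by blast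
    then show ?case using elim(1) by (auto simp: cyl_def)
  qed
  show "shift_ergodic (constant_law c)"
    by (rule ergodic_if_AE_constant(2)[OF path_law_axioms invariant AE])
qed

lemma eq_constant_law:
  assumes P: "path_law P" "shift_invariant P" and AE: "AE X in P. X = (\<lambda>_. c)" and c: "1 \<le> c"
  shows "P = constant_law c"
proof -
  interpret P: path_law P by fact
  interpret C: invariant_markov "constant_law c" "point_vector 1" "point_vector c" by (rule constant_law(1)[OF c])
  show ?thesis
  proof (rule dsf_law_eqI)
    show "emeasure P (cyl x w) = emeasure (constant_law c) (cyl x w)" for x w
      using ergodic_if_AE_constant(1)[OF P AE P.cyl_sets_P]
        ergodic_if_AE_constant(1)[OF C.path_law_axioms C.invariant constant_law(2)[OF c] C.cyl_sets_P] by simp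
  qed (rule P.sets_P C.sets_P P.finite_measure_axioms)+
qed

section \<open>The weak topology is generated by the cylinder probabilities\<close>

abbreviation cylinder :: "nat \<times> nat list \<Rightarrow> (nat \<Rightarrow> nat) set" where
  "cylinder a \<equiv> cyl (fst a) (snd a)"

definition prefix :: "nat \<Rightarrow> (nat \<Rightarrow> nat) \<Rightarrow> nat \<times> nat list" where
  "prefix n X = (X 0, initial_string n (incr X))"

definition cyl_probs :: "(nat \<Rightarrow> nat) measure \<Rightarrow> nat \<times> nat list \<Rightarrow> real" where
  "cyl_probs Q a = measure Q (cylinder a)"

lemma dsf_laws_iff: "Q \<in> dsf_laws \<longleftrightarrow> path_law Q"
  by (simp add: dsf_laws_def path_law_def path_law_axioms_def)

lemma open_contains_prefix:
  fixes U :: "(nat \<Rightarrow> nat) set"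
  assumes "open U" "X \<in> U"
  shows "\<exists>n. \<forall>\<eta>. (\<forall>i<n. \<eta> i = X i) \<longrightarrow> \<eta> \<in> U"
proof -
  have "openin (product_topology (\<lambda>i. euclidean) UNIV) U" using assms(1) by (simp add: open_fun_def)
  from product_topology_open_contains_basis[OF this assms(2)]
  obtain Y :: "nat \<Rightarrow> nat set" where Y: "X \<in> (\<Pi>\<^sub>E i\<in>UNIV. Y i)" "finite {i. Y i \<noteq> UNIV}" "(\<Pi>\<^sub>E i\<in>UNIV. Y i) \<subseteq> U"
    by auto
  obtain n where n: "\<forall>i\<in>{i. Y i \<noteq> UNIV}. i < n"
    using Y(2) finite_nat_set_iff_bounded by blast
  have "\<eta> \<in> U" if "\<forall>i<n. \<eta> i = X i" for \<eta>
  proof -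
    have "\<eta> i \<in> Y i" for i
    proof (cases "Y i = UNIV")
      case False
      then have "\<eta> i = X i" using n that by blast
      then show ?thesis using Y(1) by auto
    qed simp
    then have "\<eta> \<in> (\<Pi>\<^sub>E i\<in>UNIV. Y i)" by (auto simp: PiE_def)
    then show ?thesis using Y(3) by blast
  qed
  then show ?thesis by blast
qed

lemma cylinder_prefix: "X \<in> dsf_seqs \<Longrightarrow> X \<in> cylinder (prefix n X)"
  by (simp add: prefix_def cyl_def)

lemma in_cylinder_iff: "X \<in> dsf_seqs \<Longrightarrow> length (snd a) = n \<Longrightarrow> X \<in> cylinder a \<longleftrightarrow> a = prefix n X"
  by (cases a) (auto simp: prefix_def cyl_def)

lemma cyl_nonempty: "cyl x w \<noteq> {}"
proof -
  have "walk x (\<lambda>i. if i < length w then w ! i else 0) \<in> cyl x w"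
    by (simp add: cyl_def initial_string_eq_iff)
  then show ?thesis by blast
qed

locale bounded_continuous =
  fixes f :: "(nat \<Rightarrow> nat) \<Rightarrow> real" and B :: real
  assumes cont: "continuous_on dsf_seqs f" and bounds: "\<And>X. X \<in> dsf_seqs \<Longrightarrow> 0 \<le> f X \<and> f X \<le> B"
begin

text \<open>The infima of a continuous function over the prefix cylinders of a path increase to its value
  at the path; hence the function is a limit of combinations of cylinder indicators from below.\<close>

definition inf_on :: "nat \<times> nat list \<Rightarrow> real" where
  "inf_on a = Inf (f ` cylinder a)"

lemma inf_on_le: "X \<in> cylinder a \<Longrightarrow> inf_on a \<le> f X"
  unfolding inf_on_def
  by (rule cInf_lower) (auto simp: cyl_def bounds intro!: bdd_belowI[of _ 0])

lemma inf_on_ge: "(\<And>X. X \<in> cylinder a \<Longrightarrow> c \<le> f X) \<Longrightarrow> c \<le> inf_on a"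
  unfolding inf_on_def using cyl_nonempty by (intro cInf_greatest) auto

lemma inf_on_nonneg: "0 \<le> inf_on a"
  by (rule inf_on_ge) (auto simp: cyl_def bounds)

lemma inf_on_prefix_LIMSEQ:
  assumes X: "X \<in> dsf_seqs"
  shows "(\<lambda>n. inf_on (prefix n X)) \<longlonglongrightarrow> f X"
proof (rule LIMSEQ_I)
  fix e :: real assume e: "0 < e"
  have "open {f X - e / 2 <..}" "f X \<in> {f X - e / 2 <..}" using e by auto
  from cont[unfolded continuous_on_topological, rule_format, OF X this]
  obtain A where A: "open A" "X \<in> A" "\<And>\<eta>. \<eta> \<in> dsf_seqs \<Longrightarrow> \<eta> \<in> A \<Longrightarrow> f \<eta> \<in> {f X - e / 2 <..}"
    by blast
  obtain m where m: "\<And>\<eta>. (\<forall>i<m. \<eta> i = X i) \<Longrightarrow> \<eta> \<in> A" using open_contains_prefix[OF A(1,2)] by blast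
  show "\<exists>n0. \<forall>n\<ge>n0. norm (inf_on (prefix n X) - f X) < e"
  proof (intro exI allI impI)
    fix n assume n: "m \<le> n"
    have "f X - e / 2 \<le> inf_on (prefix n X)"
    proof (rule inf_on_ge)
      fix \<eta> assume "\<eta> \<in> cylinder (prefix n X)"
      then have \<eta>: "\<eta> \<in> dsf_seqs" "\<eta> 0 = X 0" "initial_string n (incr \<eta>) = initial_string n (incr X)"
        by (auto simp: prefix_def cyl_def)
      have "\<eta> i = X i" if "i < m" for i
      proof -
        have "initial_string i (incr \<eta>) = initial_string i (incr X)"
          using \<eta>(3) that n take_initial_string[of i n] by (metis less_imp_le_nat order.trans)
        then show ?thesis using dsf_endpoint[OF \<eta>(1), of i] dsf_endpoint[OF X, of i] \<eta>(2) by metis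
      qed
      then show "f X - e / 2 \<le> f \<eta>" using m A(3)[OF \<eta>(1)] by force
    qed
    moreover have "inf_on (prefix n X) \<le> f X" by (rule inf_on_le[OF cylinder_prefix[OF X]])
    ultimately show "norm (inf_on (prefix n X) - f X) < e" using e by simp
  qed
qed

lemma sum_inf_on:
  assumes "X \<in> dsf_seqs" "finite F" "\<And>a. a \<in> F \<Longrightarrow> length (snd a) = n"
  shows "(\<Sum>a\<in>F. inf_on a * indicator (cylinder a) X) = (if prefix n X \<in> F then inf_on (prefix n X) else 0)"
proof -
  have "(\<Sum>a\<in>F. inf_on a * indicator (cylinder a) X) = (\<Sum>a\<in>F. if a = prefix n X then inf_on a else 0)"
    using in_cylinder_iff[OF assms(1)] assms(3) by (intro sum.cong refl) (simp add: indicator_def)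
  also have "\<dots> = (if prefix n X \<in> F then inf_on (prefix n X) else 0)"
    using assms(2) by (simp add: sum.delta)
  finally show ?thesis .
qed

text \<open>The finite sums on the right are integrals of functions below \<open>f\<close>, and they come arbitrarily close
  to the integral of \<open>f\<close>: first by passing to long prefixes, then to finitely many cylinders.\<close>

lemma less_integral_iff:
  assumes "path_law Q"
  shows "t < (\<integral>X. f X \<partial>Q) \<longleftrightarrow>
    (\<exists>n F. finite F \<and> (\<forall>a\<in>F. length (snd a) = n) \<and> t < (\<Sum>a\<in>F. inf_on a * cyl_probs Q a))"
proof -
  interpret path_law Q by fact
  have fm: "f \<in> borel_measurable Q"
    using borel_measurable_continuous_on_restrict[OF cont] measurable_cong_sets[OF sets_P refl]
    unfolding dsf_space_def by blast
  have fi: "integrable Q f"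
    by (rule integrable_const_bound[where B = B]) (auto simp: bounds fm intro!: AE_I2)
  have si: "integrable Q (\<lambda>X. \<Sum>a\<in>F. inf_on a * indicator (cylinder a) X)" for F
    by (intro Bochner_Integration.integrable_sum integrable_mult_right integrable_real_indicator cyl_sets_P)
      (simp add: emeasure_eq_measure)
  have s_int: "(\<integral>X. (\<Sum>a\<in>F. inf_on a * indicator (cylinder a) X) \<partial>Q) = (\<Sum>a\<in>F. inf_on a * cyl_probs Q a)" for F
  proof -
    have i: "integrable Q (\<lambda>X. inf_on a * indicator (cylinder a) X)" for a
      by (intro integrable_mult_right integrable_real_indicator cyl_sets_P) (simp add: emeasure_eq_measure)
    have "cylinder a \<inter> space Q = cylinder a" for a by (auto simp: cyl_def)
    then have "(\<integral>X. inf_on a * indicator (cylinder a) X \<partial>Q) = inf_on a * cyl_probs Q a" for a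
      by (simp add: cyl_probs_def del: space_P)
    then have "(\<Sum>a\<in>F. \<integral>X. inf_on a * indicator (cylinder a) X \<partial>Q) = (\<Sum>a\<in>F. inf_on a * cyl_probs Q a)"
      by (rule sum.cong[OF refl])
    moreover have "(\<integral>X. (\<Sum>a\<in>F. inf_on a * indicator (cylinder a) X) \<partial>Q) =
        (\<Sum>a\<in>F. \<integral>X. inf_on a * indicator (cylinder a) X \<partial>Q)"
      by (rule Bochner_Integration.integral_sum) (rule i)
    ultimately show ?thesis by simp
  qed
  show ?thesis
  proof
    assume "\<exists>n F. finite F \<and> (\<forall>a\<in>F. length (snd a) = n) \<and> t < (\<Sum>a\<in>F. inf_on a * cyl_probs Q a)"
    then obtain n F where F: "finite F" "\<And>a. a \<in> F \<Longrightarrow> length (snd a) = n"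
      and t: "t < (\<Sum>a\<in>F. inf_on a * cyl_probs Q a)" by blast
    note t
    also have "(\<Sum>a\<in>F. inf_on a * cyl_probs Q a) = (\<integral>X. (\<Sum>a\<in>F. inf_on a * indicator (cylinder a) X) \<partial>Q)"
      by (rule s_int[symmetric])
    also have "\<dots> \<le> (\<integral>X. f X \<partial>Q)"
    proof (rule integral_mono[OF si fi])
      fix X assume "X \<in> space Q"
      then have d: "X \<in> dsf_seqs" by simp
      have "(\<Sum>a\<in>F. inf_on a * indicator (cylinder a) X) = (if prefix n X \<in> F then inf_on (prefix n X) else 0)"
        by (rule sum_inf_on[OF d F(1)]) (rule F(2))
      then show "(\<Sum>a\<in>F. inf_on a * indicator (cylinder a) X) \<le> f X"
        using bounds[OF d] inf_on_le[OF cylinder_prefix[OF d, of n]] by simp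
    qed
    finally show "t < (\<integral>X. f X \<partial>Q)" .
  next
    assume t: "t < (\<integral>X. f X \<partial>Q)"
    \<comment> \<open>the first \<open>K\<close> cylinders of length \<open>n\<close> in some enumeration\<close>
    define F where "F n K = {a :: nat \<times> nat list. to_nat a < K \<and> length (snd a) = n}" for n K
    have F: "finite (F n K)" for n K
    proof -
      have "finite (to_nat -` {..<K} :: (nat \<times> nat list) set)" by (rule finite_vimageI) simp_all
      then show ?thesis by (rule finite_subset[rotated]) (auto simp: F_def)
    qed
    define s where "s n K X = (\<Sum>a\<in>F n K. inf_on a * indicator (cylinder a) X)" for n K X
    have s: "s n K X = (if to_nat (prefix n X) < K then inf_on (prefix n X) else 0)" if "X \<in> dsf_seqs" for n K X
      unfolding s_def by (subst sum_inf_on[OF that F, of n]) (auto simp: F_def prefix_def)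
    define g where "g n X = inf_on (prefix n X)" for n X
    have gb: "0 \<le> g n X \<and> g n X \<le> B" if "X \<in> dsf_seqs" for n X
      using inf_on_nonneg inf_on_le[OF cylinder_prefix[OF that], of n] bounds[OF that] by (auto simp: g_def)
    have sg: "(\<lambda>K. s n K X) \<longlonglongrightarrow> g n X" if "X \<in> dsf_seqs" for n X
    proof (rule tendsto_eventually, unfold eventually_sequentially, intro exI allI impI)
      fix K assume "Suc (to_nat (prefix n X)) \<le> K"
      then show "s n K X = g n X" by (simp add: s[OF that] g_def)
    qed
    have sm: "s n K \<in> borel_measurable Q" for n K
      unfolding s_def[abs_def] using si by (rule borel_measurable_integrable)
    have gm: "g n \<in> borel_measurable Q" for n
      by (rule borel_measurable_LIMSEQ_real[of Q "s n"]) (simp_all add: sg sm)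
    have Bi: "integrable Q (\<lambda>_. B)" by simp
    have "(\<lambda>n. \<integral>X. g n X \<partial>Q) \<longlonglongrightarrow> (\<integral>X. f X \<partial>Q)"
    proof (rule integral_dominated_convergence[OF fm gm Bi])
      show "AE X in Q. (\<lambda>n. g n X) \<longlonglongrightarrow> f X"
        by (rule AE_I2) (simp add: g_def inf_on_prefix_LIMSEQ)
      show "AE X in Q. norm (g n X) \<le> B" for n
        by (rule AE_I2) (use gb in simp)
    qed
    then have "eventually (\<lambda>n. t < (\<integral>X. g n X \<partial>Q)) sequentially" by (rule order_tendstoD(1)[OF _ t])
    then obtain n where n: "t < (\<integral>X. g n X \<partial>Q)" by (auto simp: eventually_sequentially)
    have "(\<lambda>K. \<integral>X. s n K X \<partial>Q) \<longlonglongrightarrow> (\<integral>X. g n X \<partial>Q)"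
    proof (rule integral_dominated_convergence[OF gm sm Bi])
      show "AE X in Q. (\<lambda>K. s n K X) \<longlonglongrightarrow> g n X"
        by (rule AE_I2) (simp add: sg)
      show "AE X in Q. norm (s n K X) \<le> B" for K
      proof (rule AE_I2)
        fix X assume "X \<in> space Q"
        then have "X \<in> dsf_seqs" by simp
        from gb[OF this, of n] show "norm (s n K X) \<le> B" unfolding s[OF \<open>X \<in> dsf_seqs\<close>] by (auto simp: g_def)
      qed
    qed
    then have "eventually (\<lambda>K. t < (\<integral>X. s n K X \<partial>Q)) sequentially" by (rule order_tendstoD(1)[OF _ n])
    then obtain K where "t < (\<integral>X. s n K X \<partial>Q)" by (auto simp: eventually_sequentially)
    then have "t < (\<Sum>a\<in>F n K. inf_on a * cyl_probs Q a)" unfolding s_def s_int .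
    then show "\<exists>n F. finite F \<and> (\<forall>a\<in>F. length (snd a) = n) \<and> t < (\<Sum>a\<in>F. inf_on a * cyl_probs Q a)"
      using F by (intro exI[of _ n] exI[of _ "F n K"]) (auto simp: F_def)
  qed
qed

lemma less_integral_open:
  "\<exists>W. open W \<and> (\<forall>Q\<in>dsf_laws. t < (\<integral>X. f X \<partial>Q) \<longleftrightarrow> cyl_probs Q \<in> W)"
proof -
  define W where "W = (\<Union>n. \<Union>F\<in>{F. finite F \<and> (\<forall>a\<in>F. length (snd a) = n)}.
    {v :: nat \<times> nat list \<Rightarrow> real. t < (\<Sum>a\<in>F. inf_on a * v a)})"
  have "open {v :: nat \<times> nat list \<Rightarrow> real. t < (\<Sum>a\<in>F. inf_on a * v a)}" for F
    by (intro open_Collect_less continuous_intros continuous_on_product_coordinates)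
  then have "open W" unfolding W_def by (intro open_UN ballI) auto
  moreover have "t < (\<integral>X. f X \<partial>Q) \<longleftrightarrow> cyl_probs Q \<in> W" if "Q \<in> dsf_laws" for Q
    using less_integral_iff[of Q t] that unfolding dsf_laws_iff W_def by auto
  ultimately show ?thesis by blast
qed

end

text \<open>The conditions that the integral exceeds \<open>s\<close> and that it is less than \<open>t\<close> come from
  \<open>less_integral_open\<close> for \<open>B + f\<close> and \<open>B - f\<close>.\<close>

lemma integral_open:
  fixes f :: "(nat \<Rightarrow> nat) \<Rightarrow> real"
  assumes cont: "continuous_on dsf_seqs f" and bdd: "bounded (f ` dsf_seqs)" and U: "open U"
  shows "\<exists>W. open W \<and> {Q \<in> dsf_laws. (\<integral>X. f X \<partial>Q) \<in> U} = {Q \<in> dsf_laws. cyl_probs Q \<in> W}"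
proof -
  obtain B where B: "\<And>X. X \<in> dsf_seqs \<Longrightarrow> \<bar>f X\<bar> \<le> B"
    using bdd unfolding bounded_iff by auto
  interpret up: bounded_continuous "\<lambda>X. B + f X" "2 * B"
  proof
    show "continuous_on dsf_seqs (\<lambda>X. B + f X)" by (intro continuous_intros cont)
    show "0 \<le> B + f X \<and> B + f X \<le> 2 * B" if "X \<in> dsf_seqs" for X using B[OF that] by linarith
  qed
  interpret down: bounded_continuous "\<lambda>X. B - f X" "2 * B"
  proof
    show "continuous_on dsf_seqs (\<lambda>X. B - f X)" by (intro continuous_intros cont)
    show "0 \<le> B - f X \<and> B - f X \<le> 2 * B" if "X \<in> dsf_seqs" for X using B[OF that] by linarith
  qed
  have int: "integrable Q f" "prob_space Q" if "Q \<in> dsf_laws" for Q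
  proof -
    interpret path_law Q using that by (simp add: dsf_laws_iff)
    have "f \<in> borel_measurable Q"
      using borel_measurable_continuous_on_restrict[OF cont] measurable_cong_sets[OF sets_P refl]
      unfolding dsf_space_def by blast
    then show "integrable Q f" by (intro integrable_const_bound[where B = B]) (auto simp: B intro!: AE_I2)
    show "prob_space Q" by (rule prob_space_axioms)
  qed
  have e: "(\<integral>X. B + f X \<partial>Q) = B + (\<integral>X. f X \<partial>Q)" "(\<integral>X. B - f X \<partial>Q) = B - (\<integral>X. f X \<partial>Q)"
    if "Q \<in> dsf_laws" for Q
  proof -
    interpret prob_space Q by (rule int(2)[OF that])
    show "(\<integral>X. B + f X \<partial>Q) = B + (\<integral>X. f X \<partial>Q)" "(\<integral>X. B - f X \<partial>Q) = B - (\<integral>X. f X \<partial>Q)"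
      using int(1)[OF that] by (simp_all add: prob_space)
  qed
  obtain L where L: "\<And>t. open (L t)" "\<And>t Q. Q \<in> dsf_laws \<Longrightarrow> t < (\<integral>X. f X \<partial>Q) \<longleftrightarrow> cyl_probs Q \<in> L t"
  proof -
    have "\<forall>t. \<exists>W. open W \<and> (\<forall>Q\<in>dsf_laws. t < (\<integral>X. f X \<partial>Q) \<longleftrightarrow> cyl_probs Q \<in> W)"
    proof
      fix t show "\<exists>W. open W \<and> (\<forall>Q\<in>dsf_laws. t < (\<integral>X. f X \<partial>Q) \<longleftrightarrow> cyl_probs Q \<in> W)"
        using up.less_integral_open[of "B + t"] by (simp add: e cong: ball_cong_simp)
    qed
    then show ?thesis using that by metis
  qed
  obtain R where R: "\<And>t. open (R t)" "\<And>t Q. Q \<in> dsf_laws \<Longrightarrow> (\<integral>X. f X \<partial>Q) < t \<longleftrightarrow> cyl_probs Q \<in> R t"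
  proof -
    have "\<forall>t. \<exists>W. open W \<and> (\<forall>Q\<in>dsf_laws. (\<integral>X. f X \<partial>Q) < t \<longleftrightarrow> cyl_probs Q \<in> W)"
    proof
      fix t show "\<exists>W. open W \<and> (\<forall>Q\<in>dsf_laws. (\<integral>X. f X \<partial>Q) < t \<longleftrightarrow> cyl_probs Q \<in> W)"
        using down.less_integral_open[of "B - t"] by (simp add: e cong: ball_cong_simp)
    qed
    then show ?thesis using that by metis
  qed
  define W where "W = (\<Union>(s, t)\<in>{(s, t). {s<..<t} \<subseteq> U}. L s \<inter> R t)"
  have "open W" unfolding W_def using L(1) R(1) by (intro open_UN ballI) auto
  moreover have "(\<integral>X. f X \<partial>Q) \<in> U \<longleftrightarrow> cyl_probs Q \<in> W" if Q: "Q \<in> dsf_laws" for Q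
  proof
    assume "(\<integral>X. f X \<partial>Q) \<in> U"
    then obtain d where d: "0 < d" "ball (\<integral>X. f X \<partial>Q) d \<subseteq> U" using U open_contains_ball by blast
    define y where "y = (\<integral>X. f X \<partial>Q)"
    have "{y - d<..<y + d} \<subseteq> ball y d" by (auto simp: dist_real_def abs_less_iff)
    then have "{y - d<..<y + d} \<subseteq> U" using d(2) unfolding y_def by (rule order.trans)
    moreover have "cyl_probs Q \<in> L (y - d) \<inter> R (y + d)"
      using L(2)[OF Q, of "y - d"] R(2)[OF Q, of "y + d"] d(1) by (simp add: y_def)
    ultimately show "cyl_probs Q \<in> W" unfolding W_def by blast
  next
    assume "cyl_probs Q \<in> W"
    then obtain s t where st: "{s<..<t} \<subseteq> U" "cyl_probs Q \<in> L s" "cyl_probs Q \<in> R t" unfolding W_def by blast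
    then have "(\<integral>X. f X \<partial>Q) \<in> {s<..<t}" using L(2)[OF Q] R(2)[OF Q] by simp
    then show "(\<integral>X. f X \<partial>Q) \<in> U" using st(1) by blast
  qed
  ultimately show ?thesis by blast
qed

text \<open>The sets of this form are a topology that contains the subbase. The point is that the cylinder
  probabilities form a countable family, so open sets of their values are Borel sets of the product space.\<close>

lemma weak_open_preimage:
  assumes "openin weak_topology V"
  shows "\<exists>W. open W \<and> V = {Q \<in> dsf_laws. cyl_probs Q \<in> W}"
  using assms unfolding weak_topology_def openin_topology_generated_by_iff
proof (induction rule: generate_topology_on.induct)
  case Empty
  show ?case by (rule exI[of _ "{}"]) simp
next
  case (Int a b)
  then obtain Wa Wb where "open Wa" "a = {Q \<in> dsf_laws. cyl_probs Q \<in> Wa}"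
    "open Wb" "b = {Q \<in> dsf_laws. cyl_probs Q \<in> Wb}" by blast
  then show ?case by (intro exI[of _ "Wa \<inter> Wb"]) auto
next
  case (UN K)
  then have "\<forall>k\<in>K. \<exists>W. open W \<and> k = {Q \<in> dsf_laws. cyl_probs Q \<in> W}" by blast
  then obtain W where W: "\<And>k. k \<in> K \<Longrightarrow> open (W k)" "\<And>k. k \<in> K \<Longrightarrow> k = {Q \<in> dsf_laws. cyl_probs Q \<in> W k}"
    by metis
  have "\<Union>K = {Q \<in> dsf_laws. cyl_probs Q \<in> (\<Union>k\<in>K. W k)}" using W(2) by blast
  then show ?case using W(1) by (intro exI[of _ "\<Union>k\<in>K. W k"]) auto
next
  case (Basis s)
  then obtain f :: "(nat \<Rightarrow> nat) \<Rightarrow> real" and U where "s = {Q \<in> dsf_laws. (\<integral>x. f x \<partial>Q) \<in> U}"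
    "continuous_on dsf_seqs f" "bounded (f ` dsf_seqs)" "open U" by blast
  then show ?case using integral_open[of f U] by simp
qed

lemma continuous_on_indicator_cyl: "continuous_on dsf_seqs (indicator (cyl x w) :: _ \<Rightarrow> real)"
proof -
  define s where "s = states x w"
  define C where "C = {X :: nat \<Rightarrow> nat. \<forall>i\<in>{..length w}. X i = s ! i}"
  have op: "open {X :: nat \<Rightarrow> nat. X i \<in> A}" for i A
    using open_vimage[OF discrete_topology_class.open_discrete[of A] continuous_on_product_coordinates[of i]] by (simp add: vimage_def)
  have C: "C = (\<Inter>i\<in>{..length w}. {X. X i \<in> {s ! i}})" by (auto simp: C_def)
  have nC: "- C = (\<Union>i\<in>{..length w}. {X. X i \<in> - {s ! i}})" by (auto simp: C_def)
  have oC: "open C" unfolding C by (intro open_INT ballI op) simp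
  have onC: "open (- C)" unfolding nC by (intro open_UN ballI op)
  have "open (indicator C -` B \<inter> UNIV)" for B :: "real set"
  proof -
    have "indicator C -` B \<inter> UNIV = (if 1 \<in> B then C else {}) \<union> (if 0 \<in> B then - C else {})"
    proof (rule set_eqI)
      show "X \<in> indicator C -` B \<inter> UNIV \<longleftrightarrow> X \<in> (if 1 \<in> B then C else {}) \<union> (if 0 \<in> B then - C else {})" for X
        by (cases "X \<in> C") auto
    qed
    then show ?thesis using oC onC by auto
  qed
  then have "continuous_on UNIV (indicator C :: _ \<Rightarrow> real)"
    by (subst continuous_on_open_vimage) auto
  then have "continuous_on dsf_seqs (indicator C :: _ \<Rightarrow> real)" by (rule continuous_on_subset) simp
  moreover have "indicator C X = (indicator (cyl x w) X :: real)" if "X \<in> dsf_seqs" for X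
    using that unfolding cyl_states
    by (auto simp: C_def s_def indicator_def initial_string_eq_iff less_Suc_eq_le)
  ultimately show ?thesis using continuous_on_cong[OF refl] by metis
qed

lemma MM_subset: "MM_Delta11 \<subseteq> dsf_laws"
  by (auto simp: MM_Delta11_def)

lemma weak_open_subset: "openin weak_topology V \<Longrightarrow> V \<subseteq> dsf_laws"
  using weak_open_preimage by blast

lemma space_sigma_weak: "space (sigma dsf_laws {V. openin weak_topology V}) = dsf_laws"
  using weak_open_subset by (intro space_measure_of) auto

lemma space_MM_space [simp]: "space MM_space = MM_Delta11"
  using MM_subset by (auto simp: MM_space_def space_restrict_space space_sigma_weak)

lemma measurable_into_MM_space:
  assumes F: "\<And>x. x \<in> space M \<Longrightarrow> F x \<in> MM_Delta11"
    and meas: "\<And>x w. (\<lambda>y. measure (F y) (cyl x w)) \<in> borel_measurable M"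
  shows "F \<in> measurable M MM_space"
  unfolding MM_space_def
proof (rule measurable_restrict_space2)
  show "F \<in> space M \<rightarrow> MM_Delta11" using F by blast
  show "F \<in> measurable M (sigma dsf_laws {V. openin weak_topology V})"
  proof (rule measurable_measure_of)
    show "{V. openin weak_topology V} \<subseteq> Pow dsf_laws" using weak_open_subset by blast
    show "F \<in> space M \<rightarrow> dsf_laws" using F MM_subset by blast
    fix V assume "V \<in> {V. openin weak_topology V}"
    then obtain W where W: "open W" "V = {Q \<in> dsf_laws. cyl_probs Q \<in> W}" using weak_open_preimage by blast
    have "(\<lambda>y. cyl_probs (F y)) \<in> borel_measurable M"
      by (rule measurable_coordinatewise_then_product) (simp add: cyl_probs_def meas)
    moreover have "W \<in> sets borel" using W(1) by simp
    ultimately have "(\<lambda>y. cyl_probs (F y)) -` W \<inter> space M \<in> sets M" by (rule measurable_sets)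
    moreover have "F -` V \<inter> space M = (\<lambda>y. cyl_probs (F y)) -` W \<inter> space M"
      using F MM_subset unfolding W(2) by auto
    ultimately show "F -` V \<inter> space M \<in> sets M" by simp
  qed
qed

lemma cyl_prob_measurable: "(\<lambda>Q. measure Q (cyl x w)) \<in> borel_measurable MM_space"
  unfolding MM_space_def
proof (rule measurable_restrict_space1, rule borel_measurableI)
  fix U :: "real set" assume U: "open U"
  have "(\<lambda>Q. measure Q (cyl x w)) -` U \<inter> dsf_laws = {Q \<in> dsf_laws. (\<integral>X. indicator (cyl x w) X \<partial>Q) \<in> U}"
  proof -
    have "(\<integral>X. indicator (cyl x w) X \<partial>Q) = measure Q (cyl x w)" if "Q \<in> dsf_laws" for Q
    proof -
      interpret path_law Q using that by (simp add: dsf_laws_iff)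
      have "cyl x w \<inter> space Q = cyl x w" by (auto simp: cyl_def)
      then show ?thesis by (simp del: space_P)
    qed
    then show ?thesis by auto
  qed
  moreover have "openin weak_topology {Q \<in> dsf_laws. (\<integral>X. indicator (cyl x w) X \<partial>Q) \<in> U}"
    unfolding weak_topology_def
  proof (rule topology_generated_by_Basis)
    have "bounded ((indicator (cyl x w) :: _ \<Rightarrow> real) ` dsf_seqs)"
      by (rule boundedI[where B = 1]) (auto simp: indicator_def)
    then show "{Q \<in> dsf_laws. (\<integral>X. indicator (cyl x w) X \<partial>Q) \<in> U} \<in>
      {{Q \<in> dsf_laws. (\<integral>x. f x \<partial>Q) \<in> U} | (f :: (nat \<Rightarrow> nat) \<Rightarrow> real) U.
        continuous_on dsf_seqs f \<and> bounded (f ` dsf_seqs) \<and> open U}"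
      using continuous_on_indicator_cyl U by blast
  qed
  ultimately show "(\<lambda>Q. measure Q (cyl x w)) -` U \<inter> space (sigma dsf_laws {V. openin weak_topology V})
      \<in> sets (sigma dsf_laws {V. openin weak_topology V})"
    unfolding space_sigma_weak using weak_open_subset
    by (subst sets_measure_of) (auto intro!: sigma_sets.Basic)
qed

lemma id_MM_measurable: "(\<lambda>Q. Q) \<in> measurable MM_space (subprob_algebra dsf_space)"
proof (rule measurable_subprob_algebra_generated)
  let ?G = "range (\<lambda>a. {X \<in> dsf_seqs. initial_string (length a) X = a}) \<union> {{}}"
  have "sigma_sets dsf_seqs ?G = sigma_sets dsf_seqs (range (\<lambda>a. {X \<in> dsf_seqs. initial_string (length a) X = a}))"
    by (intro sigma_sets_eqI) (auto intro: sigma_sets.Empty)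
  then show "sets dsf_space = sigma_sets dsf_seqs ?G"
    by (simp add: dsf_space_def sets_restrict_borel_eq_prefix)
  show "Int_stable ?G" by (rule prefix_sets_Int_stable)
  show "?G \<subseteq> Pow dsf_seqs" by blast
  have law: "path_law Q" if "Q \<in> space MM_space" for Q
    using that MM_subset by (auto simp: dsf_laws_iff[symmetric])
  show "subprob_space Q" "sets Q = sets dsf_space" if "Q \<in> space MM_space" for Q
    using law[OF that] by (simp_all add: path_law_def path_law_axioms_def prob_space_imp_subprob_space)
  have full: "emeasure Q dsf_seqs = 1" if "Q \<in> space MM_space" for Q
  proof -
    interpret path_law Q by (rule law[OF that])
    show ?thesis using emeasure_space_1 by simp
  qed
  have one: "(\<lambda>Q. emeasure Q dsf_seqs) \<in> borel_measurable MM_space"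
    by (subst measurable_cong[OF full]) simp_all
  then show "(\<lambda>Q. emeasure Q dsf_seqs) \<in> borel_measurable MM_space" .
  have cylm: "(\<lambda>Q. emeasure Q (cyl x w)) \<in> borel_measurable MM_space" for x w
  proof -
    have "emeasure Q (cyl x w) = ennreal (measure Q (cyl x w))" if "Q \<in> space MM_space" for Q
    proof -
      interpret path_law Q by (rule law[OF that])
      show ?thesis by (rule emeasure_eq_measure)
    qed
    then show ?thesis using cyl_prob_measurable[of x w] by (subst measurable_cong) auto
  qed
  fix A assume "A \<in> ?G"
  then consider a where "A = {X \<in> dsf_seqs. initial_string (length a) X = a}" | "A = {}" by blast
  then show "(\<lambda>Q. emeasure Q A) \<in> borel_measurable MM_space"
  proof cases
    case (1 a)
    show ?thesis
    proof (rule dsf_prefix_cases[of a])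
      assume "a = []"
      then have "A = dsf_seqs" using 1 by simp
      then show ?thesis using one by simp
    next
      fix x w
      assume "{X \<in> dsf_seqs. initial_string (length a) X = a} = cyl x w"
      then show ?thesis using cylm[of x w] 1 by simp
    next
      assume "{X \<in> dsf_seqs. initial_string (length a) X = a} = {}"
      then have "A = {}" using 1 by (simp only:)
      then show ?thesis by simp
    qed
  qed simp
qed

section \<open>The ergodic components\<close>

lemma kern_advance: "kern q s (advance s r) = q r"
  by (auto simp: kern_def advance_def)

lemma kern_eq_0: "s > Suc t \<Longrightarrow> kern q s t = 0"
  by (simp add: kern_def)

lemma prod_kern_states:
  "(\<Prod>i<length w. kern q (states x w ! i) (states x w ! Suc i)) = (\<Prod>r\<leftarrow>w. q r)"
proof -
  have "(\<Prod>i<length w. kern q (states x w ! i) (states x w ! Suc i)) = (\<Prod>i<length w. q (w ! i))"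
    by (intro prod.cong refl) (simp add: nth_states take_Suc_conv_app_nth kern_advance)
  also have "\<dots> = (\<Prod>r\<leftarrow>w. q r)" by (simp add: prod.list_conv_set_nth atLeast0LessThan)
  finally show ?thesis .
qed

lemma kern_in_homogeneous_Delta11:
  assumes q: "probability_vector q"
  shows "kern q \<in> homogeneous_Delta11"
proof -
  have "probability_vector (kern q i)" for i
  proof -
    have "(\<lambda>j. kern q i (j + (i - 1))) = q" by (auto simp: kern_def fun_eq_iff)
    moreover have "kern q i j = 0" if "j < i - 1" for j using that by (simp add: kern_def)
    ultimately have "kern q i sums 1 \<longleftrightarrow> q sums 1"
      using sums_zero_iff_shift[of "i - 1" "kern q i" 1] by metis
    then show ?thesis using q by (simp add: probability_vector_def kern_def)
  qed
  moreover have "kern q 0 j = q j" for j by (simp add: kern_def)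
  moreover have "kern q i j = (if j \<ge> i - 1 then q (j + 1 - i) else 0)" if "i \<ge> 1" for i j
  proof -
    have "j - (i - 1) = j + 1 - i" "i \<le> Suc j \<longleftrightarrow> j \<ge> i - 1" using that by auto
    then show ?thesis unfolding kern_def by simp
  qed
  ultimately show ?thesis unfolding homogeneous_Delta11_def using q by blast
qed

lemma homogeneous_Delta11E:
  assumes "M \<in> homogeneous_Delta11"
  obtains q where "probability_vector q" "M = kern q"
proof -
  obtain q where q: "probability_vector q" "\<And>j. M 0 j = q j"
    "\<And>i j. i \<ge> 1 \<Longrightarrow> M i j = (if j \<ge> i - 1 then q (j + 1 - i) else 0)"
    using assms unfolding homogeneous_Delta11_def by blast
  have "M i j = kern q i j" for i j
  proof (cases "i = 0")
    case False
    then have "j - (i - 1) = j + 1 - i" "i \<le> Suc j \<longleftrightarrow> j \<ge> i - 1" by auto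
    then show ?thesis using q(3)[of i j] False by (simp add: kern_def)
  qed (simp add: q(2) kern_def)
  then have "M = kern q" by blast
  then show ?thesis using that q(1) by blast
qed

lemma balanced_iff_sums: "balanced q \<nu> \<longleftrightarrow> (\<forall>j. (\<lambda>i. \<nu> i * kern q i j) sums \<nu> j)"
proof -
  have s: "(\<lambda>i. \<nu> i * kern q i j) sums (\<Sum>i\<le>Suc j. \<nu> i * kern q i j)" for j
    by (rule sums_finite) (auto simp: kern_def)
  show ?thesis
  proof
    assume b: "balanced q \<nu>"
    show "\<forall>j. (\<lambda>i. \<nu> i * kern q i j) sums \<nu> j"
    proof
      fix j
      have "\<nu> j = (\<Sum>i\<le>Suc j. \<nu> i * kern q i j)" using b unfolding balanced_def by blast
      then show "(\<lambda>i. \<nu> i * kern q i j) sums \<nu> j" using s[of j] by metis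
    qed
  next
    assume "\<forall>j. (\<lambda>i. \<nu> i * kern q i j) sums \<nu> j"
    then show "balanced q \<nu>" unfolding balanced_def using s sums_unique2 by blast
  qed
qed

lemma MM_Delta11_iff: "Q \<in> MM_Delta11 \<longleftrightarrow> shift_ergodic Q \<and> (\<exists>q \<nu>. invariant_markov Q q \<nu>)"
proof
  assume "Q \<in> MM_Delta11"
  then obtain M \<nu> where Q: "Q \<in> dsf_laws" "shift_ergodic Q" and M: "M \<in> homogeneous_Delta11"
    and \<nu>: "probability_vector \<nu>" "\<forall>j. (\<lambda>i. \<nu> i * M i j) sums \<nu> j"
    and cyl: "\<forall>n\<ge>1. \<forall>a. length a = n \<longrightarrow>
           measure Q {x \<in> space Q. initial_string n x = a} = \<nu> (a ! 0) * (\<Prod>i<n - 1. M (a ! i) (a ! Suc i))"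
    unfolding MM_Delta11_def by blast
  obtain q where q: "probability_vector q" "M = kern q" using homogeneous_Delta11E[OF M] .
  interpret path_law Q using Q(1) by (simp add: dsf_laws_iff)
  have "emeasure Q (cyl x w) = ennreal (\<nu> x * (\<Prod>r\<leftarrow>w. q r))" for x w
  proof -
    have "measure Q {X \<in> space Q. initial_string (Suc (length w)) X = states x w} =
        \<nu> (states x w ! 0) * (\<Prod>i<Suc (length w) - 1. M (states x w ! i) (states x w ! Suc i))"
      by (rule cyl[rule_format]) simp_all
    then have "measure Q (cyl x w) = \<nu> x * (\<Prod>r\<leftarrow>w. q r)"
      unfolding cyl_states q(2) using prod_kern_states[of q x w] by simp
    then show ?thesis by (simp add: emeasure_eq_measure)
  qed
  moreover have "balanced q \<nu>" using \<nu>(2) q(2) by (simp add: balanced_iff_sums)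
  moreover have "shift_invariant Q" using Q(2) by (simp add: shift_ergodic_def)
  ultimately have "invariant_markov Q q \<nu>" using \<nu>(1) q(1) by unfold_locales
  then show "shift_ergodic Q \<and> (\<exists>q \<nu>. invariant_markov Q q \<nu>)" using Q(2) by blast
next
  assume "shift_ergodic Q \<and> (\<exists>q \<nu>. invariant_markov Q q \<nu>)"
  then obtain q \<nu> where erg: "shift_ergodic Q" and inv: "invariant_markov Q q \<nu>" by blast
  interpret invariant_markov Q q \<nu> by (rule inv)
  have "measure Q {X \<in> space Q. initial_string n X = a} = \<nu> (a ! 0) * (\<Prod>i<n - 1. kern q (a ! i) (a ! Suc i))"
    if n: "n \<ge> 1" and la: "length a = n" for n a
  proof -
    obtain m where m: "n = Suc m" using n by (cases n) auto
    show ?thesis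
    proof (cases "a \<in> dsf_strings (Suc m)")
      case True
      then obtain x w where xw: "a = states x w" "length w = m" by (rule dsf_string_states)
      have "{X \<in> space Q. initial_string n X = a} = cyl x w" unfolding cyl_states xw m by (simp add: xw)
      moreover have "measure Q (cyl x w) = \<nu> x * (\<Prod>r\<leftarrow>w. q r)"
        using cyl_prob[of x w] by (simp add: measure_def \<nu>_nonneg prod_q_nonneg)
      ultimately show ?thesis using prod_kern_states[of q x w] xw m by simp
    next
      case False
      then obtain i where i: "i < m" "\<not> int (a ! i) - int (a ! Suc i) \<le> 1"
        using la m by (auto simp: dsf_strings_def)
      then have "kern q (a ! i) (a ! Suc i) = 0" by (intro kern_eq_0) simp
      then have "(\<Prod>i<m. kern q (a ! i) (a ! Suc i)) = 0" using i(1) by (intro prod_zero) auto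
      moreover have "{X \<in> space Q. initial_string n X = a} = {}"
      proof -
        have False if "X \<in> dsf_seqs" "initial_string n X = a" for X
        proof -
          have "int (X i) - int (X (Suc i)) \<le> 1" using that(1) by (simp add: dsf_seqs_def)
          moreover have "X i = a ! i" "X (Suc i) = a ! Suc i" using that(2) i(1) m by auto
          ultimately show False using i(2) by simp
        qed
        then show ?thesis by auto
      qed
      ultimately show ?thesis by (simp only: m diff_Suc_1 measure_empty mult_zero_right)
    qed
  qed
  moreover have "Q \<in> dsf_laws" using path_law_axioms by (simp add: dsf_laws_iff)
  moreover have "\<forall>j. (\<lambda>i. \<nu> i * kern q i j) sums \<nu> j" using balanced balanced_iff_sums by blast
  ultimately show "Q \<in> MM_Delta11"
    unfolding MM_Delta11_def using erg kern_in_homogeneous_Delta11[OF q] \<nu> by blast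
qed

text \<open>The Markov law that a path determines by its limiting frequencies. The second alternative is
  meant for constant paths away from zero; on all other paths it is a default value that lies in \<open>MM_Delta11\<close> as well.\<close>

definition component :: "(nat \<Rightarrow> nat) \<Rightarrow> (nat \<Rightarrow> nat) measure" where
  "component X = (let q = freq_limit (incr X) in
     if positive_recurrent q then markov_law q (invariant_vector q) else constant_law (max 1 (X 0)))"

lemma positive_recurrent_markov_law:
  assumes "positive_recurrent q"
  shows "invariant_markov (markov_law q (invariant_vector q)) q (invariant_vector q)"
    and "shift_ergodic (markov_law q (invariant_vector q))"
proof -
  have q: "probability_vector q" "0 < q 0" using assms by (auto simp: positive_recurrent_def)
  show inv: "invariant_markov (markov_law q (invariant_vector q)) q (invariant_vector q)"
    by (intro invariant_markov_law q invariant_vector assms)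
  show "shift_ergodic (markov_law q (invariant_vector q))"
    by (rule invariant_markov.ergodic_if_q0_pos[OF inv q(2)])
qed

lemma component_in_MM: "component X \<in> MM_Delta11"
proof (cases "positive_recurrent (freq_limit (incr X))")
  case True
  then show ?thesis unfolding component_def Let_def MM_Delta11_iff
    using positive_recurrent_markov_law by auto
next
  case False
  have "1 \<le> max 1 (X 0)" by simp
  from constant_law(1,3)[OF this] False show ?thesis unfolding component_def Let_def MM_Delta11_iff by auto
qed

lemma component_cyl:
  "emeasure (component X) (cyl x w) = ennreal (if positive_recurrent (freq_limit (incr X))
     then invariant_vector (freq_limit (incr X)) x * (\<Prod>r\<leftarrow>w. freq_limit (incr X) r)
     else point_vector (max 1 (X 0)) x * (\<Prod>r\<leftarrow>w. point_vector 1 r))"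
proof (cases "positive_recurrent (freq_limit (incr X))")
  case True
  then have e: "component X = markov_law (freq_limit (incr X)) (invariant_vector (freq_limit (incr X)))"
    by (simp add: component_def Let_def)
  show ?thesis
    unfolding e using True invariant_markov.cyl_prob[OF positive_recurrent_markov_law(1)[OF True]] by simp
next
  case False
  then have e: "component X = constant_law (max 1 (X 0))" by (simp add: component_def Let_def)
  have "1 \<le> max 1 (X 0)" by simp
  from invariant_markov.cyl_prob[OF constant_law(1)[OF this]] show ?thesis unfolding e using False by simp
qed

text \<open>In this form each condition is visibly measurable in \<open>q\<close>.\<close>

lemma positive_recurrent_iff:
  "positive_recurrent q \<longleftrightarrow> (\<forall>r. 0 \<le> q r) \<and> (\<Sum>r. ennreal (q r)) = 1 \<and> 0 < q 0 \<and>
     (\<forall>x. 0 \<le> invariant_weight q x) \<and> (\<Sum>x. ennreal (invariant_weight q x)) \<noteq> top"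
proof -
  have pv: "probability_vector q \<longleftrightarrow> (\<Sum>r. ennreal (q r)) = 1" if nn: "\<forall>r. 0 \<le> q r"
  proof
    assume s: "(\<Sum>r. ennreal (q r)) = 1"
    then have sm: "summable q" using nn by (intro summable_suminf_not_top) auto
    have "(\<Sum>r. ennreal (q r)) = ennreal (suminf q)" using nn sm by (intro suminf_ennreal2) auto
    then have "suminf q = 1" using s by simp
    then show "probability_vector q" using nn sm by (simp add: probability_vector_def sums_iff)
  qed (rule suminf_probability_vector)
  have sm: "summable (invariant_weight q) \<longleftrightarrow> (\<Sum>x. ennreal (invariant_weight q x)) \<noteq> top"
    if nn: "\<forall>x. 0 \<le> invariant_weight q x"
  proof
    assume "summable (invariant_weight q)"
    then have "(\<Sum>x. ennreal (invariant_weight q x)) = ennreal (suminf (invariant_weight q))"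
      using nn by (intro suminf_ennreal2) auto
    then show "(\<Sum>x. ennreal (invariant_weight q x)) \<noteq> top" by simp
  next
    assume "(\<Sum>x. ennreal (invariant_weight q x)) \<noteq> top"
    then show "summable (invariant_weight q)" using nn by (intro summable_suminf_not_top) auto
  qed
  show ?thesis
  proof
    assume pr: "positive_recurrent q"
    then have "\<forall>r. 0 \<le> q r" by (simp add: positive_recurrent_def probability_vector_def)
    then show "(\<forall>r. 0 \<le> q r) \<and> (\<Sum>r. ennreal (q r)) = 1 \<and> 0 < q 0 \<and>
     (\<forall>x. 0 \<le> invariant_weight q x) \<and> (\<Sum>x. ennreal (invariant_weight q x)) \<noteq> top"
      using pr pv sm unfolding positive_recurrent_def by blast
  next
    assume "(\<forall>r. 0 \<le> q r) \<and> (\<Sum>r. ennreal (q r)) = 1 \<and> 0 < q 0 \<and>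
     (\<forall>x. 0 \<le> invariant_weight q x) \<and> (\<Sum>x. ennreal (invariant_weight q x)) \<noteq> top"
    then show "positive_recurrent q" using pv sm unfolding positive_recurrent_def by blast
  qed
qed

lemma positive_recurrent_measurable [measurable]:
  "Measurable.pred (borel :: (nat \<Rightarrow> real) measure) positive_recurrent"
  unfolding positive_recurrent_iff[abs_def] by measurable

lemma component_measurable: "component \<in> measurable dsf_space MM_space"
proof (rule measurable_into_MM_space)
  fix x w
  define P1 where "P1 q = invariant_vector q x * (\<Prod>r\<leftarrow>w. q r)" for q :: "nat \<Rightarrow> real"
  have "(\<lambda>q. \<Prod>r\<leftarrow>w. q r) \<in> borel_measurable (borel :: (nat \<Rightarrow> real) measure)" by (induction w) simp_all
  then have [measurable]: "P1 \<in> borel_measurable borel"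
    unfolding P1_def[abs_def] invariant_vector_def by measurable
  define q where "q X = freq_limit (incr X)" for X
  have [measurable]: "q \<in> measurable dsf_space borel" unfolding q_def[abs_def] by measurable
  define c where "c X = point_vector (max 1 (X 0)) x" for X :: "nat \<Rightarrow> nat"
  have [measurable]: "c \<in> borel_measurable dsf_space"
  proof -
    have "(\<lambda>X. X 0) \<in> measurable dsf_space (count_space UNIV)" by measurable
    moreover have "(\<lambda>k. point_vector (max 1 k) x) \<in> borel_measurable (count_space UNIV)" by simp
    ultimately show ?thesis unfolding c_def[abs_def] by (rule measurable_compose)
  qed
  have "measure (component X) (cyl x w) =
      (if positive_recurrent (q X) then max 0 (P1 (q X)) else max 0 (c X * (\<Prod>r\<leftarrow>w. point_vector 1 r)))" for X
  proof -
    have e: "enn2real (ennreal y) = max 0 y" for y by (cases "0 \<le> y") (auto simp: ennreal_neg max_def)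
    show ?thesis unfolding measure_def component_cyl e by (simp add: P1_def q_def c_def)
  qed
  then show "(\<lambda>X. measure (component X) (cyl x w)) \<in> borel_measurable dsf_space"
    by simp
qed (rule component_in_MM)

text \<open>Almost surely \<open>p X = q\<close>. If \<open>q 0\<close> is positive, \<open>q\<close> determines the invariant distribution;
  otherwise ergodicity makes the path a constant.\<close>

lemma AE_component_eq:
  assumes "Q \<in> MM_Delta11"
  shows "AE X in Q. component X = Q"
proof -
  obtain q \<nu> where erg: "shift_ergodic Q" and inv: "invariant_markov Q q \<nu>"
    using assms unfolding MM_Delta11_iff by blast
  interpret invariant_markov Q q \<nu> by (rule inv)
  show ?thesis
  proof (cases "q 0 = 0")
    case True
    obtain c where c: "1 \<le> c" "AE X in Q. X = (\<lambda>_. c)" using ergodic_constant_if_q0_zero[OF True erg] by blast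
    have Q: "Q = constant_law c" by (rule eq_constant_law[OF path_law_axioms invariant c(2,1)])
    have np: "\<not> positive_recurrent q" using True by (simp add: positive_recurrent_def)
    show ?thesis using c(2) AE_p_eq
    proof eventually_elim
      case (elim X)
      have "max 1 (X 0) = c" using elim(1) c(1) by simp
      then have "component X = constant_law c" unfolding component_def elim(2) Let_def using np by simp
      then show ?case using Q by metis
    qed
  next
    case False
    then have q0: "0 < q 0" using q_nonneg[of 0] by simp
    note pr = \<nu>_eq_invariant_vector[OF q0]
    have "Q = markov_law q (invariant_vector q)"
    proof (rule dsf_law_eqI)
      interpret R: invariant_markov "markov_law q (invariant_vector q)" q "invariant_vector q"
        by (rule positive_recurrent_markov_law(1)[OF pr(1)])
      show "emeasure Q (cyl x w) = emeasure (markov_law q (invariant_vector q)) (cyl x w)" for x w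
        unfolding cyl_prob R.cyl_prob pr(2) ..
      show "sets (markov_law q (invariant_vector q)) = sets dsf_space" by (rule R.sets_P)
    qed (rule sets_P finite_measure_axioms)+
    note Q = this
    show ?thesis using AE_p_eq
    proof eventually_elim
      case (elim X)
      have "component X = markov_law q (invariant_vector q)" unfolding component_def elim Let_def using pr(1) by simp
      then show ?case using Q by metis
    qed
  qed
qed

context partially_exchangeable
begin

text \<open>Where \<open>p X 0\<close> is positive, the component is the Markov law with the conditional distribution of the
  start as its initial distribution, and the de Finetti formula applies. Elsewhere the path is constant
  and its component is the point mass at the path. The function \<open>\<psi>\<close> separates the two cases.\<close>

lemma nn_integral_component_cyl:
  "(\<integral>\<^sup>+X. emeasure (component X) (cyl x w) \<partial>P) = emeasure P (cyl x w)"
proof -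
  have [measurable]: "cyl x w \<in> sets P" by (rule cyl_sets_P)
  define \<psi> where "\<psi> q = (of_bool (0 < q 0) :: ennreal)" for q :: "nat \<Rightarrow> real"
  have \<psi>[measurable]: "\<psi> \<in> borel_measurable borel" unfolding \<psi>_def by measurable
  have prod_m[measurable]: "(\<lambda>q. \<Prod>r\<leftarrow>w. ennreal (q r)) \<in> borel_measurable (borel :: (nat \<Rightarrow> real) measure)"
    by (induction w) simp_all
  have prod_p[measurable]: "(\<lambda>X. \<Prod>r\<leftarrow>w. ennreal (p X r)) \<in> borel_measurable P"
    by (induction w) simp_all
  have AEs: "AE X in P. 0 < p X 0 \<longrightarrow> positive_recurrent (p X) \<and>
      start_density x (p X) = ennreal (invariant_vector (p X) x)"
  proof -
    have "AE q in p_law. 0 < q 0 \<longrightarrow> positive_recurrent q \<and>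
        start_density x q = ennreal (invariant_vector q x)"
      using AE_start_density_eq by eventually_elim blast
    then show ?thesis unfolding p_law_def by (rule AE_distrD[OF p_measurable])
  qed
  have "AE X in P. emeasure (component X) (cyl x w) =
      start_density x (p X) * ((\<Prod>r\<leftarrow>w. ennreal (p X r)) * \<psi> (p X)) +
         indicator (cyl x w) X * (1 - \<psi> (p X))"
    using AEs AE_zeros_iff_p_pos
  proof eventually_elim
    case (elim X)
    show ?case
    proof (cases "0 < p X 0")
      case True
      then have pr: "positive_recurrent (p X)" and s: "start_density x (p X) = ennreal (invariant_vector (p X) x)"
        using elim(1) by auto
      have nn: "0 \<le> invariant_vector (p X) x" using invariant_vector(1)[OF pr] by (simp add: probability_vector_def)
      have "0 \<le> (\<Prod>r\<leftarrow>w. p X r)" by (induction w) (simp_all add: freq_limit_bounds)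
      then show ?thesis
        unfolding component_cyl s using pr True nn
        by (simp add: \<psi>_def ennreal_mult ennreal_prod_list freq_limit_bounds)
    next
      case False
      then have c: "1 \<le> X 0" "\<forall>k. X k = X 0" using elim(2) by auto
      then obtain c where c': "X = (\<lambda>_. c)" "1 \<le> c" by (metis ext)
      have np: "\<not> positive_recurrent (p X)" using False by (auto simp: positive_recurrent_def)
      have "component X = constant_law c" unfolding component_def Let_def using np c' by (simp add: max_absorb2)
      moreover have "emeasure (constant_law c) (cyl x w) = indicator (cyl x w) (\<lambda>_. c)"
      proof -
        interpret C: invariant_markov "constant_law c" "point_vector 1" "point_vector c"
          by (rule constant_law(1)[OF c'(2)])
        show ?thesis
          by (rule ergodic_if_AE_constant(1)[OF C.path_law_axioms C.invariant constant_law(2)[OF c'(2)] C.cyl_sets_P])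
      qed
      ultimately show ?thesis using False c' by (simp add: \<psi>_def)
    qed
  qed
  then have "(\<integral>\<^sup>+X. emeasure (component X) (cyl x w) \<partial>P) =
      (\<integral>\<^sup>+X. start_density x (p X) * ((\<Prod>r\<leftarrow>w. ennreal (p X r)) * \<psi> (p X)) +
         indicator (cyl x w) X * (1 - \<psi> (p X)) \<partial>P)"
    by (rule nn_integral_cong_AE)
  also have "\<dots> = (\<integral>\<^sup>+X. start_density x (p X) * ((\<Prod>r\<leftarrow>w. ennreal (p X r)) * \<psi> (p X)) \<partial>P) +
      (\<integral>\<^sup>+X. indicator (cyl x w) X * (1 - \<psi> (p X)) \<partial>P)"
    by (rule nn_integral_add) measurable
  also have "(\<integral>\<^sup>+X. start_density x (p X) * ((\<Prod>r\<leftarrow>w. ennreal (p X r)) * \<psi> (p X)) \<partial>P) =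
      (\<integral>\<^sup>+q. start_density x q * ((\<Prod>r\<leftarrow>w. ennreal (q r)) * \<psi> q) \<partial>p_law)"
    by (rule nn_integral_p_law[symmetric]) measurable
  also have "\<dots> = (\<integral>\<^sup>+X. indicator (cyl x []) X * ((\<Prod>r\<leftarrow>w. ennreal (p X r)) * \<psi> (p X)) \<partial>P)"
    by (rule nn_integral_start[symmetric]) measurable
  also have "\<dots> = (\<integral>\<^sup>+X. indicator (cyl x w) X * \<psi> (p X) \<partial>P)"
    by (rule de_Finetti_formula[symmetric]) (simp_all add: \<psi>_def \<psi>[unfolded \<psi>_def[abs_def]])
  also have "\<dots> + (\<integral>\<^sup>+X. indicator (cyl x w) X * (1 - \<psi> (p X)) \<partial>P) =
      (\<integral>\<^sup>+X. indicator (cyl x w) X * \<psi> (p X) + indicator (cyl x w) X * (1 - \<psi> (p X)) \<partial>P)"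
    by (rule nn_integral_add[symmetric]) measurable
  also have "\<dots> = (\<integral>\<^sup>+X. indicator (cyl x w) X \<partial>P)"
    by (intro nn_integral_cong) (simp add: \<psi>_def of_bool_def)
  finally show ?thesis by simp
qed

lemma component_measurable_P: "component \<in> measurable P MM_space"
  using component_measurable measurable_cong_sets[OF sets_P refl] by blast

lemma component_decomposition:
  assumes A: "A \<in> sets dsf_space"
  shows "emeasure P A = (\<integral>\<^sup>+X. emeasure (component X) A \<partial>P)"
proof -
  have k: "component \<in> measurable P (subprob_algebra dsf_space)"
    using measurable_compose[OF component_measurable_P id_MM_measurable] by simp
  have ne: "space P \<noteq> {}" by (rule not_empty)
  have b: "emeasure (bind P component) A = (\<integral>\<^sup>+X. emeasure (component X) A \<partial>P)" if "A \<in> sets dsf_space" for A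
    by (rule emeasure_bind[OF ne k that])
  have "P = bind P component"
  proof (rule dsf_law_eqI)
    show "sets (bind P component) = sets dsf_space" by (rule sets_bind[OF sets_kernel[OF k] ne])
    show "emeasure P (cyl x w) = emeasure (bind P component) (cyl x w)" for x w
      unfolding b[OF cyl_sets] nn_integral_component_cyl ..
  qed (rule sets_P finite_measure_axioms)+
  then show ?thesis using b[OF A] by metis
qed

text \<open>Both existence and uniqueness say that the representing measure is the distribution of the
  component.\<close>

theorem ergodic_decomposition:
  "\<exists>!\<mu>. prob_space \<mu> \<and> sets \<mu> = sets MM_space \<and>
    (\<forall>A\<in>sets dsf_space. emeasure P A = (\<integral>\<^sup>+ Q. emeasure Q A \<partial>\<mu>))"
proof (rule ex1I)
  let ?\<mu> = "distr P MM_space component"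
  have ev: "(\<lambda>Q. emeasure Q A) \<in> borel_measurable MM_space" if "A \<in> sets dsf_space" for A
    using measurable_compose[OF id_MM_measurable measurable_emeasure_subprob_algebra[OF that]] .
  show "prob_space ?\<mu> \<and> sets ?\<mu> = sets MM_space \<and>
    (\<forall>A\<in>sets dsf_space. emeasure P A = (\<integral>\<^sup>+ Q. emeasure Q A \<partial>?\<mu>))"
  proof (intro conjI ballI)
    show "prob_space ?\<mu>" by (rule prob_space_distr[OF component_measurable_P])
    fix A assume A: "A \<in> sets dsf_space"
    show "emeasure P A = (\<integral>\<^sup>+ Q. emeasure Q A \<partial>?\<mu>)"
      unfolding component_decomposition[OF A]
      by (rule nn_integral_distr[OF component_measurable_P, symmetric]) (simp add: ev[OF A])
  qed simp
  fix \<mu> assume "prob_space \<mu> \<and> sets \<mu> = sets MM_space \<and>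
    (\<forall>A\<in>sets dsf_space. emeasure P A = (\<integral>\<^sup>+ Q. emeasure Q A \<partial>\<mu>))"
  then have sets: "sets \<mu> = sets MM_space"
    and repr: "\<And>A. A \<in> sets dsf_space \<Longrightarrow> emeasure P A = (\<integral>\<^sup>+ Q. emeasure Q A \<partial>\<mu>)" by auto
  have sp: "space \<mu> = MM_Delta11" using sets_eq_imp_space_eq[OF sets] by simp
  show "\<mu> = ?\<mu>"
  proof (rule measure_eqI)
    show "sets \<mu> = sets ?\<mu>" by (simp add: sets)
    fix E assume E: "E \<in> sets \<mu>"
    then have E': "E \<in> sets MM_space" by (simp add: sets)
    define A where "A = component -` E \<inter> dsf_seqs"
    have A: "A \<in> sets dsf_space" using measurable_sets[OF component_measurable E'] by (simp add: A_def)
    have Q: "emeasure Q A = indicator E Q" if "Q \<in> space \<mu>" for Q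
    proof -
      have QM: "Q \<in> MM_Delta11" using that sp by simp
      then have "path_law Q" using MM_subset by (auto simp: dsf_laws_iff[symmetric])
      interpret Q: path_law Q by fact
      have "emeasure Q A = (\<integral>\<^sup>+X. indicator A X \<partial>Q)" using A Q.sets_P by simp
      also have "\<dots> = (\<integral>\<^sup>+X. indicator E Q \<partial>Q)"
      proof (rule nn_integral_cong_AE)
        show "AE X in Q. indicator A X = (indicator E Q :: ennreal)"
          using AE_component_eq[OF QM] AE_space by eventually_elim (simp add: A_def indicator_def)
      qed
      also have "\<dots> = indicator E Q" using Q.emeasure_space_1 by simp
      finally show ?thesis .
    qed
    have "emeasure ?\<mu> E = emeasure P (component -` E \<inter> space P)"
      by (rule emeasure_distr[OF component_measurable_P E'])
    also have "\<dots> = (\<integral>\<^sup>+ Q. emeasure Q A \<partial>\<mu>)" using repr[OF A] by (simp add: A_def)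
    also have "\<dots> = (\<integral>\<^sup>+ Q. indicator E Q \<partial>\<mu>)" by (rule nn_integral_cong) (rule Q)
    also have "\<dots> = emeasure \<mu> E" using E by simp
    finally show "emeasure \<mu> E = emeasure ?\<mu> E" by simp
  qed
qed

end

section \<open>Laws summarized by the statistic\<close>

lemma initial_string_measurable: "initial_string n \<in> measurable dsf_space (count_space UNIV)"
proof (subst measurable_count_space_eq2_countable, intro conjI ballI)
  fix a :: "nat list"
  show "initial_string n -` {a} \<inter> space dsf_space \<in> sets dsf_space"
  proof (cases "length a = n")
    case True
    have "{X \<in> space dsf_space. \<forall>i<n. X i = a ! i} \<in> sets dsf_space" by measurable
    moreover have "initial_string n -` {a} \<inter> space dsf_space = {X \<in> space dsf_space. \<forall>i<n. X i = a ! i}"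
      using True by (auto simp: initial_string_eq_iff)
    ultimately show ?thesis by metis
  next
    case False
    then have "initial_string n -` {a} = {}" by auto
    then show ?thesis by simp
  qed
qed auto

text \<open>Two words with the same multiset and end point lead to strings in one fibre of \<open>tau\<close>, on which the
  conditional law is uniform.\<close>

lemma summarized_imp_partially_exchangeable:
  assumes "path_law P" and inv: "shift_invariant P" and tau: "summarized_by_tau P"
  shows "partially_exchangeable P"
proof -
  interpret path_law P by fact
  have im: "initial_string n \<in> measurable P (count_space UNIV)" for n
    using initial_string_measurable measurable_cong_sets[OF sets_P refl] by blast
  have "emeasure P (cyl x w) = emeasure P (cyl x w')"
    if m: "mset w = mset w'" and e: "endpoint x w = endpoint x w'" for x w w'
  proof -
    define n where "n = Suc (length w)"
    have l: "length w' = length w" using m by (metis size_mset)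
    define r where "r = tau (states x w)"
    have r': "tau (states x w') = r" unfolding r_def by (rule tau_states_eq[OF m e, symmetric])
    define T where "T = {X \<in> space P. tau (initial_string n X) = r}"
    have T: "T \<in> sets P"
    proof -
      have "initial_string n -` {a. tau a = r} \<inter> space P \<in> sets P" by (rule measurable_sets[OF im]) simp
      moreover have "initial_string n -` {a. tau a = r} \<inter> space P = T" by (auto simp: T_def)
      ultimately show ?thesis by simp
    qed
    have sub: "cyl x u \<subseteq> T" if "length u = length w" "tau (states x u) = r" for u
      using that unfolding cyl_states T_def n_def by auto
    show ?thesis
    proof (cases "emeasure P T = 0")
      case True
      then have "emeasure P (cyl x u) = 0" if "length u = length w" "tau (states x u) = r" for u
        using emeasure_mono[OF sub[OF that] T] by simp
      then show ?thesis using l r' by (simp add: r_def)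
    next
      case False
      then have pos: "emeasure P T > 0" by (simp add: zero_less_iff_neq_zero)
      define S where "S = {a \<in> dsf_strings n. tau a = r}"
      have S: "finite S" unfolding S_def n_def by (rule finite_tau_fibre)
      have eq: "distr (uniform_measure P T) (count_space UNIV) (initial_string n) = measure_pmf (pmf_of_set S)"
        using tau[unfolded summarized_by_tau_def, rule_format, of n r] pos
        unfolding T_def S_def by (simp add: n_def)
      have uim: "initial_string n \<in> measurable (uniform_measure P T) (count_space UNIV)"
        using im measurable_cong_sets[OF sets_uniform_measure refl] by blast
      have "emeasure P (cyl x u) / emeasure P T = ennreal (1 / card S)"
        if u: "length u = length w" "tau (states x u) = r" for u
      proof -
        have uS: "states x u \<in> S" using states_dsf[of x u] u by (simp add: S_def n_def)
        have "T \<inter> (initial_string n -` {states x u} \<inter> space (uniform_measure P T)) = cyl x u"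
          using sub[OF u] u(1) unfolding cyl_states by (auto simp: n_def)
        moreover have "initial_string n -` {states x u} \<inter> space (uniform_measure P T) \<in> sets P"
          using measurable_sets[OF uim, of "{states x u}"] by simp
        ultimately have "emeasure (uniform_measure P T) (initial_string n -` {states x u} \<inter> space (uniform_measure P T)) =
            emeasure P (cyl x u) / emeasure P T"
          using emeasure_uniform_measure[OF T] by simp
        then have "emeasure P (cyl x u) / emeasure P T = emeasure (measure_pmf (pmf_of_set S)) {states x u}"
          unfolding eq[symmetric] by (subst emeasure_distr[OF uim]) simp_all
        also have "\<dots> = ennreal (1 / card S)"
          using uS S by (subst emeasure_pmf_single, subst pmf_of_set) auto
        finally show ?thesis .
      qed
      from this[of w] this[of w'] have "emeasure P (cyl x w) / emeasure P T = emeasure P (cyl x w') / emeasure P T"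
        using l r' by (simp add: r_def)
      then have "emeasure P (cyl x w) / emeasure P T * emeasure P T = emeasure P (cyl x w') / emeasure P T * emeasure P T"
        by simp
      then show ?thesis using False by (simp add: ennreal_divide_times ennreal_divide_self emeasure_eq_measure)
    qed
  qed
  then show ?thesis using inv by unfold_locales
qed

theorem theorem3p5:
  fixes P :: "(nat \<Rightarrow> nat) measure"
  assumes "P \<in> dsf_laws"
    and "shift_invariant P"
    and "summarized_by_tau P"
  shows "\<exists>!\<mu>. prob_space \<mu> \<and> sets \<mu> = sets MM_space \<and>
    (\<forall>A\<in>sets dsf_space. emeasure P A = (\<integral>\<^sup>+ Q. emeasure Q A \<partial>\<mu>))"
proof -
  have "path_law P" using assms(1) by (simp add: dsf_laws_iff)
  then interpret partially_exchangeable P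
    using assms(2,3) by (rule summarized_imp_partially_exchangeable)
  show ?thesis by (rule ergodic_decomposition)
qed

end
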